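(* Let $F\in EFG(\mathbb{R}^{2d})$ be polyradial, let $F_0$ be its representation on $V^d=[0,\infty)^d$, and let $k\in\mathbb{N}_0^d$. Then the eigenfunctions of the localization operator $A_F^{\phi_k}$ are the product Hermite functions $\{\phi_n\}_{n\in\mathbb{N}_0^d}$ (an orthonormal basis of $L^2(\mathbb{R}^d)$), and the $n$-th eigenvalue, i.e. the number with $A_F^{\phi_k}\phi_n=c_{n,k}(F)\phi_n$, is $$c_{n,k}(F)=\frac{k!}{n!}\int_{V^d}u^{n-k}e^{-(u_1+\dots+u_d)}\Bigl(\prod_{j=1}^dL_{k_j}^{n_j-k_j}(u_j)\Bigr)^2F_0\Bigl(\sqrt{\tfrac{u}{\pi}}\Bigr)\,du .$$
   Context: Identify $\mathbb{R}^{2d}$ with $\mathbb{C}^d$ via $(x,\omega)\mapsto z=(x_1+i\omega_1,\dots,x_d+i\omega_d)$. For $z=(x,\omega)$, $\pi(z)g(t)=e^{2\pi i\langle t,\omega\rangle}g(t-x)$, and the short-time Fourier transform is $V_gf(z)=\langle f,\pi(z)g\rangle$ (inner products antilinear in the second slot). The localization operator with mask $F$ and window $g\in L^2(\mathbb{R}^d)$ is defined weakly by $A_F^gf=\int_{\mathbb{R}^{2d}}F(z)V_gf(z)\pi(z)g\,dz$, i.e. $\langle A_F^gf,h\rangle=\int F(z)V_gf(z)\overline{V_gh(z)}\,dz$, read as a duality pairing if $F$ is a distribution. Hermite functions: $\phi_n(t)=\frac{2^{1/4}}{\sqrt{n!}}\bigl(\frac{-1}{2\sqrt{\pi}}\bigr)^ne^{\pi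 t^2}\frac{d^n}{dt^n}(e^{-2\pi t^2})$ for $n\in\mathbb{N}_0$, $t\in\mathbb{R}$, and $\phi_n(t_1,\dots,t_d)=\prod_j\phi_{n_j}(t_j)$ for $n\in\mathbb{N}_0^d$. Feichtinger's algebra is $S_0(\mathbb{R}^m)=\{f\in\mathscr{S}'(\mathbb{R}^m):V_{\phi_0}f\in L^1(\mathbb{R}^{2m})\}$ ($\phi_0$ the standard Gaussian) and $S_0'(\mathbb{R}^m)$ is its dual. The Fernández–Galbis class $FG(\mathbb{R}^{2d})$ is the set of $G\in S_0'(\mathbb{R}^{2d})$ for which there is $\Phi\in\mathscr{S}(\mathbb{R}^{2d})\setminus\{0\}$ such that for all $R>0$, $\lim_{|x|\to\infty}\sup_{|\omega|<R}|V_\Phi G(x,\omega)|=0$ (here $x,\omega\in\mathbb{R}^{2d}$). The extended class is $EFG(\mathbb{R}^{2d})=\{c+G:c\in\mathbb{C},\,G\in FG(\mathbb{R}^{2d})\}$. A tempered distribution on $\mathbb{R}^{2d}\cong\mathbb{C}^d$ is polyradial if it is invariant under all maps $(z_1,\dots,z_d)\mapsto(e^{i\theta_1}z_1,\dots,e^{i\theta_d}z_d)$. A polyradial function is written $F(z)=F_0(|z_1|,\dots,|z_d|)$ with $F_0$ on $V^d$. If $F$ is a distribution, the eigenvalue integral is interpreted distributionally, as the pairing of $F$ with the function of $z$ obtained from the rest of the integrand by substituting $u_j=\pi|z_j|^2$. Multi-index notation: $k!=\prod_jk_j!$, $u^{n-k}=\prod_ju_j^{n_j-k_j}$, and $\sqrt{u/\pi}$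 is taken componentwise. Laguerre polynomials: $L_k^\alpha(t)=\sum_{j=0}^k(-1)^j\binom{k+\alpha}{k-j}\frac{t^j}{j!}$; if $n_j<k_j$, $L_{k_j}^{n_j-k_j}$ is interpreted through the reflection identity $\frac{(-t)^n}{n!}L_j^{n-j}(t)=\frac{(-t)^j}{j!}L_n^{j-n}(t)$. *)

theory Defs
  imports "HOL-Analysis.Analysis"
begin

text \<open>
  The Euclidean space \<open>\<real>\<^sup>m\<close> is an arbitrary type of class \<^class>\<open>euclidean_space\<close>. The
  configuration space \<open>\<real>\<^sup>d\<close> is \<^typ>\<open>real ^ 'd\<close>, and \<open>\<real>\<^sup>2\<^sup>d\<close> is its square; a point
  \<open>(x, \<omega>)\<close> stands for the complex vector with components \<open>x\<^sub>j + i \<omega>\<^sub>j\<close>.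
\<close>

type_synonym 'd phase = "(real ^ 'd) \<times> (real ^ 'd)"

text \<open>A functional on functions, used for tempered distributions on \<^typ>\<open>'a\<close>.\<close>

type_synonym 'a distr = "('a \<Rightarrow> complex) \<Rightarrow> complex"

section \<open>Square-integrable functions\<close>

definition L2 :: "('a::euclidean_space \<Rightarrow> complex) set" where
  "L2 = {f. f \<in> borel_measurable lborel \<and> integrable lborel (\<lambda>t. (cmod (f t))\<^sup>2)}"

definition L2_inner :: "('a::euclidean_space \<Rightarrow> complex) \<Rightarrow> ('a \<Rightarrow> complex) \<Rightarrow> complex" where
  "L2_inner f g = (LINT t|lborel. f t * cnj (g t))"

text \<open>The last clause says that the linear span of the family is dense in \<open>L\<^sup>2\<close>.\<close>

definition orthonormal_basis_L2 :: "('i \<Rightarrow> 'a::euclidean_space \<Rightarrow> complex) \<Rightarrow> bool" where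
  "orthonormal_basis_L2 e \<longleftrightarrow>
     (\<forall>i. e i \<in> L2) \<and>
     (\<forall>i j. L2_inner (e i) (e j) = (if i = j then 1 else 0)) \<and>
     (\<forall>f\<in>L2. \<forall>\<epsilon>>0. \<exists>I a. finite I \<and>
        (LINT t|lborel. (cmod (f t - (\<Sum>i\<in>I. a i * e i t)))\<^sup>2) < \<epsilon>)"

section \<open>Schwartz functions and tempered distributions\<close>

fun partials :: "'a::euclidean_space list \<Rightarrow> ('a \<Rightarrow> complex) \<Rightarrow> 'a \<Rightarrow> complex" where
  "partials [] f = f"
| "partials (b # bs) f = (\<lambda>x. frechet_derivative (partials bs f) (at x) b)"

definition schwartz :: "('a::euclidean_space \<Rightarrow> complex) set" where
  "schwartz = {f. \<forall>bs. set bs \<subseteq> Basis \<longrightarrow>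
     (\<forall>x. partials bs f differentiable (at x)) \<and>
     (\<forall>N. bounded (range (\<lambda>x. (1 + norm x) ^ N *\<^sub>R partials bs f x)))}"

definition schwartz_norm :: "nat \<Rightarrow> ('a::euclidean_space \<Rightarrow> complex) \<Rightarrow> real" where
  "schwartz_norm N f =
     (SUP (bs, x) \<in> {bs. set bs \<subseteq> Basis \<and> length bs \<le> N} \<times> UNIV.
        (1 + norm x) ^ N * cmod (partials bs f x))"

text \<open>
  Distributions are complex linear functionals. They vanish outside the Schwartz space by
  convention, so that they are equal as functions iff they agree on Schwartz functions.
\<close>

definition tempered :: "'a::euclidean_space distr set" where
  "tempered = {u.
     (\<forall>f\<in>schwartz. \<forall>g\<in>schwartz. u (\<lambda>t. f t + g t) = u f + u g) \<and>
     (\<forall>c. \<forall>f\<in>schwartz. u (\<lambda>t. c * f t) = c * u f) \<and>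
     (\<exists>C N. \<forall>f\<in>schwartz. cmod (u f) \<le> C * schwartz_norm N f) \<and>
     (\<forall>f. f \<notin> schwartz \<longrightarrow> u f = 0)}"

definition regular_distr :: "('a::euclidean_space \<Rightarrow> complex) \<Rightarrow> 'a distr" where
  "regular_distr f = (\<lambda>\<phi>. if \<phi> \<in> schwartz then LINT t|lborel. f t * \<phi> t else 0)"

section \<open>Time-frequency analysis\<close>

definition tf_shift :: "'a::euclidean_space \<times> 'a \<Rightarrow> ('a \<Rightarrow> complex) \<Rightarrow> 'a \<Rightarrow> complex" where
  "tf_shift = (\<lambda>(x, \<omega>) g t. exp (2 * pi * \<i> * (t \<bullet> \<omega>)) * g (t - x))"

definition stft :: "('a::euclidean_space \<Rightarrow> complex) \<Rightarrow> ('a \<Rightarrow> complex) \<Rightarrow> 'a \<times> 'a \<Rightarrow> complex" where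
  "stft g f z = L2_inner f (tf_shift z g)"

text \<open>
  Since distributions are linear, the sesquilinear bracket \<open>\<langle>u, \<pi>(z) g\<rangle>\<close> is \<open>u\<close> applied to the
  conjugate of \<open>\<pi>(z) g\<close>.
\<close>

definition stft_distr :: "('a::euclidean_space \<Rightarrow> complex) \<Rightarrow> 'a distr \<Rightarrow> 'a \<times> 'a \<Rightarrow> complex" where
  "stft_distr g u z = u (\<lambda>t. cnj (tf_shift z g t))"

definition std_gauss :: "'a::euclidean_space \<Rightarrow> complex" where
  "std_gauss t = of_real (2 powr (DIM('a) / 4) * exp (- pi * (norm t)\<^sup>2))"

definition S0 :: "'a::euclidean_space distr set" where
  "S0 = {u \<in> tempered. integrable lborel (stft_distr std_gauss u)}"

definition S0_norm :: "'a::euclidean_space distr \<Rightarrow> real" where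
  "S0_norm u = (LINT z|lborel. cmod (stft_distr std_gauss u z))"

definition S0_dual :: "('a::euclidean_space distr \<Rightarrow> complex) set" where
  "S0_dual = {G.
     (\<forall>u\<in>S0. \<forall>v\<in>S0. G (\<lambda>\<phi>. u \<phi> + v \<phi>) = G u + G v) \<and>
     (\<forall>c. \<forall>u\<in>S0. G (\<lambda>\<phi>. c * u \<phi>) = c * G u) \<and>
     (\<exists>C. \<forall>u\<in>S0. cmod (G u) \<le> C * S0_norm u)}"

text \<open>
  The bilinear pairing of an element of \<open>S0_dual\<close> with a function. On Schwartz functions this is
  the embedding of \<open>S0_dual\<close> into the tempered distributions.
\<close>

definition pairing :: "('a::euclidean_space distr \<Rightarrow> complex) \<Rightarrow> ('a \<Rightarrow> complex) \<Rightarrow> complex" where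
  "pairing G f = G (regular_distr f)"

definition FG :: "('a::euclidean_space distr \<Rightarrow> complex) set" where
  "FG = {G \<in> S0_dual. \<exists>\<Phi>\<in>schwartz. \<Phi> \<noteq> (\<lambda>_. 0) \<and>
     (\<forall>R>0. ((\<lambda>x. SUP \<omega>\<in>ball 0 R. cmod (stft_distr \<Phi> (pairing G) (x, \<omega>))) \<longlongrightarrow> 0) at_infinity)}"

text \<open>
  \<open>F = c + G\<close> as functionals on \<open>S0\<close>; every element of \<open>S0\<close> is the regular distribution of an
  integrable function \<open>f\<close>, on which the constant \<open>c\<close> acts as \<open>c\<close> times the integral of \<open>f\<close>.
\<close>

definition EFG :: "('a::euclidean_space distr \<Rightarrow> complex) set" where
  "EFG = {F \<in> S0_dual. \<exists>c. \<exists>G\<in>FG. \<forall>f. integrable lborel f \<and> regular_distr f \<in> S0 \<longrightarrow>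
     pairing F f = c * (LINT t|lborel. f t) + pairing G f}"

text \<open>
  \<open>has_localization F g f v\<close> is the weak identity \<open>A\<^sub>F\<^sup>g f = v\<close>: the inner product of \<open>v\<close> with
  every \<open>h\<close> in \<open>L\<^sup>2\<close> is the duality pairing of \<open>F\<close> with \<open>V\<^sub>gf\<close> times the conjugate of
  \<open>V\<^sub>gh\<close>, where this product is required to lie in \<open>S0\<close> so that the pairing is meaningful. It
  determines \<open>v\<close> up to a null set.
\<close>

definition has_localization ::
  "(('a \<times> 'a) distr \<Rightarrow> complex) \<Rightarrow> ('a::euclidean_space \<Rightarrow> complex) \<Rightarrow>
     ('a \<Rightarrow> complex) \<Rightarrow> ('a \<Rightarrow> complex) \<Rightarrow> bool" where
  "has_localization F g f v \<longleftrightarrow> g \<in> L2 \<and> f \<in> L2 \<and> v \<in> L2 \<and>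
     (\<forall>h\<in>L2. regular_distr (\<lambda>z. stft g f z * cnj (stft g h z)) \<in> S0 \<and>
        L2_inner v h = pairing F (\<lambda>z. stft g f z * cnj (stft g h z)))"

section \<open>Polyradial distributions\<close>

definition rotate_phase :: "real ^ 'd \<Rightarrow> 'd::finite phase \<Rightarrow> 'd phase" where
  "rotate_phase \<theta> = (\<lambda>(x, \<omega>).
     (\<chi> j. Re (cis (\<theta> $ j) * Complex (x $ j) (\<omega> $ j)),
      \<chi> j. Im (cis (\<theta> $ j) * Complex (x $ j) (\<omega> $ j))))"

definition polyradial :: "'d::finite phase distr \<Rightarrow> bool" where
  "polyradial u \<longleftrightarrow> (\<forall>\<theta>. \<forall>\<phi>\<in>schwartz. u (\<lambda>z. \<phi> (rotate_phase \<theta> z)) = u \<phi>)"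

definition moduli :: "'d::finite phase \<Rightarrow> real ^ 'd" where
  "moduli = (\<lambda>(x, \<omega>). \<chi> j. cmod (Complex (x $ j) (\<omega> $ j)))"

definition Vd :: "(real ^ 'd::finite) set" where
  "Vd = {u. \<forall>j. 0 \<le> u $ j}"

text \<open>\<open>F\<close> is (integration against) the polyradial function \<open>z \<mapsto> F\<^sub>0(|z\<^sub>1|, \<dots>, |z\<^sub>d|)\<close>.\<close>

definition polyradial_representation ::
  "('d::finite phase distr \<Rightarrow> complex) \<Rightarrow> (real ^ 'd \<Rightarrow> complex) \<Rightarrow> bool" where
  "polyradial_representation F F0 \<longleftrightarrow> (\<forall>\<phi>\<in>schwartz.
     integrable lborel (\<lambda>z. F0 (moduli z) * \<phi> z) \<and>
     pairing F \<phi> = (LINT z|lborel. F0 (moduli z) * \<phi> z))"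

section \<open>Hermite functions and Laguerre polynomials\<close>

definition hermite1 :: "nat \<Rightarrow> real \<Rightarrow> real" where
  "hermite1 n t = 2 powr (1 / 4) / sqrt (fact n) * (- 1 / (2 * sqrt pi)) ^ n * exp (pi * t\<^sup>2) *
     (deriv ^^ n) (\<lambda>s. exp (- 2 * pi * s\<^sup>2)) t"

definition hermite :: "nat ^ 'd \<Rightarrow> real ^ 'd::finite \<Rightarrow> complex" where
  "hermite n t = of_real (\<Prod>j\<in>UNIV. hermite1 (n $ j) (t $ j))"

definition laguerre :: "nat \<Rightarrow> real \<Rightarrow> real \<Rightarrow> real" where
  "laguerre k \<alpha> t = (\<Sum>j\<le>k. (- 1) ^ j * ((real k + \<alpha>) gchoose (k - j)) * t ^ j / fact j)"

text \<open>
  \<open>L\<^sub>k\<^sup>n\<^sup>-\<^sup>k(t)\<close>, where for \<open>n < k\<close> the identity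
  \<open>(-t)\<^sup>n / n! L\<^sub>k\<^sup>n\<^sup>-\<^sup>k(t) = (-t)\<^sup>k / k! L\<^sub>n\<^sup>k\<^sup>-\<^sup>n(t)\<close> is solved for it.
\<close>

definition laguerre_diff :: "nat \<Rightarrow> nat \<Rightarrow> real \<Rightarrow> real" where
  "laguerre_diff k n t =
     (if k \<le> n then laguerre k (real n - real k) t
      else fact n / fact k * (- t) ^ (k - n) * laguerre n (real k - real n) t)"

definition multi_fact :: "nat ^ 'd::finite \<Rightarrow> real" where
  "multi_fact n = (\<Prod>j\<in>UNIV. fact (n $ j))"

text \<open>
  The exponent \<open>n\<^sub>j - k\<^sub>j\<close> is an integer and may be negative; the double zero of the Laguerre
  factor at \<open>0\<close> then compensates. With the convention \<open>inverse 0 = 0\<close> the value at \<open>u\<^sub>j = 0\<close> is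
  \<open>0\<close>, which is the continuous extension.
\<close>

definition eigen_weight :: "nat ^ 'd \<Rightarrow> nat ^ 'd \<Rightarrow> real ^ 'd::finite \<Rightarrow> real" where
  "eigen_weight n k u =
     (\<Prod>j\<in>UNIV. (u $ j) powi (int (n $ j) - int (k $ j))) * exp (- (\<Sum>j\<in>UNIV. u $ j)) *
     (\<Prod>j\<in>UNIV. laguerre_diff (k $ j) (n $ j) (u $ j))\<^sup>2"

text \<open>
  \<open>k!/n! \<integral> eigen_weight n k u F\<^sub>0(\<surd>(u/\<pi>)) du\<close> read distributionally: the substitution
  \<open>u\<^sub>j = \<pi> |z\<^sub>j|\<^sup>2\<close> carries Lebesgue measure on \<open>\<real>\<^sup>2\<^sup>d\<close> to Lebesgue measure on \<open>V\<^sup>d\<close>, so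
  no Jacobian factor appears.
\<close>

definition eigenvalue ::
  "nat ^ 'd \<Rightarrow> nat ^ 'd \<Rightarrow> ('d::finite phase distr \<Rightarrow> complex) \<Rightarrow> complex" where
  "eigenvalue n k F = of_real (multi_fact k / multi_fact n) *
     pairing F (\<lambda>z. of_real (eigen_weight n k (\<chi> j. pi * (moduli z $ j)\<^sup>2)))"

end

theory Submission
  imports Defs "HOL-Probability.Probability" "HOL-Real_Asymp.Real_Asymp"
begin

text \<open>
  Write \<open>V\<^sub>k h\<close> for the short-time Fourier transform of \<open>h\<close> with window \<open>\<phi>\<^sub>k\<close>. All functions
  built from Hermite functions factor over the coordinates. In one coordinate, integration by parts
  turns the ladder relations of the Hermite functions into recurrences for \<open>V\<^sub>k \<phi>\<^sub>n\<close>, which is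
  therefore a Gaussian times a phase times a polynomial in \<open>z\<close> and its conjugate, homogeneous of
  degree \<open>k - n\<close> under rotations. Hence \<open>V\<^sub>k \<phi>\<^sub>n\<close> times the conjugate of \<open>V\<^sub>k \<phi>\<^sub>m\<close> is a Schwartz
  function; a polyradial \<open>F\<close> annihilates it for \<open>n \<noteq> m\<close>, and for \<open>n = m\<close> it is the Laguerre weight
  of the eigenvalue formula. To pass from \<open>h = \<phi>\<^sub>m\<close> to arbitrary \<open>h \<in> L\<^sup>2\<close>, write
  \<open>V\<^sub>k \<phi>\<^sub>n\<close> times the conjugate of \<open>V\<^sub>k h\<close> as a superposition, weighted by the conjugate of
  \<open>h(t)\<close>, of functions \<open>z \<mapsto> V\<^sub>k \<phi>\<^sub>n(z) \<cdot> \<pi>(z) \<phi>\<^sub>k(t)\<close> whose \<open>S\<^sub>0\<close>-norm decays like a Gaussian in \<open>t\<close>;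
  so the \<open>S\<^sub>0\<close>-norm of the product is bounded by the \<open>L\<^sup>2\<close>-norm of \<open>h\<close>, and the completeness of the
  Hermite functions concludes. Completeness follows because the closed span contains
  \<open>exp (i t \<bullet> \<xi>) \<phi>\<^sub>0(t)\<close> for every \<open>\<xi>\<close>, hence, by a monotone class argument, \<open>1\<^sub>A \<phi>\<^sub>0\<close> for every
  Borel set \<open>A\<close>.
\<close>

section \<open>Product functions on the configuration space and on phase space\<close>

text \<open>A functional in \<open>S0_dual\<close> is bounded only in the norm of \<open>S0\<close>,
  so the limit from Hermite sums to a general \<open>h\<close> needs an integral bound over the
  doubled phase space, not just on phase space. The superposition supplies it for two reasons. The
  modulation in \<open>tf_shift\<close> by frequency t merely translates the transform of the kernel
  in the frequency dual to \<omega>, and the integral over frequencies does not see a translation.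
  The factor \<open>hermite k (t - x)\<close>, together with the Gaussian decay of the other factor
  in x, forces Gaussian decay in t, which is square integrable and can be paired with
  \<open>h\<close>. Decay in frequency like 1 / ((1 + e1^2) (1 + e2^2)) suffices, and two
  integrations by parts per variable give it. To differentiate freely, everything is kept inside
  classes \<open>poly_times E\<close>: polynomials times a fixed exponential of a quadratic, stable
  under derivatives and bounded by a Gaussian. The quadratic is not always diagonal: translating
  before modulating leaves the phase exp (- pi i x \<omega>) in the transform, and this phase
  disappears only in products with a conjugate.\<close>

lemma prod_Basis_vec: "(\<Prod>b\<in>(Basis :: (real^'d::finite) set). f b) = (\<Prod>j\<in>UNIV. f (axis j 1))"
proof -
  have B: "(Basis :: (real^'d) set) = range (\<lambda>j. axis j 1)"
    unfolding Basis_vec_def by auto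
  have "inj (\<lambda>j::'d. axis j (1::real))"
    by (auto simp: inj_on_def axis_eq_axis)
  then show ?thesis unfolding B by (simp add: prod.reindex)
qed

lemma prod_Basis_Pair:
  "(\<Prod>b\<in>(Basis :: ('a::euclidean_space \<times> 'b::euclidean_space) set). f b) =
     (\<Prod>b\<in>Basis. f (b, 0)) * (\<Prod>b\<in>Basis. f (0, b))"
proof -
  have "inj_on (\<lambda>u::'a. (u, 0::'b)) Basis" "inj_on (\<lambda>u::'b. (0::'a, u)) Basis"
    by (auto simp: inj_on_def)
  moreover have "((\<lambda>u::'a. (u, 0::'b)) ` Basis) \<inter> ((\<lambda>u::'b. (0::'a, u)) ` Basis) = {}"
    by auto
  ultimately show ?thesis
    unfolding Basis_prod_def by (simp add: prod.union_disjoint prod.reindex)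
qed

lemma measurable_vec_lambda_component [measurable]:
  fixes g :: "'a \<Rightarrow> 'd::finite \<Rightarrow> real"
  assumes [measurable]: "\<And>j. (\<lambda>x. g x j) \<in> borel_measurable M"
  shows "(\<lambda>x. \<chi> j. g x j) \<in> borel_measurable M"
proof (subst borel_measurable_euclidean_space, intro ballI)
  fix i :: "real^'d" assume "i \<in> Basis"
  then obtain j where "i = axis j 1" by (auto simp: Basis_vec_def)
  then show "(\<lambda>x. (\<chi> j. g x j) \<bullet> i) \<in> borel_measurable M"
    by (simp add: inner_axis)
qed

lemma vec_nth_measurable [measurable]: "(\<lambda>x::real^'d::finite. x $ j) \<in> borel_measurable borel"
  by (intro borel_measurable_continuous_onI continuous_intros)

text \<open>Phase space is a pair of vectors, while the functions at hand factor over the pairs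
  (x_j, \<omega>_j). This map regroups a family of planes, one for each coordinate, into a point of
  phase space.\<close>

definition of_pairs :: "('d \<Rightarrow> real \<times> real) \<Rightarrow> 'd::finite phase" where
  "of_pairs f = (\<chi> j. fst (f j), \<chi> j. snd (f j))"

lemma of_pairs_measurable [measurable]:
  "(of_pairs :: ('d::finite \<Rightarrow> real \<times> real) \<Rightarrow> 'd phase) \<in> (\<Pi>\<^sub>M j\<in>UNIV. borel) \<rightarrow>\<^sub>M borel"
proof -
  have "(\<lambda>f::'d \<Rightarrow> real \<times> real. f j) \<in> (\<Pi>\<^sub>M j\<in>UNIV. borel) \<rightarrow>\<^sub>M borel" for j
    by simp
  then have "(\<lambda>f::'d \<Rightarrow> real \<times> real. f j) \<in> (\<Pi>\<^sub>M j\<in>UNIV. borel) \<rightarrow>\<^sub>M borel \<Otimes>\<^sub>M borel" for j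
    unfolding borel_prod by blast
  then have [measurable]: "(\<lambda>f::'d \<Rightarrow> real \<times> real. fst (f j)) \<in> borel_measurable (\<Pi>\<^sub>M j\<in>UNIV. borel)"
     "(\<lambda>f::'d \<Rightarrow> real \<times> real. snd (f j)) \<in> borel_measurable (\<Pi>\<^sub>M j\<in>UNIV. borel)" for j
    by (auto simp: measurable_pair_iff o_def)
  show ?thesis unfolding of_pairs_def borel_prod[symmetric] by measurable
qed

lemma mem_box_phase:
  "z \<in> box l (u :: 'd::finite phase) \<longleftrightarrow>
     (\<forall>j. fst l $ j < fst z $ j \<and> fst z $ j < fst u $ j \<and> snd l $ j < snd z $ j \<and> snd z $ j < snd u $ j)"
proof -
  have "z \<in> box l u \<longleftrightarrow> fst z \<in> box (fst l) (fst u) \<and> snd z \<in> box (snd l) (snd u)"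
    unfolding mem_box Basis_prod_def ball_Un inner_prod_def by auto
  then show ?thesis by (auto simp: mem_box_cart)
qed

section \<open>Lebesgue measure and integrals of coordinatewise products\<close>

lemma PiM_lborel_cong:
  "measurable (\<Pi>\<^sub>M j\<in>I. (lborel :: 'a::euclidean_space measure)) N = measurable (\<Pi>\<^sub>M j\<in>I. borel) N"
  by (intro measurable_cong_sets sets_PiM_cong) auto

text \<open>Lebesgue measure is characterized by its values on boxes, and the preimage of a box
  under the coordinate map is a product of intervals, whose product measure is known.\<close>

lemma lborel_vec_eq_distr:
  "(lborel :: (real^'d::finite) measure) = distr (\<Pi>\<^sub>M j\<in>UNIV. lborel) borel (\<lambda>f. \<chi> j. f j)"
proof (rule lborel_eqI)
  interpret product_sigma_finite "\<lambda>_::'d. lborel :: real measure" by standard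
  fix l u :: "real^'d"
  assume le: "\<And>b. b \<in> Basis \<Longrightarrow> l \<bullet> b \<le> u \<bullet> b"
  have le': "l $ j \<le> u $ j" for j
    using le[of "axis j 1"] by (simp add: inner_axis axis_in_Basis_iff)
  have [measurable]: "(\<lambda>f. \<chi> j. f j) \<in> (\<Pi>\<^sub>M j\<in>(UNIV::'d set). (lborel::real measure)) \<rightarrow>\<^sub>M borel"
    unfolding PiM_lborel_cong by measurable
  have "emeasure (distr (\<Pi>\<^sub>M j\<in>UNIV. lborel) borel (\<lambda>f. \<chi> j. f j)) (box l u) =
     emeasure (\<Pi>\<^sub>M j\<in>(UNIV::'d set). lborel) (\<Pi>\<^sub>E j\<in>UNIV. {l$j<..<u$j})"
    by (subst emeasure_distr) (auto intro!: arg_cong2[where f=emeasure] simp: mem_box_cart space_PiM PiE_def extensional_def Pi_iff)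
  also have "\<dots> = (\<Prod>j\<in>UNIV. ennreal (u$j - l$j))"
    by (subst emeasure_PiM) (auto simp: le')
  also have "\<dots> = ennreal (\<Prod>j\<in>UNIV. (u$j - l$j))"
    by (rule prod_ennreal) (simp add: le')
  also have "(\<Prod>j\<in>UNIV. (u$j - l$j)) = (\<Prod>b\<in>Basis. (u - l) \<bullet> b)"
    by (subst prod_Basis_vec) (simp add: inner_axis)
  finally show "emeasure (distr (\<Pi>\<^sub>M j\<in>UNIV. lborel) borel (\<lambda>f. \<chi> j. f j)) (box l u) = (\<Prod>b\<in>Basis. (u - l) \<bullet> b)" .
qed simp

text \<open>As for \<open>lborel_vec_eq_distr\<close>, but a box of phase space pulls back to a
  product of rectangles, the j-th one being cut out by the j-th entries of both halves.\<close>

lemma lborel_phase_eq_distr: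
  "(lborel :: 'd::finite phase measure) = distr (\<Pi>\<^sub>M j\<in>UNIV. lborel) borel of_pairs"
proof (rule lborel_eqI)
  interpret product_sigma_finite "\<lambda>_::'d. lborel :: (real \<times> real) measure" by standard
  fix l u :: "'d phase"
  assume le: "\<And>b. b \<in> Basis \<Longrightarrow> l \<bullet> b \<le> u \<bullet> b"
  have le': "fst l $ j \<le> fst u $ j" "snd l $ j \<le> snd u $ j" for j
    using le[of "(axis j 1, 0)"] le[of "(0, axis j 1)"]
    by (simp_all add: inner_axis axis_in_Basis_iff Basis_prod_def inner_prod_def)
  have [measurable]: "of_pairs \<in> (\<Pi>\<^sub>M j\<in>(UNIV::'d set). (lborel::(real\<times>real) measure)) \<rightarrow>\<^sub>M borel"
    unfolding PiM_lborel_cong by measurable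
  have "emeasure (distr (\<Pi>\<^sub>M j\<in>UNIV. lborel) borel of_pairs) (box l u) =
     emeasure (\<Pi>\<^sub>M j\<in>(UNIV::'d set). lborel) (\<Pi>\<^sub>E j\<in>UNIV. box (fst l $ j, snd l $ j) (fst u $ j, snd u $ j))"
    by (subst emeasure_distr) (auto intro!: arg_cong2[where f=emeasure]
       simp: mem_box_phase space_PiM PiE_def extensional_def Pi_iff of_pairs_def mem_box Basis_prod_def inner_prod_def)
  also have "\<dots> = (\<Prod>j\<in>UNIV. ennreal ((fst u$j - fst l$j) * (snd u $ j - snd l $ j)))"
    by (subst emeasure_PiM) (auto simp: le' emeasure_lborel_box_eq prod_Basis_Pair inner_prod_def Basis_prod_def mult.commute)
  also have "\<dots> = ennreal (\<Prod>j\<in>UNIV. ((fst u$j - fst l$j) * (snd u $ j - snd l $ j)))"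
    by (rule prod_ennreal) (simp add: le')
  also have "(\<Prod>j\<in>UNIV. ((fst u$j - fst l$j) * (snd u $ j - snd l $ j))) = (\<Prod>b\<in>Basis. (u - l) \<bullet> b)"
    by (subst prod_Basis_Pair) (simp add: inner_axis prod_Basis_vec inner_prod_def prod.distrib)
  finally show "emeasure (distr (\<Pi>\<^sub>M j\<in>UNIV. lborel) borel of_pairs) (box l u) = (\<Prod>b\<in>Basis. (u - l) \<bullet> b)" .
qed simp

lemma
  fixes f :: "'d::finite \<Rightarrow> real \<Rightarrow> complex"
  assumes f: "\<And>j. integrable lborel (f j)"
  shows integrable_vec_prod: "integrable lborel (\<lambda>t::real^'d. \<Prod>j\<in>UNIV. f j (t $ j))"
    and integral_vec_prod: "(LINT t|lborel. (\<Prod>j\<in>UNIV. f j ((t::real^'d) $ j))) = (\<Prod>j\<in>UNIV. LINT s|lborel. f j s)"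
proof -
  interpret product_sigma_finite "\<lambda>_::'d. lborel :: real measure" by standard
  have m[measurable]: "f j \<in> borel_measurable borel" for j
    using borel_measurable_integrable[OF f[of j]] by simp
  have [measurable]: "(\<lambda>f. \<chi> j. f j) \<in> (\<Pi>\<^sub>M j\<in>(UNIV::'d set). (lborel::real measure)) \<rightarrow>\<^sub>M borel"
    unfolding PiM_lborel_cong by measurable
  show "integrable lborel (\<lambda>t::real^'d. \<Prod>j\<in>UNIV. f j (t $ j))"
    unfolding lborel_vec_eq_distr
    by (subst integrable_distr_eq) (auto intro!: product_integrable_prod f)
  show "(LINT t|lborel. (\<Prod>j\<in>UNIV. f j ((t::real^'d) $ j))) = (\<Prod>j\<in>UNIV. LINT s|lborel. f j s)"
    unfolding lborel_vec_eq_distr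
    by (subst integral_distr) (auto intro!: product_integral_prod f)
qed

lemma
  fixes f :: "'d::finite \<Rightarrow> real \<times> real \<Rightarrow> complex"
  assumes f: "\<And>j. integrable lborel (f j)"
  shows integrable_phase_prod: "integrable lborel (\<lambda>z::'d phase. \<Prod>j\<in>UNIV. f j (fst z $ j, snd z $ j))"
    and integral_phase_prod: "(LINT z|lborel. (\<Prod>j\<in>UNIV. f j (fst (z::'d phase) $ j, snd z $ j))) = (\<Prod>j\<in>UNIV. LINT s|lborel. f j s)"
proof -
  interpret product_sigma_finite "\<lambda>_::'d. lborel :: (real \<times> real) measure" by standard
  have m[measurable]: "f j \<in> borel_measurable (borel \<Otimes>\<^sub>M borel)" for j
    using borel_measurable_integrable[OF f[of j]] by (simp add: borel_prod)
  have [measurable]: "of_pairs \<in> (\<Pi>\<^sub>M j\<in>(UNIV::'d set). (lborel::(real\<times>real) measure)) \<rightarrow>\<^sub>M borel"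
    unfolding PiM_lborel_cong by measurable
  have [measurable]: "(\<lambda>z::'d phase. \<Prod>j\<in>UNIV. f j (fst z $ j, snd z $ j)) \<in> borel_measurable borel"
    unfolding borel_prod[symmetric] by measurable
  have e: "(\<Prod>j\<in>UNIV. f j (fst (of_pairs g) $ j, snd (of_pairs g) $ j)) = (\<Prod>j\<in>UNIV. f j (g j))" for g
    by (simp add: of_pairs_def)
  show "integrable lborel (\<lambda>z::'d phase. \<Prod>j\<in>UNIV. f j (fst z $ j, snd z $ j))"
    unfolding lborel_phase_eq_distr
    by (subst integrable_distr_eq) (auto intro!: product_integrable_prod f simp: e)
  show "(LINT z|lborel. (\<Prod>j\<in>UNIV. f j (fst (z::'d phase) $ j, snd z $ j))) = (\<Prod>j\<in>UNIV. LINT s|lborel. f j s)"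
    unfolding lborel_phase_eq_distr
    by (subst integral_distr) (auto intro!: product_integral_prod f simp: e)
qed

lemma nn_integral_vec_prod:
  fixes f :: "'d::finite \<Rightarrow> real \<Rightarrow> ennreal"
  assumes [measurable]: "\<And>j. f j \<in> borel_measurable borel"
  shows "(\<integral>\<^sup>+t. (\<Prod>j\<in>UNIV. f j ((t::real^'d) $ j)) \<partial>lborel) = (\<Prod>j\<in>UNIV. \<integral>\<^sup>+s. f j s \<partial>lborel)"
proof -
  interpret product_sigma_finite "\<lambda>_::'d. lborel :: real measure" by standard
  have [measurable]: "(\<lambda>f. \<chi> j. f j) \<in> (\<Pi>\<^sub>M j\<in>(UNIV::'d set). (lborel::real measure)) \<rightarrow>\<^sub>M borel"
    unfolding PiM_lborel_cong by measurable
  show ?thesis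
    unfolding lborel_vec_eq_distr
    by (subst nn_integral_distr) (auto intro!: product_nn_integral_prod)
qed

text \<open>The extended-valued version serves for measures of sets and for the norm in
  \<open>S0\<close>, which is estimated before integrability is known.\<close>

lemma nn_integral_phase_prod:
  fixes f :: "'d::finite \<Rightarrow> real \<times> real \<Rightarrow> ennreal"
  assumes f: "\<And>j. f j \<in> borel_measurable borel"
  shows "(\<integral>\<^sup>+z. (\<Prod>j\<in>UNIV. f j (fst (z::'d phase) $ j, snd z $ j)) \<partial>lborel) = (\<Prod>j\<in>UNIV. \<integral>\<^sup>+s. f j s \<partial>lborel)"
proof -
  interpret product_sigma_finite "\<lambda>_::'d. lborel :: (real \<times> real) measure" by standard
  have m[measurable]: "f j \<in> borel_measurable (borel \<Otimes>\<^sub>M borel)" for j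
    using f[of j] by (simp add: borel_prod)
  have [measurable]: "of_pairs \<in> (\<Pi>\<^sub>M j\<in>(UNIV::'d set). (lborel::(real\<times>real) measure)) \<rightarrow>\<^sub>M borel"
    unfolding PiM_lborel_cong by measurable
  have [measurable]: "(\<lambda>z::'d phase. \<Prod>j\<in>UNIV. f j (fst z $ j, snd z $ j)) \<in> borel_measurable borel"
    unfolding borel_prod[symmetric] by measurable
  have e: "(\<Prod>j\<in>UNIV. f j (fst (of_pairs g) $ j, snd (of_pairs g) $ j)) = (\<Prod>j\<in>UNIV. f j (g j))" for g
    by (simp add: of_pairs_def)
  show ?thesis
    unfolding lborel_phase_eq_distr
    by (subst nn_integral_distr) (auto intro!: product_nn_integral_prod f simp: e)
qed

section \<open>Polynomials times a Gaussian\<close>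

text \<open>Members are built by multiplying with linear forms instead of from an explicit
  polynomial, so that differentiability and Gaussian bounds both follow by rule induction.\<close>

inductive_set poly_times :: "('a::euclidean_space \<Rightarrow> complex) \<Rightarrow> ('a \<Rightarrow> complex) set"
  for E :: "'a \<Rightarrow> complex" where
  base: "E \<in> poly_times E"
| coord: "f \<in> poly_times E \<Longrightarrow> (\<lambda>x. of_real (x \<bullet> b) * f x) \<in> poly_times E"
| scale: "f \<in> poly_times E \<Longrightarrow> (\<lambda>x. c * f x) \<in> poly_times E"
| add: "f \<in> poly_times E \<Longrightarrow> g \<in> poly_times E \<Longrightarrow> (\<lambda>x. f x + g x) \<in> poly_times E"

lemma poly_times_zero: "(\<lambda>x. 0) \<in> poly_times E"
  using poly_times.scale[OF poly_times.base, of 0] by simp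

lemma poly_times_uminus: "f \<in> poly_times E \<Longrightarrow> (\<lambda>x. - f x) \<in> poly_times E"
  using poly_times.scale[of f E "-1"] by simp

lemma poly_times_diff:
  "f \<in> poly_times E \<Longrightarrow> g \<in> poly_times E \<Longrightarrow> (\<lambda>x. f x - g x) \<in> poly_times E"
  using poly_times.add[of f E "\<lambda>x. - g x"] poly_times_uminus by force

lemma poly_times_sum:
  assumes "\<And>i. i \<in> I \<Longrightarrow> f i \<in> poly_times E"
  shows "(\<lambda>x. \<Sum>i\<in>I. f i x) \<in> poly_times E"
proof (cases "finite I")
  case True
  then show ?thesis using assms
    by (induction I) (auto intro: poly_times_zero poly_times.add)
qed (simp add: poly_times_zero)

text \<open>The condition is imposed for each fixed direction v because \<open>poly_times E\<close>
  consists of scalar functions. It concerns \<open>E\<close> alone and passes to the whole class by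
  the product rule.\<close>

definition diff_closed :: "('a::euclidean_space \<Rightarrow> complex) \<Rightarrow> bool" where
  "diff_closed E \<longleftrightarrow> (\<exists>E'. (\<forall>x. (E has_derivative E' x) (at x)) \<and> (\<forall>v. (\<lambda>x. E' x v) \<in> poly_times E))"

lemma poly_times_has_derivative:
  assumes "f \<in> poly_times E" "diff_closed E"
  obtains f' where "\<And>x. (f has_derivative f' x) (at x)" "\<And>v. (\<lambda>x. f' x v) \<in> poly_times E"
proof -
  have "\<exists>f'. (\<forall>x. (f has_derivative f' x) (at x)) \<and> (\<forall>v. (\<lambda>x. f' x v) \<in> poly_times E)"
    using assms(1)
  proof induction
    case base
    then show ?case using assms(2) unfolding diff_closed_def .
  next
    case (coord f b)
    then obtain f' where f': "\<And>x. (f has_derivative f' x) (at x)" "\<And>v. (\<lambda>x. f' x v) \<in> poly_times E"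
      by blast
    have "((\<lambda>x. of_real (x \<bullet> b) * f x) has_derivative
        (\<lambda>v. of_real (x \<bullet> b) * f' x v + of_real (v \<bullet> b) * f x)) (at x)" for x
      using f'(1) by (auto intro!: derivative_eq_intros has_derivative_of_real)
    moreover have "(\<lambda>x. of_real (x \<bullet> b) * f' x v + of_real (v \<bullet> b) * f x) \<in> poly_times E" for v
      using f'(2) coord.hyps by (intro poly_times.add poly_times.coord poly_times.scale)
    ultimately show ?case by (intro exI[of _ "\<lambda>x v. of_real (x \<bullet> b) * f' x v + of_real (v \<bullet> b) * f x"]) auto
  next
    case (scale f c)
    then obtain f' where f': "\<And>x. (f has_derivative f' x) (at x)" "\<And>v. (\<lambda>x. f' x v) \<in> poly_times E"
      by blast
    then show ?case
      by (intro exI[of _ "\<lambda>x v. c * f' x v"]) (auto intro!: derivative_eq_intros poly_times.scale)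
  next
    case (add f g)
    then obtain f' g' where "\<And>x. (f has_derivative f' x) (at x)" "\<And>v. (\<lambda>x. f' x v) \<in> poly_times E"
        "\<And>x. (g has_derivative g' x) (at x)" "\<And>v. (\<lambda>x. g' x v) \<in> poly_times E"
      by blast
    then show ?case
      by (intro exI[of _ "\<lambda>x v. f' x v + g' x v"]) (auto intro!: derivative_eq_intros poly_times.add)
  qed
  then show ?thesis using that by blast
qed

lemma poly_times_continuous:
  assumes "f \<in> poly_times E" "diff_closed E"
  shows "continuous_on S f"
  using poly_times_has_derivative[OF assms]
  by (metis continuous_at_imp_continuous_on has_derivative_continuous)

lemma poly_times_measurable:
  assumes "f \<in> poly_times E" "diff_closed E"
  shows "f \<in> borel_measurable borel"
  by (rule borel_measurable_continuous_onI[OF poly_times_continuous[OF assms]])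

text \<open>The rate is left existential because each multiplication by a coordinate costs a
  fraction of it.\<close>

definition gauss_bounded :: "('a::euclidean_space \<Rightarrow> complex) \<Rightarrow> bool" where
  "gauss_bounded f \<longleftrightarrow> (\<exists>C>0. \<exists>c>0. \<forall>x. cmod (f x) \<le> C * exp (- c * (norm x)\<^sup>2))"

text \<open>By 1 + r \<le> exp r the polynomial factor is at most exp (N r), and completing the
  square in N r - c r^2 yields the constant.\<close>

lemma power_exp_bound:
  fixes r c :: real
  assumes "r \<ge> 0" "c > 0"
  shows "(1 + r) ^ N * exp (- c * r\<^sup>2) \<le> exp ((real N)\<^sup>2 / (4 * c))"
proof -
  have "(1 + r) ^ N \<le> exp r ^ N"
    using assms by (intro power_mono) (auto simp: exp_ge_add_one_self)
  also have "\<dots> = exp (real N * r)" by (simp add: exp_of_nat_mult)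
  finally have "(1 + r) ^ N * exp (- c * r\<^sup>2) \<le> exp (real N * r) * exp (- c * r\<^sup>2)"
    by (intro mult_right_mono) auto
  also have "\<dots> = exp (real N * r - c * r\<^sup>2)" by (simp add: exp_add[symmetric])
  also have "real N * r - c * r\<^sup>2 \<le> (real N)\<^sup>2 / (4 * c)"
  proof -
    have "0 \<le> (2 * c * r - real N)\<^sup>2" by simp
    then show ?thesis using assms(2) by (simp add: field_simps power2_eq_square)
  qed
  finally show ?thesis by simp
qed

lemma gauss_bounded_decay:
  assumes "gauss_bounded f"
  shows "\<exists>B. \<forall>x. (1 + norm x) ^ N * cmod (f x) \<le> B"
proof -
  obtain C c where C: "C > 0" "c > 0" "\<And>x. cmod (f x) \<le> C * exp (- c * (norm x)\<^sup>2)"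
    using assms unfolding gauss_bounded_def by blast
  have "(1 + norm x) ^ N * cmod (f x) \<le> C * exp ((real N)\<^sup>2 / (4 * c))" for x
  proof -
    have "(1 + norm x) ^ N * cmod (f x) \<le> (1 + norm x) ^ N * (C * exp (- c * (norm x)\<^sup>2))"
      using C(3) by (intro mult_left_mono) auto
    also have "\<dots> = C * ((1 + norm x) ^ N * exp (- c * (norm x)\<^sup>2))" by simp
    also have "\<dots> \<le> C * exp ((real N)\<^sup>2 / (4 * c))"
      using C power_exp_bound[of "norm x" c N] by (intro mult_left_mono) auto
    finally show ?thesis .
  qed
  then show ?thesis by blast
qed

lemma gauss_bounded_scale:
  assumes "gauss_bounded f"
  shows "gauss_bounded (\<lambda>x. c' * f x)"
proof -
  obtain C c where C: "C > 0" "c > 0" "\<And>x. cmod (f x) \<le> C * exp (- c * (norm x)\<^sup>2)"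
    using assms unfolding gauss_bounded_def by blast
  have "cmod (c' * f x) \<le> (1 + cmod c') * C * exp (- c * (norm x)\<^sup>2)" for x
    unfolding norm_mult mult.assoc using C by (intro mult_mono) auto
  moreover have "(1 + cmod c') * C > 0" using C(1) by (intro mult_pos_pos) (auto intro: add_pos_nonneg)
  ultimately show ?thesis unfolding gauss_bounded_def using C(2) by meson
qed

lemma gauss_bounded_add:
  assumes "gauss_bounded f" "gauss_bounded g"
  shows "gauss_bounded (\<lambda>x. f x + g x)"
proof -
  obtain C c D d where C: "C > 0" "c > 0" "\<And>x. cmod (f x) \<le> C * exp (- c * (norm x)\<^sup>2)"
    and D: "D > 0" "d > 0" "\<And>x. cmod (g x) \<le> D * exp (- d * (norm x)\<^sup>2)"
    using assms unfolding gauss_bounded_def by blast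
  have "cmod (f x + g x) \<le> (C + D) * exp (- min c d * (norm x)\<^sup>2)" for x
  proof -
    have "exp (- c * (norm x)\<^sup>2) \<le> exp (- min c d * (norm x)\<^sup>2)"
         "exp (- d * (norm x)\<^sup>2) \<le> exp (- min c d * (norm x)\<^sup>2)"
      by (auto intro!: mult_right_mono)
    then have "C * exp (- c * (norm x)\<^sup>2) + D * exp (- d * (norm x)\<^sup>2)
      \<le> C * exp (- min c d * (norm x)\<^sup>2) + D * exp (- min c d * (norm x)\<^sup>2)"
      using C(1) D(1) by (intro add_mono mult_left_mono) auto
    then show ?thesis using C(3)[of x] D(3)[of x] norm_triangle_ineq[of "f x" "g x"]
      by (simp add: algebra_simps)
  qed
  moreover have "C + D > 0" "min c d > 0" using C D by auto
  ultimately show ?thesis unfolding gauss_bounded_def by meson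
qed

text \<open>A linear factor is absorbed by giving up half of the rate; scaling and addition are
  harmless.\<close>

lemma poly_times_gauss_bounded:
  assumes "f \<in> poly_times E" "gauss_bounded E"
  shows "gauss_bounded f"
  using assms(1)
proof induction
  case base
  then show ?case by fact
next
  case (coord f b)
  then obtain C c where C: "C > 0" "c > 0" "\<And>x. cmod (f x) \<le> C * exp (- c * (norm x)\<^sup>2)"
    unfolding gauss_bounded_def by blast
  \<comment> \<open>The constant of \<open>power_exp_bound\<close> for N = 1 and rate c / 2.\<close>
  define B where "B = exp (1 / (4 * (c/2)))"
  have "cmod (of_real (x \<bullet> b) * f x) \<le> (1 + norm b) * B * C * exp (- (c/2) * (norm x)\<^sup>2)" for x
  proof -
    have "(1 + norm b) * (1 + norm x) = 1 + norm b + norm x + norm x * norm b" by (simp add: algebra_simps)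
    then have "\<bar>x \<bullet> b\<bar> \<le> (1 + norm b) * (1 + norm x)"
      using Cauchy_Schwarz_ineq2[of x b] norm_ge_zero[of x] norm_ge_zero[of b] by linarith
    then have "cmod (of_real (x \<bullet> b) * f x) \<le> (1 + norm b) * (1 + norm x) * (C * exp (- c * (norm x)\<^sup>2))"
      unfolding norm_mult using C(3) by (intro mult_mono) auto
    also have "exp (- c * (norm x)\<^sup>2) = exp (- (c/2) * (norm x)\<^sup>2) * exp (- (c/2) * (norm x)\<^sup>2)"
      by (simp add: exp_add[symmetric])
    also have "(1 + norm b) * (1 + norm x) * (C * (exp (- (c/2) * (norm x)\<^sup>2) * exp (- (c/2) * (norm x)\<^sup>2)))
       = (1 + norm b) * ((1 + norm x)^1 * exp (- (c/2) * (norm x)\<^sup>2)) * (C * exp (- (c/2) * (norm x)\<^sup>2))"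
      by simp
    also have "\<dots> \<le> (1 + norm b) * B * (C * exp (- (c/2) * (norm x)\<^sup>2))"
      unfolding B_def using C power_exp_bound[of "norm x" "c/2" 1]
      by (intro mult_right_mono mult_left_mono) auto
    finally show ?thesis by (simp add: mult.assoc)
  qed
  moreover have "(1 + norm b) * B * C > 0" unfolding B_def using C(1)
    by (intro mult_pos_pos) (auto intro: add_pos_nonneg)
  ultimately show ?case unfolding gauss_bounded_def using C(2) by (meson half_gt_zero)
qed (auto intro: gauss_bounded_scale gauss_bounded_add)

lemma poly_times_partials:
  assumes "f \<in> poly_times E" "diff_closed E"
  shows "partials bs f \<in> poly_times E"
proof (induction bs)
  case Nil
  then show ?case using assms by simp
next
  case (Cons b bs)
  obtain f' where f': "\<And>x. (partials bs f has_derivative f' x) (at x)" "\<And>v. (\<lambda>x. f' x v) \<in> poly_times E"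
    using poly_times_has_derivative[OF Cons assms(2)] by blast
  have "partials (b # bs) f = (\<lambda>x. f' x b)"
    using frechet_derivative_at[OF f'(1)] by auto
  then show ?case using f'(2) by simp
qed

text \<open>All iterated partial derivatives stay in the class, hence are bounded by Gaussians,
  which beat every power of 1 + |x|.\<close>

lemma poly_times_schwartz:
  assumes "f \<in> poly_times E" "diff_closed E" "gauss_bounded E"
  shows "f \<in> schwartz"
proof -
  have "partials bs f differentiable (at x)" for bs x
    using poly_times_has_derivative[OF poly_times_partials[OF assms(1,2), of bs] assms(2)]
    by (metis differentiableI)
  moreover have "bounded (range (\<lambda>x. (1 + norm x) ^ N *\<^sub>R partials bs f x))" for N bs
  proof -
    obtain B where "\<And>x. (1 + norm x) ^ N * cmod (partials bs f x) \<le> B"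
      using gauss_bounded_decay[OF poly_times_gauss_bounded[OF poly_times_partials[OF assms(1,2), of bs] assms(3)], of N]
      by blast
    then show ?thesis by (intro boundedI[of _ B]) auto
  qed
  ultimately show ?thesis unfolding schwartz_def by blast
qed

text \<open>The exponent \<open>Q\<close> has an affine gradient, with constant part
  \<open>ca\<close> and matrix \<open>cb\<close>. A derivative of exp Q is therefore exp Q times a
  polynomial of degree at most one.\<close>

lemma exp_diff_closed:
  assumes Q: "\<And>x. (Q has_derivative (\<lambda>v. \<Sum>b\<in>Basis. (v \<bullet> b) *\<^sub>R l b x)) (at x)"
    and l: "\<And>b x. b \<in> Basis \<Longrightarrow> l b x = ca b + (\<Sum>a\<in>Basis. of_real (x \<bullet> a) * cb b a)"
  shows "diff_closed (\<lambda>x. exp (Q x :: complex))"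
  unfolding diff_closed_def
proof (intro exI conjI allI)
  fix x
  show "((\<lambda>x. exp (Q x)) has_derivative
      (\<lambda>v. (\<Sum>b\<in>Basis. of_real (v \<bullet> b) * (ca b * exp (Q x) + (\<Sum>a\<in>Basis. cb b a * (of_real (x \<bullet> a) * exp (Q x))))))) (at x)"
  proof -
    have "(exp has_derivative (\<lambda>h. exp (Q x) * h)) (at (Q x))"
      using DERIV_exp[of "Q x"] by (simp add: has_field_derivative_def)
    from has_derivative_compose[OF Q this] show ?thesis
    proof (rule has_derivative_eq_rhs, intro ext)
      fix v :: 'a
      have "l b x * exp (Q x) = ca b * exp (Q x) + (\<Sum>a\<in>Basis. cb b a * (of_real (x \<bullet> a) * exp (Q x)))"
        if "b \<in> Basis" for b
        unfolding l[OF that] distrib_right sum_distrib_right by (simp add: mult_ac)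
      then show "exp (Q x) * (\<Sum>b\<in>Basis. (v \<bullet> b) *\<^sub>R l b x) =
         (\<Sum>b\<in>Basis. of_real (v \<bullet> b) * (ca b * exp (Q x) + (\<Sum>a\<in>Basis. cb b a * (of_real (x \<bullet> a) * exp (Q x)))))"
        unfolding sum_distrib_left[of "exp (Q x)"]
        by (intro sum.cong refl) (simp add: scaleR_conv_of_real mult.commute mult.left_commute)
    qed
  qed
next
  fix v
  show "(\<lambda>x. \<Sum>b\<in>Basis. of_real (v \<bullet> b) * (ca b * exp (Q x) + (\<Sum>a\<in>Basis. cb b a * (of_real (x \<bullet> a) * exp (Q x)))))
     \<in> poly_times (\<lambda>x. exp (Q x))"
    by (intro poly_times_sum poly_times.scale poly_times.add poly_times.coord poly_times.base)
qed

text \<open>The isotropic case, enough for real Gaussians and their time-frequency shifts.\<close>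

lemma exp_quadratic_diff_closed:
  fixes \<mu> :: complex
  shows "diff_closed (\<lambda>x::'a::euclidean_space. exp (\<mu> * of_real (x \<bullet> x) + (\<Sum>b\<in>Basis. of_real (x \<bullet> b) * \<beta> b)))"
proof (rule exp_diff_closed[where l="\<lambda>b x. \<beta> b + 2 * \<mu> * of_real (x \<bullet> b)" and ca=\<beta>
        and cb="\<lambda>b a. if a = b then 2 * \<mu> else 0"])
  fix x :: 'a
  show "((\<lambda>x. \<mu> * of_real (x \<bullet> x) + (\<Sum>b\<in>Basis. of_real (x \<bullet> b) * \<beta> b)) has_derivative
     (\<lambda>v. \<Sum>b\<in>Basis. (v \<bullet> b) *\<^sub>R (\<beta> b + 2 * \<mu> * of_real (x \<bullet> b)))) (at x)"
  proof -
    have "((\<lambda>x. \<mu> * of_real (x \<bullet> x) + (\<Sum>b\<in>Basis. of_real (x \<bullet> b) * \<beta> b)) has_derivative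
       (\<lambda>v. \<mu> * of_real (x \<bullet> v + v \<bullet> x) + (\<Sum>b\<in>Basis. of_real (v \<bullet> b) * \<beta> b))) (at x)"
      by (intro has_derivative_add has_derivative_sum has_derivative_mult_left has_derivative_mult_right
          has_derivative_of_real has_derivative_inner_left has_derivative_ident has_derivative_inner)
    moreover have "x \<bullet> v + v \<bullet> x = (\<Sum>b\<in>Basis. 2 * (v \<bullet> b) * (x \<bullet> b))" for v
      by (simp add: inner_commute[of v x] euclidean_inner[of x v] sum_distrib_left mult_ac)
    then have "\<mu> * of_real (x \<bullet> v + v \<bullet> x) + (\<Sum>b\<in>Basis. of_real (v \<bullet> b) * \<beta> b) =
        (\<Sum>b\<in>Basis. (v \<bullet> b) *\<^sub>R (\<beta> b + 2 * \<mu> * of_real (x \<bullet> b)))" for v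
      by (simp add: sum_distrib_left sum.distrib[symmetric] scaleR_conv_of_real algebra_simps)
    ultimately show ?thesis by simp
  qed
next
  fix b x :: 'a
  assume "b \<in> Basis"
  then show "\<beta> b + 2 * \<mu> * of_real (x \<bullet> b) = \<beta> b + (\<Sum>a\<in>Basis. of_real (x \<bullet> a) * (if a = b then 2 * \<mu> else 0))"
    by (simp add: if_distrib[of "\<lambda>c. _ * c"] cong: if_cong)
qed

section \<open>Hermite functions\<close>

definition gauss_deriv :: "nat \<Rightarrow> real \<Rightarrow> real" where
  "gauss_deriv n = (deriv ^^ n) (\<lambda>s. exp (- 2 * pi * s\<^sup>2))"

text \<open>The recurrence is the n-fold derivative of G' = - 4 pi t G. Both claims are proved by
  one induction, since the iterated \<open>deriv\<close> carries information only once
  differentiability at the lower orders is known. For n = 0 the convention n - 1 = 0 is harmless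
  because of the factor n.\<close>

lemma gauss_deriv_aux:
  "(\<forall>t. (gauss_deriv n has_real_derivative gauss_deriv (Suc n) t) (at t)) \<and>
   (\<forall>t. gauss_deriv (Suc n) t = - 4 * pi * (t * gauss_deriv n t + real n * gauss_deriv (n - 1) t))"
proof (induction n rule: less_induct)
  case (less n)
  have *: "(gauss_deriv n has_real_derivative - 4 * pi * (t * gauss_deriv n t + real n * gauss_deriv (n - 1) t)) (at t)" for t
  proof (cases n)
    case 0
    then show ?thesis unfolding gauss_deriv_def by (auto intro!: derivative_eq_intros)
  next
    case (Suc m)
    have eq: "gauss_deriv n = (\<lambda>t. - 4 * pi * (t * gauss_deriv m t + real m * gauss_deriv (m - 1) t))"
      using less[of m] Suc by auto
    have d1: "(gauss_deriv m has_real_derivative gauss_deriv n t) (at t)"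
      using less[of m] Suc by auto
    have d2: "((\<lambda>t. real m * gauss_deriv (m - 1) t) has_real_derivative real m * gauss_deriv m t) (at t)"
    proof (cases m)
      case (Suc l)
      then have "(gauss_deriv l has_real_derivative gauss_deriv m t) (at t)"
        using less[of l] \<open>n = Suc m\<close> by auto
      then show ?thesis using Suc by (auto intro!: derivative_eq_intros)
    qed auto
    have "((\<lambda>t. - 4 * pi * (t * gauss_deriv m t + real m * gauss_deriv (m - 1) t)) has_real_derivative
        - 4 * pi * ((1 * gauss_deriv m t + gauss_deriv n t * t) + real m * gauss_deriv m t)) (at t)"
      by (intro DERIV_cmult DERIV_add DERIV_mult DERIV_ident d1 d2)
    then show ?thesis unfolding eq[symmetric] using Suc by (simp add: algebra_simps)
  qed
  have "gauss_deriv (Suc n) = deriv (gauss_deriv n)" by (simp add: gauss_deriv_def)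
  then have eq: "gauss_deriv (Suc n) t = - 4 * pi * (t * gauss_deriv n t + real n * gauss_deriv (n - 1) t)" for t
    using DERIV_imp_deriv[OF *] by simp
  show ?case using * unfolding eq[symmetric] using eq by blast
qed

lemma hermite1_eq:
  "hermite1 n t = 2 powr (1 / 4) / sqrt (fact n) * (- 1 / (2 * sqrt pi)) ^ n * exp (pi * t\<^sup>2) * gauss_deriv n t"
  by (simp add: hermite1_def gauss_deriv_def)

text \<open>The recurrence of \<open>gauss_deriv\<close> in normalized form. One step of the
  normalization contributes q / sqrt (n + 1) with q = - 1 / (2 sqrt pi), and the identities q (- 4
  pi) = 2 sqrt pi and q (2 sqrt pi) = - 1 produce the coefficients.\<close>

lemma hermite1_Suc:
  "sqrt (real (Suc n)) * hermite1 (Suc n) t =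
     2 * sqrt pi * t * hermite1 n t - sqrt (real n) * hermite1 (n - 1) t"
proof -
  define e where "e = 2 powr (1 / 4) * exp (pi * t\<^sup>2)"
  define q where "q = - 1 / (2 * sqrt pi)"
  have q: "q * (- 4 * pi) = 2 * sqrt pi" "q * (2 * sqrt pi) = -1"
    unfolding q_def by (simp_all add: field_simps)
  have h: "hermite1 n t = e / sqrt (fact n) * q ^ n * gauss_deriv n t" for n
    unfolding hermite1_eq e_def q_def by simp
  have sq: "sqrt (fact (Suc n)) = sqrt (real (Suc n)) * sqrt (fact n)" for n
    by (simp add: real_sqrt_mult)
  have "sqrt (real (Suc n)) * hermite1 (Suc n) t = e / sqrt (fact n) * q ^ n * (q * gauss_deriv (Suc n) t)"
    unfolding h sq by simp
  also have "q * gauss_deriv (Suc n) t = 2 * sqrt pi * (t * gauss_deriv n t + real n * gauss_deriv (n - 1) t)"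
    using gauss_deriv_aux[of n] q(1) by (metis mult.assoc)
  also have "e / sqrt (fact n) * q ^ n * (2 * sqrt pi * (t * gauss_deriv n t + real n * gauss_deriv (n - 1) t)) =
     2 * sqrt pi * t * hermite1 n t + 2 * sqrt pi * real n * (e / sqrt (fact n) * q ^ n * gauss_deriv (n - 1) t)"
    unfolding h by (simp add: algebra_simps)
  also have "2 * sqrt pi * real n * (e / sqrt (fact n) * q ^ n * gauss_deriv (n - 1) t) = - sqrt (real n) * hermite1 (n - 1) t"
  proof (cases n)
    case (Suc m)
    have r: "real n / sqrt (real n) = sqrt (real n)" by (rule real_div_sqrt) simp
    have "2 * sqrt pi * real n * (e / sqrt (fact n) * q ^ n * gauss_deriv (n - 1) t) =
       (q * (2 * sqrt pi)) * (real n / sqrt (real n)) * (e / sqrt (fact m) * q ^ m * gauss_deriv m t)"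
      unfolding Suc sq by (simp del: of_nat_Suc)
    also have "\<dots> = - sqrt (real n) * hermite1 (n - 1) t"
      unfolding q r h using Suc by simp
    finally show ?thesis .
  qed simp
  finally show ?thesis by simp
qed

text \<open>Differentiating the factor exp (pi t^2) produces 2 pi t \<open>hermite1 n t\<close>, and
  \<open>hermite1_Suc\<close> trades the factor t for neighbouring indices. Multiplication by t and
  differentiation thus both act by the two ladder steps.\<close>

lemma hermite1_has_derivative:
  "(hermite1 n has_real_derivative
     sqrt pi * (sqrt (real n) * hermite1 (n - 1) t - sqrt (real (Suc n)) * hermite1 (Suc n) t)) (at t)"
proof -
  define c where "c = 2 powr (1 / 4) / sqrt (fact n) * (- 1 / (2 * sqrt pi)) ^ n"
  have h: "hermite1 n = (\<lambda>t. c * exp (pi * t\<^sup>2) * gauss_deriv n t)"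
    by (auto simp: hermite1_eq c_def)
  have "((\<lambda>t. c * exp (pi * t\<^sup>2) * gauss_deriv n t) has_real_derivative
     2 * pi * t * (c * exp (pi * t\<^sup>2) * gauss_deriv n t) + c * exp (pi * t\<^sup>2) * gauss_deriv (Suc n) t) (at t)"
    by (rule derivative_eq_intros conjunct1[OF gauss_deriv_aux, rule_format] refl | simp add: algebra_simps)+
  then have d: "(hermite1 n has_real_derivative 2 * pi * t * hermite1 n t + c * exp (pi * t\<^sup>2) * gauss_deriv (Suc n) t) (at t)"
    unfolding h .
  have sq: "sqrt (fact (Suc n)) = sqrt (real (Suc n)) * sqrt (fact n)"
    by (simp add: real_sqrt_mult)
  have c: "c * exp (pi * t\<^sup>2) * gauss_deriv (Suc n) t = - 2 * sqrt pi * (sqrt (real (Suc n)) * hermite1 (Suc n) t)"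
    unfolding hermite1_eq c_def sq by (simp add: field_simps del: of_nat_Suc fact_Suc)
  have "2 * pi * t * hermite1 n t = sqrt pi * (2 * sqrt pi * t * hermite1 n t)" by simp
  also have "2 * sqrt pi * t * hermite1 n t = sqrt (real (Suc n)) * hermite1 (Suc n) t + sqrt (real n) * hermite1 (n - 1) t"
    using hermite1_Suc[of n t] by simp
  finally have "2 * pi * t * hermite1 n t + c * exp (pi * t\<^sup>2) * gauss_deriv (Suc n) t =
     sqrt pi * (sqrt (real n) * hermite1 (n - 1) t - sqrt (real (Suc n)) * hermite1 (Suc n) t)"
    unfolding c by (simp add: algebra_simps del: of_nat_Suc)
  with d show ?thesis by simp
qed

lemma hermite1_0: "hermite1 0 t = 2 powr (1 / 4) * exp (- pi * t\<^sup>2)"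
  by (simp add: hermite1_def exp_add[symmetric])

section \<open>Gaussian integrals and integration by parts\<close>

lemma integrable_exp_square:
  assumes "c > 0"
  shows "integrable lborel (\<lambda>s::real. exp (- c * s\<^sup>2))"
proof -
  define \<sigma> where "\<sigma> = sqrt (1 / (2 * c))"
  have s: "\<sigma> > 0" "2 * \<sigma>\<^sup>2 = 1 / c" unfolding \<sigma>_def using assms by (auto simp: field_simps)
  have "(\<lambda>s. exp (- c * s\<^sup>2)) = (\<lambda>s. sqrt (2 * pi * \<sigma>\<^sup>2) * normal_density 0 \<sigma> s)"
    using s assms unfolding normal_density_def by (auto simp: field_simps)
  then show ?thesis using integrable_normal_density[OF s(1)] by simp
qed

lemma integrable_exp_norm_square:
  assumes "c > 0"
  shows "integrable lborel (\<lambda>x::'a::euclidean_space. exp (- c * (norm x)\<^sup>2))"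
proof (rule integrableI_nonneg)
  have 1: "(\<integral>\<^sup>+ s. ennreal (exp (- c * s\<^sup>2)) \<partial>(lborel::real measure)) < \<infinity>"
    using integrable_exp_square[OF assms] by (simp add: integrable_iff_bounded)
  have "(norm x)\<^sup>2 = (\<Sum>b\<in>Basis. (x \<bullet> b)\<^sup>2)" for x :: 'a
    unfolding power2_norm_eq_inner by (subst euclidean_inner) (simp add: power2_eq_square)
  then have "exp (- c * (norm x)\<^sup>2) = (\<Prod>b\<in>Basis. exp (- c * (x \<bullet> b)\<^sup>2))" for x :: 'a
    by (simp add: exp_sum[symmetric] sum_distrib_left sum_negf)
  then have "(\<integral>\<^sup>+ x. ennreal (exp (- c * (norm x)\<^sup>2)) \<partial>(lborel::'a measure)) =
     (\<integral>\<^sup>+ x. (\<Prod>b\<in>Basis. ennreal (exp (- c * (x \<bullet> b)\<^sup>2))) \<partial>(lborel::'a measure))"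
    by (simp add: prod_ennreal)
  also have "\<dots> = (\<Prod>b\<in>(Basis::'a set). \<integral>\<^sup>+ s. ennreal (exp (- c * s\<^sup>2)) \<partial>lborel)"
    by (rule nn_integral_lborel_prod) auto
  also have "\<dots> < \<infinity>" using 1 by (simp add: less_top[symmetric] power_eq_top_ennreal)
  finally show "(\<integral>\<^sup>+ x. ennreal (exp (- c * (norm x)\<^sup>2)) \<partial>(lborel::'a measure)) < \<infinity>" .
qed auto

lemma gauss_bounded_integrable:
  assumes "gauss_bounded f" "f \<in> borel_measurable borel"
  shows "integrable lborel f"
proof -
  obtain C c where C: "C > 0" "c > 0" "\<And>x. cmod (f x) \<le> C * exp (- c * (norm x)\<^sup>2)"
    using assms unfolding gauss_bounded_def by blast
  have "integrable lborel (\<lambda>x::'a. C * exp (- c * (norm x)\<^sup>2))"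
    using integrable_exp_norm_square[OF C(2)] by (intro integrable_mult_right) auto
  then show ?thesis
    by (rule Bochner_Integration.integrable_bound) (use assms(2) C in \<open>auto simp: abs_mult\<close>)
qed

lemma gauss_bounded_mult_bounded:
  assumes "gauss_bounded f" "\<And>x. cmod (g x) \<le> M"
  shows "gauss_bounded (\<lambda>x. f x * g x)"
proof -
  obtain C c where C: "C > 0" "c > 0" "\<And>x. cmod (f x) \<le> C * exp (- c * (norm x)\<^sup>2)"
    using assms unfolding gauss_bounded_def by blast
  have "cmod (f x * g x) \<le> C * (\<bar>M\<bar> + 1) * exp (- c * (norm x)\<^sup>2)" for x
  proof -
    have "cmod (f x * g x) \<le> (C * exp (- c * (norm x)\<^sup>2)) * (\<bar>M\<bar> + 1)"
      unfolding norm_mult using C assms(2)[of x] by (intro mult_mono) auto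
    then show ?thesis by (simp add: mult_ac)
  qed
  moreover have "C * (\<bar>M\<bar> + 1) > 0" using C(1) by simp
  ultimately show ?thesis unfolding gauss_bounded_def using C(2) by blast
qed

lemma gauss_bounded_bounded:
  assumes "gauss_bounded f"
  obtains B where "\<And>x. cmod (f x) \<le> B"
  using gauss_bounded_decay[OF assms, of 0] by auto

lemma gauss_bounded_tendsto:
  fixes f :: "real \<Rightarrow> complex"
  assumes "gauss_bounded f"
  shows "(f \<longlongrightarrow> 0) at_infinity"
proof -
  obtain B where B: "\<And>x. (1 + norm x) ^ 1 * cmod (f x) \<le> B"
    using gauss_bounded_decay[OF assms, of 1] by blast
  have "((\<lambda>x::real. B / (1 + norm x)) \<longlongrightarrow> 0) at_infinity"
    by (intro tendsto_divide_0[OF tendsto_const] filterlim_at_top_imp_at_infinity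
        filterlim_tendsto_add_at_top[OF tendsto_const] filterlim_norm_at_top)
  moreover have "cmod (f x) \<le> B / (1 + norm x)" for x
    using B[of x] by (subst pos_le_divide_eq) (auto simp: mult.commute add_pos_nonneg)
  ultimately show ?thesis
    by (intro Lim_null_comparison[of f "\<lambda>x. B / (1 + norm x)"]) auto
qed

text \<open>The fundamental theorem of calculus on the whole line; applied to products it is
  integration by parts without boundary terms.\<close>

lemma integral_derivative_eq_0:
  fixes f f' :: "real \<Rightarrow> complex"
  assumes d: "\<And>t. (f has_vector_derivative f' t) (at t)" and c: "continuous_on UNIV f'"
    and i: "integrable lborel f'" and l: "(f \<longlongrightarrow> 0) at_infinity"
  shows "(LINT t|lborel. f' t) = 0"
proof -
  have "(LBINT t=-\<infinity>..\<infinity>. f' t) = 0 - 0"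
  proof (rule interval_integral_FTC_integrable)
    show "((f \<circ> real_of_ereal) \<longlongrightarrow> 0) (at_right (- \<infinity>))"
      using tendsto_mono[OF at_bot_le_at_infinity l] by (simp add: ereal_tendsto_simps)
    show "((f \<circ> real_of_ereal) \<longlongrightarrow> 0) (at_left \<infinity>)"
      using tendsto_mono[OF at_top_le_at_infinity l] by (simp add: ereal_tendsto_simps)
  qed (use d c i in \<open>auto simp: set_integrable_def einterval_eq continuous_on_eq_continuous_at\<close>)
  then show ?thesis by (simp add: interval_lebesgue_integral_def einterval_eq set_lebesgue_integral_def)
qed

abbreviation gauss1 :: "real \<Rightarrow> complex" where
  "gauss1 \<equiv> \<lambda>t. of_real (exp (- pi * t\<^sup>2))"

lemma gauss1_closed: "diff_closed gauss1"
proof -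
  have "gauss1 = (\<lambda>x. exp (of_real (- pi) * of_real (x \<bullet> x) + (\<Sum>b\<in>Basis. of_real (x \<bullet> b) * 0)))"
    by (auto simp: exp_of_real[symmetric] power2_eq_square)
  then show ?thesis using exp_quadratic_diff_closed[where 'a=real, of "of_real (- pi)" "\<lambda>_. 0"] by simp
qed

lemma gauss1_bounded: "gauss_bounded gauss1"
  unfolding gauss_bounded_def by (intro exI[of _ 1] conjI exI[of _ pi] allI) auto

lemma hermite1_poly_times: "(\<lambda>t. of_real (hermite1 n t)) \<in> poly_times gauss1"
proof (induction n rule: less_induct)
  case (less n)
  show ?case
  proof (cases n)
    case 0
    then show ?thesis
      using poly_times.scale[OF poly_times.base[of gauss1], of "of_real (2 powr (1/4))"]
      by (simp add: hermite1_0)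
  next
    case (Suc m)
    have e: "hermite1 n t = (2 * sqrt pi / sqrt (real n)) * (t * hermite1 m t) - (sqrt (real m) / sqrt (real n)) * hermite1 (m - 1) t" for t
      using hermite1_Suc[of m t] Suc by (simp add: field_simps del: of_nat_Suc)
    have "(\<lambda>t. of_real (2 * sqrt pi / sqrt (real n)) * (of_real (t \<bullet> 1) * of_real (hermite1 m t))
       - of_real (sqrt (real m) / sqrt (real n)) * of_real (hermite1 (m - 1) t)) \<in> poly_times gauss1"
      using Suc by (intro poly_times_diff poly_times.scale poly_times.coord less) auto
    then show ?thesis by (simp add: e)
  qed
qed

text \<open>Up to constants this is the characteristic function of the standard normal law at - sqrt
  pi \<omega>, after the substitution s = 2 sqrt pi t.\<close>

lemma integral_exp_square_fourier:
  "(LINT t|lborel. of_real (exp (- 2 * pi * t\<^sup>2)) * exp (- 2 * pi * \<i> * of_real (t * \<omega>)))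
     = of_real (exp (- pi * \<omega>\<^sup>2 / 2) / sqrt 2)"
proof -
  have "complex_of_real (exp (- (- sqrt pi * \<omega>)\<^sup>2 / 2)) = char std_normal_distribution (- sqrt pi * \<omega>)"
    by (simp add: char_std_normal_distribution)
  also have "\<dots> = (LINT s|lborel. std_normal_density s *\<^sub>R iexp (- sqrt pi * \<omega> * s))"
    unfolding char_def by (subst integral_density) (auto simp: normal_density_nonneg)
  also have "\<dots> = \<bar>2 * sqrt pi\<bar> *\<^sub>R (LINT t|lborel. std_normal_density (0 + 2 * sqrt pi * t) *\<^sub>R iexp (- sqrt pi * \<omega> * (0 + 2 * sqrt pi * t)))"
    by (rule lborel_integral_real_affine) simp
  also have "(\<lambda>t. std_normal_density (0 + 2 * sqrt pi * t) *\<^sub>R iexp (- sqrt pi * \<omega> * (0 + 2 * sqrt pi * t))) =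
     (\<lambda>t. of_real (1 / sqrt (2 * pi)) * (of_real (exp (- 2 * pi * t\<^sup>2)) * exp (- 2 * pi * \<i> * of_real (t * \<omega>))))"
  proof
    fix t
    have 1: "std_normal_density (0 + 2 * sqrt pi * t) = 1 / sqrt (2 * pi) * exp (- 2 * pi * t\<^sup>2)"
      by (simp add: std_normal_density_def power_mult_distrib)
    have 2: "- sqrt pi * \<omega> * (0 + 2 * sqrt pi * t) = - 2 * pi * (t * \<omega>)"
      by (simp add: algebra_simps)
    show "std_normal_density (0 + 2 * sqrt pi * t) *\<^sub>R iexp (- sqrt pi * \<omega> * (0 + 2 * sqrt pi * t)) =
      of_real (1 / sqrt (2 * pi)) * (of_real (exp (- 2 * pi * t\<^sup>2)) * exp (- 2 * pi * \<i> * of_real (t * \<omega>)))"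
      unfolding 1 2 by (simp add: scaleR_conv_of_real mult_ac)
  qed
  also have "\<bar>2 * sqrt pi\<bar> *\<^sub>R (LINT t|lborel. of_real (1 / sqrt (2 * pi)) * (of_real (exp (- 2 * pi * t\<^sup>2)) * exp (- 2 * pi * \<i> * of_real (t * \<omega>))))
    = of_real (2 * sqrt pi / sqrt (2 * pi)) * (LINT t|lborel. of_real (exp (- 2 * pi * t\<^sup>2)) * exp (- 2 * pi * \<i> * of_real (t * \<omega>)))"
    by (subst integral_mult_right_zero) (simp add: scaleR_conv_of_real)
  also have "2 * sqrt pi / sqrt (2 * pi) = sqrt 2"
    by (simp add: real_sqrt_mult real_div_sqrt)
  finally have "of_real (sqrt 2) * (LINT t|lborel. of_real (exp (- 2 * pi * t\<^sup>2)) * exp (- 2 * pi * \<i> * of_real (t * \<omega>))) =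
     complex_of_real (exp (- (- sqrt pi * \<omega>)\<^sup>2 / 2))" ..
  then show ?thesis by (simp add: field_simps power_mult_distrib)
qed

section \<open>The short-time Fourier transform of a pair of Hermite functions\<close>

abbreviation wave :: "real \<Rightarrow> complex" where "wave s \<equiv> exp (- 2 * pi * \<i> * of_real s)"

lemma norm_wave [simp]: "cmod (wave s) = 1"
  by simp

lemma wave_deriv: "((\<lambda>t. wave (t * \<omega>)) has_vector_derivative - 2 * pi * \<i> * \<omega> * wave (t * \<omega>)) (at t)"
  by (auto intro!: derivative_eq_intros has_vector_derivative_real_field simp: of_real_def[symmetric])

text \<open>The one-coordinate transform of \<open>hermite1 n\<close> with window
  \<open>hermite1 k\<close>; the window is real, so no conjugate appears.\<close>

definition hstft :: "nat \<Rightarrow> nat \<Rightarrow> real \<times> real \<Rightarrow> complex" where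
  "hstft n k = (\<lambda>(x, \<omega>). LINT t|lborel. of_real (hermite1 n t) * of_real (hermite1 k (t - x)) * wave (t * \<omega>))"

lemma continuous_on_hermite1 [continuous_intros]:
  "continuous_on S g \<Longrightarrow> continuous_on S (\<lambda>t. hermite1 n (g t))"
  by (rule continuous_on_compose2[of UNIV "hermite1 n"])
    (auto intro!: continuous_at_imp_continuous_on DERIV_isCont[OF hermite1_has_derivative])

lemma hermite1_measurable [measurable]: "hermite1 n \<in> borel_measurable borel"
  by (intro borel_measurable_continuous_onI continuous_on_hermite1 continuous_on_id)

lemma hermite1_gauss_bounded: "gauss_bounded (\<lambda>t. of_real (hermite1 n t))"
  by (rule poly_times_gauss_bounded[OF hermite1_poly_times gauss1_bounded])

lemma hermite1_bounded:
  obtains B where "\<And>t. \<bar>hermite1 n t\<bar> \<le> B"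
  using gauss_bounded_bounded[OF hermite1_gauss_bounded[of n]] by (metis norm_of_real)

lemma hstft_integrand_gauss_bounded:
  "gauss_bounded (\<lambda>t. of_real (hermite1 n t) * of_real (hermite1 k (t - x)) * wave (t * \<omega>))"
proof -
  obtain B where B: "\<And>t. \<bar>hermite1 k t\<bar> \<le> B" using hermite1_bounded by blast
  have "gauss_bounded (\<lambda>t. of_real (hermite1 n t) * of_real (hermite1 k (t - x)))"
    using gauss_bounded_mult_bounded[OF hermite1_gauss_bounded[of n], of "\<lambda>t. of_real (hermite1 k (t - x))" B] B by simp
  then show ?thesis by (rule gauss_bounded_mult_bounded[of _ _ 1]) simp
qed

lemma hstft_integrable:
  "integrable lborel (\<lambda>t. of_real (hermite1 n t) * of_real (hermite1 k (t - x)) * wave (t * \<omega>))"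
  by (rule gauss_bounded_integrable[OF hstft_integrand_gauss_bounded]) measurable

lemma hstft_has_integral:
  "has_bochner_integral lborel (\<lambda>t. of_real (hermite1 n t) * of_real (hermite1 k (t - x)) * wave (t * \<omega>)) (hstft n k (x, \<omega>))"
  using has_bochner_integral_integrable[OF hstft_integrable] unfolding hstft_def prod.case .

text \<open>Under the integral, x = t - (t - x), and \<open>hermite1_Suc\<close> turns t times the
  first factor and t - x times the second into neighbouring indices.\<close>

lemma hstft_mult:
  "2 * of_real (sqrt pi * x) * hstft n k (x, \<omega>) =
     of_real (sqrt (Suc n)) * hstft (Suc n) k (x, \<omega>) + of_real (sqrt n) * hstft (n - 1) k (x, \<omega>)
     - of_real (sqrt (Suc k)) * hstft n (Suc k) (x, \<omega>) - of_real (sqrt k) * hstft n (k - 1) (x, \<omega>)"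
proof -
  define U where "U n k t = complex_of_real (hermite1 n t) * of_real (hermite1 k (t - x)) * wave (t * \<omega>)" for n k t
  have I: "has_bochner_integral lborel (U n k) (hstft n k (x, \<omega>))" for n k
    unfolding U_def by (rule hstft_has_integral)
  have 1: "has_bochner_integral lborel (\<lambda>t. of_real (sqrt (Suc n)) * U (Suc n) k t + of_real (sqrt n) * U (n - 1) k t
     - of_real (sqrt (Suc k)) * U n (Suc k) t - of_real (sqrt k) * U n (k - 1) t)
    (of_real (sqrt (Suc n)) * hstft (Suc n) k (x, \<omega>) + of_real (sqrt n) * hstft (n - 1) k (x, \<omega>)
     - of_real (sqrt (Suc k)) * hstft n (Suc k) (x, \<omega>) - of_real (sqrt k) * hstft n (k - 1) (x, \<omega>))"
    by (intro has_bochner_integral_add has_bochner_integral_diff has_bochner_integral_mult_right I)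
  have "of_real (sqrt (Suc n)) * U (Suc n) k t + of_real (sqrt n) * U (n - 1) k t
     - of_real (sqrt (Suc k)) * U n (Suc k) t - of_real (sqrt k) * U n (k - 1) t =
     2 * of_real (sqrt pi * x) * U n k t" for t
  proof -
    have "sqrt (Suc n) * hermite1 (Suc n) t * hermite1 k (t - x) + sqrt n * hermite1 (n - 1) t * hermite1 k (t - x)
      - sqrt (Suc k) * hermite1 (Suc k) (t - x) * hermite1 n t - sqrt k * hermite1 (k - 1) (t - x) * hermite1 n t
      = 2 * (sqrt pi * x) * (hermite1 n t * hermite1 k (t - x))"
      unfolding hermite1_Suc by (simp add: algebra_simps)
    then have "complex_of_real (sqrt (Suc n) * hermite1 (Suc n) t * hermite1 k (t - x) + sqrt n * hermite1 (n - 1) t * hermite1 k (t - x)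
      - sqrt (Suc k) * hermite1 (Suc k) (t - x) * hermite1 n t - sqrt k * hermite1 (k - 1) (t - x) * hermite1 n t) * wave (t * \<omega>)
      = of_real (2 * (sqrt pi * x) * (hermite1 n t * hermite1 k (t - x))) * wave (t * \<omega>)" by simp
    then show ?thesis
      unfolding U_def by (simp add: algebra_simps del: of_nat_Suc)
  qed
  then have "has_bochner_integral lborel (\<lambda>t. 2 * of_real (sqrt pi * x) * U n k t)
    (of_real (sqrt (Suc n)) * hstft (Suc n) k (x, \<omega>) + of_real (sqrt n) * hstft (n - 1) k (x, \<omega>)
     - of_real (sqrt (Suc k)) * hstft n (Suc k) (x, \<omega>) - of_real (sqrt k) * hstft n (k - 1) (x, \<omega>))"
    using 1 by simp
  moreover have "has_bochner_integral lborel (\<lambda>t. 2 * of_real (sqrt pi * x) * U n k t) (2 * of_real (sqrt pi * x) * hstft n k (x, \<omega>))"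
    by (intro has_bochner_integral_mult_right I)
  ultimately show ?thesis using has_bochner_integral_eq by blast
qed

text \<open>The t-derivative of the integrand has integral zero. It is made of the ladder
  derivatives of the two Hermite factors and of the factor - 2 pi i \<omega> from the
  character.\<close>

lemma hstft_deriv:
  "2 * \<i> * of_real (sqrt pi * \<omega>) * hstft n k (x, \<omega>) =
     of_real (sqrt n) * hstft (n - 1) k (x, \<omega>) - of_real (sqrt (Suc n)) * hstft (Suc n) k (x, \<omega>)
     + of_real (sqrt k) * hstft n (k - 1) (x, \<omega>) - of_real (sqrt (Suc k)) * hstft n (Suc k) (x, \<omega>)"
proof -
  define U where "U n k t = complex_of_real (hermite1 n t) * of_real (hermite1 k (t - x)) * wave (t * \<omega>)" for n k t
  define dU where "dU t = of_real (sqrt pi) * (of_real (sqrt n) * U (n - 1) k t - of_real (sqrt (Suc n)) * U (Suc n) k t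
     + of_real (sqrt k) * U n (k - 1) t - of_real (sqrt (Suc k)) * U n (Suc k) t) - 2 * pi * \<i> * \<omega> * U n k t" for t
  have int: "integrable lborel (U n k)" for n k
    unfolding U_def by (rule hstft_integrable)
  have dh: "((\<lambda>t. complex_of_real (hermite1 n (t - y))) has_vector_derivative
     of_real (sqrt pi * (sqrt (real n) * hermite1 (n - 1) (t - y) - sqrt (real (Suc n)) * hermite1 (Suc n) (t - y)))) (at t)" for n y t
  proof -
    have "((\<lambda>t. hermite1 n (t - y)) has_real_derivative
       sqrt pi * (sqrt (real n) * hermite1 (n - 1) (t - y) - sqrt (real (Suc n)) * hermite1 (Suc n) (t - y))) (at t)"
      using DERIV_shift[of "hermite1 n" _ t "- y"] hermite1_has_derivative[of n "t - y"] by simp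
    then show ?thesis by (rule has_vector_derivative_of_real)
  qed
  have dh0: "((\<lambda>t. complex_of_real (hermite1 n t)) has_vector_derivative
     of_real (sqrt pi * (sqrt (real n) * hermite1 (n - 1) t - sqrt (real (Suc n)) * hermite1 (Suc n) t))) (at t)" for t
    using dh[of n 0 t] by (simp only: diff_0_right)
  have "(U n k has_vector_derivative dU t) (at t)" for t
    unfolding U_def
    by (rule has_vector_derivative_eq_rhs[OF has_vector_derivative_mult[OF has_vector_derivative_mult[OF dh0 dh] wave_deriv]])
      (simp only: dU_def U_def of_real_mult of_real_diff of_real_numeral of_real_neg_numeral, algebra)
  moreover have "continuous_on UNIV (U n k)" for n k
    unfolding U_def
    by (intro continuous_intros)
  then have "continuous_on UNIV dU" unfolding dU_def by (intro continuous_intros)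
  moreover have "integrable lborel dU"
    unfolding dU_def by (intro Bochner_Integration.integrable_add Bochner_Integration.integrable_diff integrable_mult_right int)
  moreover have "(U n k \<longlongrightarrow> 0) at_infinity"
    unfolding U_def by (rule gauss_bounded_tendsto[OF hstft_integrand_gauss_bounded])
  ultimately have "(LINT t|lborel. dU t) = 0"
    by (rule integral_derivative_eq_0)
  moreover have I: "has_bochner_integral lborel (U n k) (hstft n k (x, \<omega>))" for n k
    unfolding U_def by (rule hstft_has_integral)
  have "has_bochner_integral lborel dU (of_real (sqrt pi) * (of_real (sqrt n) * hstft (n - 1) k (x, \<omega>) - of_real (sqrt (Suc n)) * hstft (Suc n) k (x, \<omega>)
     + of_real (sqrt k) * hstft n (k - 1) (x, \<omega>) - of_real (sqrt (Suc k)) * hstft n (Suc k) (x, \<omega>)) - 2 * pi * \<i> * \<omega> * hstft n k (x, \<omega>))"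
    unfolding dU_def
    by (intro has_bochner_integral_add has_bochner_integral_diff has_bochner_integral_mult_right I)
  note has_bochner_integral_integral_eq[OF this]
  moreover have "2 * pi * \<i> * \<omega> * hstft n k (x, \<omega>) = of_real (sqrt pi) * (2 * \<i> * of_real (sqrt pi * \<omega>) * hstft n k (x, \<omega>))"
  proof -
    have sp: "complex_of_real pi = of_real (sqrt pi) * of_real (sqrt pi)" by (simp flip: of_real_mult)
    show ?thesis unfolding of_real_mult of_real_numeral by (subst sp) (simp only: mult_ac)
  qed
  ultimately have "of_real (sqrt pi) * (of_real (sqrt n) * hstft (n - 1) k (x, \<omega>) - of_real (sqrt (Suc n)) * hstft (Suc n) k (x, \<omega>)
     + of_real (sqrt k) * hstft n (k - 1) (x, \<omega>) - of_real (sqrt (Suc k)) * hstft n (Suc k) (x, \<omega>))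
     = of_real (sqrt pi) * (2 * \<i> * of_real (sqrt pi * \<omega>) * hstft n k (x, \<omega>))"
    by simp
  then show ?thesis by (subst (asm) mult_cancel_left) auto
qed

text \<open>Adding and subtracting \<open>hstft_mult\<close> and \<open>hstft_deriv\<close> forms x
  + i \<omega> and x - i \<omega>, and in each combination two of the four neighbours cancel. What
  remains raises either the window index alone or the function index alone.\<close>

lemma hstft_recurrence:
  "of_real (sqrt (Suc k)) * hstft n (Suc k) (x, \<omega>) =
     of_real (sqrt n) * hstft (n - 1) k (x, \<omega>) - of_real (sqrt pi) * Complex x \<omega> * hstft n k (x, \<omega>)"
  "of_real (sqrt (Suc n)) * hstft (Suc n) k (x, \<omega>) =
     of_real (sqrt k) * hstft n (k - 1) (x, \<omega>) + of_real (sqrt pi) * cnj (Complex x \<omega>) * hstft n k (x, \<omega>)"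
proof -
  define A B C D I where defs: "A = of_real (sqrt (Suc n)) * hstft (Suc n) k (x, \<omega>)" "B = of_real (sqrt n) * hstft (n - 1) k (x, \<omega>)"
     "C = of_real (sqrt (Suc k)) * hstft n (Suc k) (x, \<omega>)" "D = of_real (sqrt k) * hstft n (k - 1) (x, \<omega>)" "I = hstft n k (x, \<omega>)"
  have m: "2 * of_real (sqrt pi * x) * I = A + B - C - D"
    using hstft_mult[of x n k \<omega>] by (simp only: defs)
  have d: "2 * \<i> * of_real (sqrt pi * \<omega>) * I = B - A + D - C"
    using hstft_deriv[of \<omega> n k x] by (simp only: defs)
  have c: "Complex x \<omega> = of_real x + \<i> * of_real \<omega>" "cnj (Complex x \<omega>) = of_real x - \<i> * of_real \<omega>"
    by (simp_all add: complex_eq_iff)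
  have "2 * (of_real (sqrt pi) * Complex x \<omega> * I) = 2 * of_real (sqrt pi * x) * I + 2 * \<i> * of_real (sqrt pi * \<omega>) * I"
       "2 * (of_real (sqrt pi) * cnj (Complex x \<omega>) * I) = 2 * of_real (sqrt pi * x) * I - 2 * \<i> * of_real (sqrt pi * \<omega>) * I"
    unfolding c by (simp_all add: algebra_simps)
  then have "2 * (of_real (sqrt pi) * Complex x \<omega> * I) = 2 * (B - C)" "2 * (of_real (sqrt pi) * cnj (Complex x \<omega>) * I) = 2 * (A - D)"
    unfolding m d by (simp_all add: algebra_simps)
  then have "of_real (sqrt pi) * Complex x \<omega> * I = B - C" "of_real (sqrt pi) * cnj (Complex x \<omega>) * I = A - D"
    by (simp_all only: mult_cancel_left) auto
  then have "C = B - of_real (sqrt pi) * Complex x \<omega> * I" "A = D + of_real (sqrt pi) * cnj (Complex x \<omega>) * I" by simp_all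
  then show "of_real (sqrt (Suc k)) * hstft n (Suc k) (x, \<omega>) =
     of_real (sqrt n) * hstft (n - 1) k (x, \<omega>) - of_real (sqrt pi) * Complex x \<omega> * hstft n k (x, \<omega>)"
  "of_real (sqrt (Suc n)) * hstft (Suc n) k (x, \<omega>) =
     of_real (sqrt k) * hstft n (k - 1) (x, \<omega>) + of_real (sqrt pi) * cnj (Complex x \<omega>) * hstft n k (x, \<omega>)"
    by (simp_all only: defs)
qed

text \<open>The transform of the ground state with itself, see \<open>hstft_0_0\<close>. The chirp
  phase stems from the unsymmetric order of translation and modulation.\<close>

definition chirp_gauss :: "real \<times> real \<Rightarrow> complex" where
  "chirp_gauss = (\<lambda>(x, \<omega>). exp (- pi * \<i> * of_real (x * \<omega>)) * of_real (exp (- pi * (x\<^sup>2 + \<omega>\<^sup>2) / 2)))"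

lemma hstft_0_0: "hstft 0 0 (x, \<omega>) = chirp_gauss (x, \<omega>)"
proof -
  let ?f = "\<lambda>t. of_real (hermite1 0 t) * of_real (hermite1 0 (t - x)) * wave (t * \<omega>)"
  let ?c = "of_real (sqrt 2 * exp (- pi * x\<^sup>2 / 2)) * exp (- pi * \<i> * of_real (x * \<omega>))"
  \<comment> \<open>Centering at the midpoint x / 2 of the two Gaussians splits their product into
    exp (- pi x^2 / 2) and exp (- 2 pi s^2) without a mixed term.\<close>
  have "hstft 0 0 (x, \<omega>) = \<bar>1\<bar> *\<^sub>R (LINT s|lborel. ?f (x / 2 + 1 * s))"
    unfolding hstft_def prod.case by (rule lborel_integral_real_affine) simp
  also have "(\<lambda>s. ?f (x / 2 + 1 * s)) =
     (\<lambda>s. ?c * (of_real (exp (- 2 * pi * s\<^sup>2)) * exp (- 2 * pi * \<i> * of_real (s * \<omega>))))"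
  proof
    fix s
    have p: "2 powr (1 / 4) * 2 powr (1 / 4) = sqrt (2::real)"
      by (simp add: powr_add[symmetric] powr_half_sqrt)
    have "hermite1 0 (x / 2 + 1 * s) * hermite1 0 (x / 2 + 1 * s - x)
       = (2 powr (1 / 4) * 2 powr (1 / 4)) * (exp (- pi * (x / 2 + s)\<^sup>2) * exp (- pi * (x / 2 + s - x)\<^sup>2))"
      by (simp add: hermite1_0)
    also have "exp (- pi * (x / 2 + s)\<^sup>2) * exp (- pi * (x / 2 + s - x)\<^sup>2) = exp (- pi * x\<^sup>2 / 2) * exp (- 2 * pi * s\<^sup>2)"
      unfolding exp_add[symmetric] by (simp add: power2_eq_square field_simps)
    finally have 1: "hermite1 0 (x / 2 + 1 * s) * hermite1 0 (x / 2 + 1 * s - x) = sqrt 2 * exp (- pi * x\<^sup>2 / 2) * exp (- 2 * pi * s\<^sup>2)"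
      unfolding p by simp
    have 2: "wave ((x / 2 + 1 * s) * \<omega>) = exp (- pi * \<i> * of_real (x * \<omega>)) * exp (- 2 * pi * \<i> * of_real (s * \<omega>))"
      unfolding exp_add[symmetric] by (rule arg_cong[where f=exp]) (simp add: field_simps)
    show "?f (x / 2 + 1 * s) = ?c * (of_real (exp (- 2 * pi * s\<^sup>2)) * exp (- 2 * pi * \<i> * of_real (s * \<omega>)))"
      unfolding 2 of_real_mult[symmetric] 1 by (simp add: mult_ac)
  qed
  also have "\<bar>1\<bar> *\<^sub>R (LINT s|lborel. ?c * (of_real (exp (- 2 * pi * s\<^sup>2)) * exp (- 2 * pi * \<i> * of_real (s * \<omega>))))
     = ?c * of_real (exp (- pi * \<omega>\<^sup>2 / 2) / sqrt 2)"
    unfolding integral_mult_right_zero integral_exp_square_fourier by simp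
  also have "\<dots> = of_real (sqrt 2 / sqrt 2 * (exp (- pi * x\<^sup>2 / 2) * exp (- pi * \<omega>\<^sup>2 / 2))) * exp (- pi * \<i> * of_real (x * \<omega>))"
    by (simp add: mult_ac)
  also have "\<dots> = chirp_gauss (x, \<omega>)"
    unfolding exp_add[symmetric] by (simp add: chirp_gauss_def field_simps)
  finally show ?thesis .
qed

text \<open>This is \<open>n!\<close> times the coefficient of \<open>a\<^sup>n b\<^sup>k\<close> in \<open>exp (a b + a cnj w - b w)\<close>.\<close>

definition hstft_poly :: "nat \<Rightarrow> nat \<Rightarrow> complex \<Rightarrow> complex" where
  "hstft_poly n k w = (\<Sum>j\<le>k. of_nat (n choose j) * cnj w ^ (n - j) * (- w) ^ (k - j) / fact (k - j))"

text \<open>Differentiating the generating function exp (a b + a cnj w - b w) in b produces the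
  factor a - w; comparing coefficients gives the recurrence.\<close>

lemma hstft_poly_Suc:
  "of_nat (Suc k) * hstft_poly n (Suc k) w = of_nat n * hstft_poly (n - 1) k w - w * hstft_poly n k w"
proof -
  define T where "T j = of_nat (n choose j) * cnj w ^ (n - j) * (- w) ^ (Suc k - j) / fact (Suc k - j)" for j
  have "of_nat (Suc k) * hstft_poly n (Suc k) w = (\<Sum>j\<le>Suc k. of_nat (Suc k) * T j)"
    unfolding hstft_poly_def T_def sum_distrib_left by simp
  \<comment> \<open>The weight \<open>Suc k\<close> is split as j + (\<open>Suc k\<close> - j): the
    first part is absorbed by the binomial coefficient, the second by the factorial.\<close>
  also have "\<dots> = (\<Sum>j\<le>Suc k. of_nat j * T j + of_nat (Suc k - j) * T j)"
    by (intro sum.cong refl) (auto simp: distrib_right[symmetric] of_nat_add[symmetric] simp del: of_nat_add of_nat_Suc)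
  also have "\<dots> = (\<Sum>j\<le>Suc k. of_nat j * T j) + (\<Sum>j\<le>Suc k. of_nat (Suc k - j) * T j)"
    by (rule sum.distrib)
  also have "(\<Sum>j\<le>Suc k. of_nat j * T j) = (\<Sum>j\<le>k. of_nat (Suc j) * T (Suc j))"
    by (subst sum.atMost_Suc_shift) simp
  also have "\<dots> = of_nat n * hstft_poly (n - 1) k w"
    unfolding hstft_poly_def sum_distrib_left
  proof (intro sum.cong refl)
    fix j
    show "of_nat (Suc j) * T (Suc j) = of_nat n * (of_nat (n - 1 choose j) * cnj w ^ (n - 1 - j) * (- w) ^ (k - j) / fact (k - j))"
    proof (cases n)
      case (Suc m)
      have "of_nat (Suc j) * of_nat (n choose Suc j) = (of_nat n * of_nat (n - 1 choose j) :: complex)"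
        unfolding of_nat_mult[symmetric] Suc by (simp only: Suc_times_binomial diff_Suc_1)
      then show ?thesis unfolding T_def
        by (simp add: Suc del: of_nat_Suc binomial_Suc_Suc flip: mult.assoc)
    qed (simp add: T_def)
  qed
  also have "(\<Sum>j\<le>Suc k. of_nat (Suc k - j) * T j) = (\<Sum>j\<le>k. of_nat (Suc k - j) * T j)"
    by simp
  also have "\<dots> = - w * hstft_poly n k w"
    unfolding hstft_poly_def sum_distrib_left
  proof (intro sum.cong refl)
    fix j assume "j \<in> {..k}"
    then have "Suc k - j = Suc (k - j)" by auto
    then show "of_nat (Suc k - j) * T j = - w * (of_nat (n choose j) * cnj w ^ (n - j) * (- w) ^ (k - j) / fact (k - j))"
      unfolding T_def by (simp add: field_simps del: of_nat_Suc)
  qed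
  finally show ?thesis by simp
qed

text \<open>Both sides obey the recurrences of \<open>hstft_recurrence\<close>: the row k = 0 is
  filled by raising n, and every further row by raising k. The prefactor converts the square roots
  of the ladder coefficients into the integers of \<open>hstft_poly_Suc\<close>.\<close>

lemma hstft_eq:
  "hstft n k (x, \<omega>) = of_real (sqrt (fact k / fact n)) * hstft_poly n k (of_real (sqrt pi) * Complex x \<omega>) * chirp_gauss (x, \<omega>)"
proof (induction k arbitrary: n)
  case 0
  show ?case
  proof (induction n)
    case 0
    then show ?case by (simp add: hstft_0_0 hstft_poly_def)
  next
    case (Suc n)
    let ?w = "of_real (sqrt pi) * Complex x \<omega>"
    have "complex_of_real (sqrt (Suc n)) * hstft (Suc n) 0 (x, \<omega>) = cnj ?w * hstft n 0 (x, \<omega>)"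
      using hstft_recurrence(2)[of n 0 x \<omega>] by simp
    also have "\<dots> = complex_of_real (sqrt (Suc n)) * (of_real (sqrt (1 / fact (Suc n))) * hstft_poly (Suc n) 0 ?w * chirp_gauss (x, \<omega>))"
      unfolding Suc hstft_poly_def by (simp add: real_sqrt_mult real_sqrt_divide del: of_nat_Suc)
    finally show ?case by (simp del: of_nat_Suc fact_Suc)
  qed
next
  case (Suc k)
  let ?w = "of_real (sqrt pi) * Complex x \<omega>"
  let ?s = "\<lambda>n. complex_of_real (sqrt n)"
  have a: "?s n * (of_real (sqrt (fact k / fact (n - 1))) * hstft_poly (n - 1) k ?w * chirp_gauss (x, \<omega>))
     = of_real (sqrt (fact k / fact n)) * chirp_gauss (x, \<omega>) * (of_nat n * hstft_poly (n - 1) k ?w)"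
  proof (cases n)
    case (Suc m)
    have "fact k / fact n * real n = fact k / fact (n - 1)"
      unfolding Suc by (simp del: of_nat_Suc)
    then have "sqrt (fact k / fact n) * sqrt n = sqrt (fact k / fact (n - 1))"
      unfolding real_sqrt_mult[symmetric] by simp
    then have "sqrt n * sqrt (fact k / fact (n - 1)) = sqrt (fact k / fact n) * (sqrt n * sqrt n)" by (simp only: mult_ac)
    then have "sqrt n * sqrt (fact k / fact (n - 1)) = sqrt (fact k / fact n) * n" by simp
    then have "complex_of_real (sqrt n * sqrt (fact k / fact (n - 1))) = of_real (sqrt (fact k / fact n) * n)"
      by (simp only:)
    then have "?s n * of_real (sqrt (fact k / fact (n - 1))) = of_real (sqrt (fact k / fact n)) * of_nat n"
      unfolding of_real_mult of_real_of_nat_eq .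
    then show ?thesis by (simp add: mult_ac)
  qed simp
  have "?s (Suc k) * hstft n (Suc k) (x, \<omega>) = ?s n * hstft (n - 1) k (x, \<omega>) - ?w * hstft n k (x, \<omega>)"
    by (rule hstft_recurrence(1))
  also have "\<dots> = of_real (sqrt (fact k / fact n)) * chirp_gauss (x, \<omega>) * (of_nat n * hstft_poly (n - 1) k ?w - ?w * hstft_poly n k ?w)"
    unfolding Suc a by (simp add: algebra_simps)
  also have "\<dots> = of_real (sqrt (fact k / fact n)) * of_nat (Suc k) * chirp_gauss (x, \<omega>) * hstft_poly n (Suc k) ?w"
    unfolding hstft_poly_Suc[symmetric] by simp
  also have "of_real (sqrt (fact k / fact n)) * of_nat (Suc k) = ?s (Suc k) * of_real (sqrt (fact (Suc k) / fact n))"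
  proof -
    have "sqrt (Suc k) * sqrt (fact (Suc k) / fact n) = sqrt (Suc k) * sqrt (Suc k) * sqrt (fact k / fact n)"
      by (simp add: real_sqrt_mult real_sqrt_divide del: of_nat_Suc)
    then have "sqrt (fact k / fact n) * Suc k = sqrt (Suc k) * sqrt (fact (Suc k) / fact n)"
      by (simp del: of_nat_Suc fact_Suc)
    then have "complex_of_real (sqrt (fact k / fact n) * Suc k) = of_real (sqrt (Suc k) * sqrt (fact (Suc k) / fact n))"
      by (simp only:)
    then show ?thesis unfolding of_real_mult of_real_of_nat_eq .
  qed
  finally show ?case by (simp add: mult_ac del: of_nat_Suc fact_Suc)
qed

section \<open>Decay of the kernel of the time-frequency transform\<close>

text \<open>The mixed term x \<omega> in the exponent puts it outside
  \<open>exp_quadratic_diff_closed\<close>. Its gradient is still linear, with off-diagonal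
  coefficients - pi i.\<close>

lemma chirp_gauss_closed: "diff_closed chirp_gauss"
proof -
  have B: "(Basis :: (real \<times> real) set) = {(1, 0), (0, 1)}" by (auto simp: Basis_prod_def)
  have "diff_closed (\<lambda>z::real \<times> real. exp (- pi * \<i> * of_real (fst z * snd z) + of_real (- pi * ((fst z)\<^sup>2 + (snd z)\<^sup>2) / 2)))"
  proof (rule exp_diff_closed[where l="\<lambda>b z. \<Sum>a\<in>Basis. of_real (z \<bullet> a) * (if a = b then - of_real pi else - of_real pi * \<i>)"
        and ca="\<lambda>_. 0" and cb="\<lambda>b a. if a = b then - of_real pi else - of_real pi * \<i>"])
    fix z :: "real \<times> real"
    have "((\<lambda>z::real \<times> real. - pi * \<i> * of_real (fst z * snd z) + of_real (- pi * ((fst z)\<^sup>2 + (snd z)\<^sup>2) / 2))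
      has_derivative (\<lambda>v. - pi * \<i> * of_real (fst z * snd v + fst v * snd z) + of_real (- pi * (2 * fst z * fst v + 2 * snd z * snd v) / 2))) (at z)"
      by (auto intro!: derivative_eq_intros simp: fun_eq_iff field_simps power2_eq_square)
    then show "((\<lambda>z::real \<times> real. - pi * \<i> * of_real (fst z * snd z) + of_real (- pi * ((fst z)\<^sup>2 + (snd z)\<^sup>2) / 2))
      has_derivative (\<lambda>v. \<Sum>b\<in>Basis. (v \<bullet> b) *\<^sub>R (\<Sum>a\<in>Basis. of_real (z \<bullet> a) * (if a = b then - of_real pi else - of_real pi * \<i>)))) (at z)"
      by (rule has_derivative_eq_rhs) (auto simp: B fun_eq_iff scaleR_conv_of_real inner_prod_def field_simps)
  qed simp
  then show ?thesis
    by (simp only: chirp_gauss_def case_prod_unfold exp_add exp_of_real)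
qed

lemma norm_chirp_gauss: "cmod (chirp_gauss z) = exp (- (pi / 2) * (norm z)\<^sup>2)"
  by (cases z) (simp add: chirp_gauss_def norm_mult norm_Pair field_simps)

lemma chirp_gauss_bounded: "gauss_bounded chirp_gauss"
  unfolding gauss_bounded_def norm_chirp_gauss
  by (intro exI[of _ 1] conjI exI[of _ "pi/2"] allI) auto

lemma hstft_poly_times: "hstft n k \<in> poly_times chirp_gauss"
proof -
  have m: "(\<lambda>z. of_real (fst z) * f z) \<in> poly_times chirp_gauss" "(\<lambda>z. of_real (snd z) * f z) \<in> poly_times chirp_gauss"
    if "f \<in> poly_times chirp_gauss" for f
    using poly_times.coord[OF that, of "(1,0)"] poly_times.coord[OF that, of "(0,1)"] by (simp_all add: inner_prod_def)
  have c: "Complex x \<omega> = of_real x + \<i> * of_real \<omega>" "cnj (Complex x \<omega>) = of_real x - \<i> * of_real \<omega>" for x \<omega>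
    by (simp_all add: complex_eq_iff)
  show ?thesis
  proof (induction k arbitrary: n)
    case 0
    show ?case
    proof (induction n)
      case 0
      have "hstft 0 0 = chirp_gauss" by (auto simp: hstft_0_0 fun_eq_iff)
      then show ?case by (simp add: poly_times.base)
    next
      case (Suc n)
      have "hstft (Suc n) 0 z = of_real (sqrt pi / sqrt (Suc n)) * (of_real (fst z) * hstft n 0 z - \<i> * (of_real (snd z) * hstft n 0 z))" for z
        using hstft_recurrence(2)[of n 0 "fst z" "snd z"] unfolding c
        by (simp add: field_simps del: of_nat_Suc)
      moreover have "(\<lambda>z. of_real (sqrt pi / sqrt (Suc n)) * (of_real (fst z) * hstft n 0 z - \<i> * (of_real (snd z) * hstft n 0 z))) \<in> poly_times chirp_gauss"
        by (intro poly_times.scale poly_times_diff m Suc)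
      ultimately show ?case by (simp add: fun_eq_iff[symmetric] del: of_nat_Suc)
    qed
  next
    case (Suc k)
    have "hstft n (Suc k) z = of_real (sqrt n / sqrt (Suc k)) * hstft (n - 1) k z
       - of_real (sqrt pi / sqrt (Suc k)) * (of_real (fst z) * hstft n k z + \<i> * (of_real (snd z) * hstft n k z))" for z
      using hstft_recurrence(1)[of k n "fst z" "snd z"] unfolding c
      by (simp add: field_simps del: of_nat_Suc)
    moreover have "(\<lambda>z. of_real (sqrt n / sqrt (Suc k)) * hstft (n - 1) k z
       - of_real (sqrt pi / sqrt (Suc k)) * (of_real (fst z) * hstft n k z + \<i> * (of_real (snd z) * hstft n k z))) \<in> poly_times chirp_gauss"
      by (intro poly_times.scale poly_times_diff poly_times.add m Suc)
    ultimately show ?case by (simp add: fun_eq_iff[symmetric] del: of_nat_Suc)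
  qed
qed

lemma hstft_measurable [measurable]: "hstft n k \<in> borel_measurable borel"
  by (rule poly_times_measurable[OF hstft_poly_times chirp_gauss_closed])

lemma poly_times_gauss1_derivative:
  assumes "f \<in> poly_times gauss1"
  shows "\<exists>f' \<in> poly_times gauss1. \<forall>t. (f has_vector_derivative f' t) (at t)"
proof -
  have "\<exists>D. (\<forall>t. (f has_derivative D t) (at t)) \<and> (\<forall>v. (\<lambda>t. D t v) \<in> poly_times gauss1)"
    by (rule poly_times_has_derivative[OF assms gauss1_closed]) (intro exI conjI allI)
  then obtain D where D0: "\<forall>t. (f has_derivative D t) (at t)" "\<forall>v. (\<lambda>t. D t v) \<in> poly_times gauss1"
    by (elim exE conjE)
  note D = D0[rule_format]
  have "(f has_vector_derivative D t 1) (at t)" for t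
  proof -
    have "D t h = h *\<^sub>R D t 1" for h
      using linear_cmul[OF has_derivative_linear[OF D(1)[of t]], of h 1] by simp
    then have "D t = (\<lambda>h. h *\<^sub>R D t 1)" by (rule ext)
    then show ?thesis unfolding has_vector_derivative_def using D(1)[of t] by simp
  qed
  then show ?thesis by (intro bexI[OF _ D(2)[of 1]] allI)
qed

lemma poly_times_chirp_derivatives:
  assumes "f \<in> poly_times chirp_gauss"
  shows "\<exists>f1 \<in> poly_times chirp_gauss. \<exists>f2 \<in> poly_times chirp_gauss.
    (\<forall>x y. ((\<lambda>x. f (x, y)) has_vector_derivative f1 (x, y)) (at x)) \<and>
    (\<forall>x y. ((\<lambda>y. f (x, y)) has_vector_derivative f2 (x, y)) (at y))"
proof -
  have "\<exists>D. (\<forall>t. (f has_derivative D t) (at t)) \<and> (\<forall>v. (\<lambda>t. D t v) \<in> poly_times chirp_gauss)"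
    by (rule poly_times_has_derivative[OF assms chirp_gauss_closed]) (intro exI conjI allI)
  then obtain D where D0: "\<forall>t. (f has_derivative D t) (at t)" "\<forall>v. (\<lambda>t. D t v) \<in> poly_times chirp_gauss"
    by (elim exE conjE)
  note D = D0[rule_format]
  have 1: "((\<lambda>x. f (x, y)) has_vector_derivative D (x, y) (1, 0)) (at x)" for x y
  proof -
    have "((\<lambda>x. (x, y)) has_derivative (\<lambda>h. (h, 0))) (at x)"
      by (auto intro!: derivative_eq_intros)
    from has_derivative_compose[OF this D(1)]
    have "((\<lambda>x. f (x, y)) has_derivative (\<lambda>h. D (x, y) (h, 0))) (at x)" .
    moreover have "D (x, y) (h, 0) = h *\<^sub>R D (x, y) (1, 0)" for h
      using linear_cmul[OF has_derivative_linear[OF D(1)[of "(x,y)"]], of h "(1,0)"] by simp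
    then have "(\<lambda>h. D (x, y) (h, 0)) = (\<lambda>h. h *\<^sub>R D (x, y) (1, 0))" by (rule ext)
    ultimately show ?thesis unfolding has_vector_derivative_def by (simp only:)
  qed
  have 2: "((\<lambda>y. f (x, y)) has_vector_derivative D (x, y) (0, 1)) (at y)" for x y
  proof -
    have "((\<lambda>y. (x, y)) has_derivative (\<lambda>h. (0, h))) (at y)"
      by (auto intro!: derivative_eq_intros)
    from has_derivative_compose[OF this D(1)]
    have "((\<lambda>y. f (x, y)) has_derivative (\<lambda>h. D (x, y) (0, h))) (at y)" .
    moreover have "D (x, y) (0, h) = h *\<^sub>R D (x, y) (0, 1)" for h
      using linear_cmul[OF has_derivative_linear[OF D(1)[of "(x,y)"]], of h "(0,1)"] by simp
    then have "(\<lambda>h. D (x, y) (0, h)) = (\<lambda>h. h *\<^sub>R D (x, y) (0, 1))" by (rule ext)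
    ultimately show ?thesis unfolding has_vector_derivative_def by (simp only:)
  qed
  show ?thesis by (intro bexI[OF _ D(2)[of "(1, 0)"]] bexI[OF _ D(2)[of "(0, 1)"]] conjI allI 1 2)
qed

section \<open>Integration by parts on the plane\<close>

lemma gauss_bounded_slices:
  fixes V :: "real \<times> real \<Rightarrow> complex"
  assumes "gauss_bounded V"
  shows "gauss_bounded (\<lambda>x. V (x, y))" "gauss_bounded (\<lambda>y. V (x, y))"
proof -
  obtain C c where C: "C > 0" "c > 0" "\<And>z. cmod (V z) \<le> C * exp (- c * (norm z)\<^sup>2)"
    using assms unfolding gauss_bounded_def by blast
  have "cmod (V (x, y)) \<le> C * exp (- c * (norm x)\<^sup>2)" "cmod (V (x, y)) \<le> C * exp (- c * (norm y)\<^sup>2)" for x y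
  proof -
    have "C * exp (- c * (norm (x, y))\<^sup>2) \<le> C * exp (- c * (norm x)\<^sup>2)"
      "C * exp (- c * (norm (x, y))\<^sup>2) \<le> C * exp (- c * (norm y)\<^sup>2)"
      using C by (auto simp: norm_Pair)
    then show "cmod (V (x, y)) \<le> C * exp (- c * (norm x)\<^sup>2)" "cmod (V (x, y)) \<le> C * exp (- c * (norm y)\<^sup>2)"
      using C(3)[of "(x, y)"] by linarith+
  qed
  then show "gauss_bounded (\<lambda>x. V (x, y))" "gauss_bounded (\<lambda>y. V (x, y))"
    unfolding gauss_bounded_def using C(1,2) by blast+
qed

text \<open>A partial derivative integrates to zero along every line in its own direction, and
  Fubini finishes.\<close>

lemma integral_partial_derivative_eq_0:
  fixes V V' :: "real \<times> real \<Rightarrow> complex"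
  assumes V: "gauss_bounded V" and V': "gauss_bounded V'" "continuous_on UNIV V'"
  shows "(\<And>x y. ((\<lambda>x. V (x, y)) has_vector_derivative V' (x, y)) (at x)) \<Longrightarrow> (LINT z|lborel. V' z) = 0"
    and "(\<And>x y. ((\<lambda>y. V (x, y)) has_vector_derivative V' (x, y)) (at y)) \<Longrightarrow> (LINT z|lborel. V' z) = 0"
proof -
  have m: "V' \<in> borel_measurable borel" by (rule borel_measurable_continuous_onI[OF V'(2)])
  have i: "integrable (lborel \<Otimes>\<^sub>M lborel) (\<lambda>(x, y). V' (x, y))"
    using gauss_bounded_integrable[OF V'(1) m] by (simp add: lborel_prod)
  have c1: "continuous_on UNIV (\<lambda>x. V' (x, y))" "continuous_on UNIV (\<lambda>y. V' (x, y))" for x y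
    by (intro continuous_on_compose2[OF V'(2)] continuous_intros; simp)+
  have i1: "integrable lborel (\<lambda>x. V' (x, y))" "integrable lborel (\<lambda>y. V' (x, y))" for x y
    by (intro gauss_bounded_integrable gauss_bounded_slices V' borel_measurable_continuous_onI c1)+
  {
    assume "\<And>x y. ((\<lambda>x. V (x, y)) has_vector_derivative V' (x, y)) (at x)"
    then have "(LINT x|lborel. V' (x, y)) = 0" for y
      by (rule integral_derivative_eq_0) (intro c1 i1 gauss_bounded_tendsto gauss_bounded_slices V)+
    then have "0 = (LINT y|lborel. LINT x|lborel. V' (x, y))" by simp
    also have "\<dots> = (LINT z|lborel. V' z)"
      using lborel_pair.integral_snd[OF i] by (simp add: lborel_prod)
    finally show "(LINT z|lborel. V' z) = 0" by simp
  }
  {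
    assume "\<And>x y. ((\<lambda>y. V (x, y)) has_vector_derivative V' (x, y)) (at y)"
    then have "(LINT y|lborel. V' (x, y)) = 0" for x
      by (rule integral_derivative_eq_0) (intro c1 i1 gauss_bounded_tendsto gauss_bounded_slices V)+
    then have "0 = (LINT x|lborel. LINT y|lborel. V' (x, y))" by simp
    also have "\<dots> = (LINT z|lborel. V' z)"
      using lborel_pair.integral_fst'[OF i] by (simp add: lborel_prod)
    finally show "(LINT z|lborel. V' z) = 0" by simp
  }
qed

text \<open>
  For \<open>A = V\<^sub>k \<phi>\<^sub>n\<close>, \<open>v = \<phi>\<^sub>k\<close> and Gaussians \<open>g1\<close>, \<open>g2\<close> the kernel is one coordinate of the
  transform, at position \<open>(a, b)\<close> and frequency \<open>(e1, e2 + t)\<close>, of \<open>z \<mapsto> A(z) \<cdot> \<pi>(z) v(t)\<close>.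
\<close>

definition tf_integrand where
  "tf_integrand A v g1 g2 t a b e1 e2 z =
     A z * v (t - fst z) * g1 (fst z - a) * g2 (snd z - b) * wave (fst z * e1) * wave (snd z * e2)"
  for A :: "real \<times> real \<Rightarrow> complex" and v g1 g2 :: "real \<Rightarrow> complex" and t a b e1 e2 :: real

definition tf_kernel where
  "tf_kernel A v g1 g2 t a b e1 e2 = (LINT z|lborel. tf_integrand A v g1 g2 t a b e1 e2 z)"

text \<open>A Gaussian bound persists for all smaller rates with the same constant, so that several
  factors can be given one common rate.\<close>

lemma gauss_bounded_exponent:
  assumes "gauss_bounded f"
  shows "\<exists>C>0. \<exists>c>0. \<forall>d. 0 < d \<and> d \<le> c \<longrightarrow> (\<forall>x. cmod (f x) \<le> C * exp (- d * (norm x)\<^sup>2))"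
proof -
  obtain C c where C: "C > 0" "c > 0" "\<And>x. cmod (f x) \<le> C * exp (- c * (norm x)\<^sup>2)"
    using assms unfolding gauss_bounded_def by blast
  have "cmod (f x) \<le> C * exp (- d * (norm x)\<^sup>2)" if "0 < d" "d \<le> c" for d x
  proof -
    have "d * (norm x)\<^sup>2 \<le> c * (norm x)\<^sup>2" using that by (intro mult_right_mono) auto
    then have "C * exp (- c * (norm x)\<^sup>2) \<le> C * exp (- d * (norm x)\<^sup>2)" using C by auto
    then show ?thesis using C(3)[of x] by linarith
  qed
  then show ?thesis using C by blast
qed

text \<open>From t = x + (t - x) comes t^2 \<le> 2 x^2 + 2 (t - x)^2, likewise for a and b. The
  largest coefficient that then arises is 5, that of x^2, so 6 is a safe constant.\<close>

lemma square_sum_bound: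
  fixes x \<omega> t a b :: real
  shows "x\<^sup>2 + \<omega>\<^sup>2 + t\<^sup>2 + a\<^sup>2 + b\<^sup>2 \<le> 6 * (x\<^sup>2 + \<omega>\<^sup>2 + (t - x)\<^sup>2 + (x - a)\<^sup>2 + (\<omega> - b)\<^sup>2)"
proof -
  have "t\<^sup>2 \<le> 2 * x\<^sup>2 + 2 * (t - x)\<^sup>2" for t x :: real
    using zero_le_power2[of "t - 2 * x"] by (simp add: power2_eq_square algebra_simps)
  note * = this[of t x] this[of a x] this[of b \<omega>]
  have "X + W + T + A + B \<le> 6 * (X + W + P + Q + R)"
    if "T \<le> 2 * X + 2 * P" "A \<le> 2 * X + 2 * Q" "B \<le> 2 * W + 2 * R" "X \<ge> 0" "W \<ge> 0" "P \<ge> 0" "Q \<ge> 0" "R \<ge> 0"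
    for X W T A B P Q R :: real
    using that by auto
  from this[OF *] show ?thesis unfolding power2_commute[of x a] power2_commute[of \<omega> b] by simp
qed

text \<open>The characters have modulus one. The other four factors decay in x, \<omega>, t - x, x -
  a and \<omega> - b, and these five quantities control t, a, b and z at one sixth of the
  rate.\<close>

lemma tf_integrand_bound:
  assumes "gauss_bounded A" "gauss_bounded v" "gauss_bounded g1" "gauss_bounded g2"
  shows "\<exists>C>0. \<exists>c>0. \<forall>t a b e1 e2 z. cmod (tf_integrand A v g1 g2 t a b e1 e2 z)
     \<le> C * exp (- c * (t\<^sup>2 + a\<^sup>2 + b\<^sup>2)) * exp (- c * (norm z)\<^sup>2)"
proof -
  obtain C1 c1 where 1: "C1 > 0" "c1 > 0" "\<And>d x. 0 < d \<Longrightarrow> d \<le> c1 \<Longrightarrow> cmod (A x) \<le> C1 * exp (- d * (norm x)\<^sup>2)"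
    using gauss_bounded_exponent[OF assms(1)] by blast
  obtain C2 c2 where 2: "C2 > 0" "c2 > 0" "\<And>d x. 0 < d \<Longrightarrow> d \<le> c2 \<Longrightarrow> cmod (v x) \<le> C2 * exp (- d * (norm x)\<^sup>2)"
    using gauss_bounded_exponent[OF assms(2)] by blast
  obtain C3 c3 where 3: "C3 > 0" "c3 > 0" "\<And>d x. 0 < d \<Longrightarrow> d \<le> c3 \<Longrightarrow> cmod (g1 x) \<le> C3 * exp (- d * (norm x)\<^sup>2)"
    using gauss_bounded_exponent[OF assms(3)] by blast
  obtain C4 c4 where 4: "C4 > 0" "c4 > 0" "\<And>d x. 0 < d \<Longrightarrow> d \<le> c4 \<Longrightarrow> cmod (g2 x) \<le> C4 * exp (- d * (norm x)\<^sup>2)"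
    using gauss_bounded_exponent[OF assms(4)] by blast
  define c where "c = min (min c1 c2) (min c3 c4)"
  have c: "c > 0" "c \<le> c1" "c \<le> c2" "c \<le> c3" "c \<le> c4" using 1 2 3 4 unfolding c_def by auto
  have "cmod (tf_integrand A v g1 g2 t a b e1 e2 z) \<le> (C1 * C2 * C3 * C4) * exp (- (c / 6) * (t\<^sup>2 + a\<^sup>2 + b\<^sup>2)) * exp (- (c / 6) * (norm z)\<^sup>2)" for t a b e1 e2 z
  proof -
    obtain x \<omega> where z: "z = (x, \<omega>)" by (cases z)
    have "cmod (tf_integrand A v g1 g2 t a b e1 e2 z) = cmod (A z) * cmod (v (t - x)) * cmod (g1 (x - a)) * cmod (g2 (\<omega> - b))"
      unfolding tf_integrand_def z norm_mult norm_wave by simp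
    also have "\<dots> \<le> (C1 * exp (- c * (norm z)\<^sup>2)) * (C2 * exp (- c * (norm (t - x))\<^sup>2)) * (C3 * exp (- c * (norm (x - a))\<^sup>2)) * (C4 * exp (- c * (norm (\<omega> - b))\<^sup>2))"
      using 1 2 3 4 c by (intro mult_mono) auto
    also have "\<dots> = (C1 * C2 * C3 * C4) * exp (- c * (x\<^sup>2 + \<omega>\<^sup>2 + (t - x)\<^sup>2 + (x - a)\<^sup>2 + (\<omega> - b)\<^sup>2))"
    proof -
      have "exp (- c * (norm z)\<^sup>2) * exp (- c * (norm (t - x))\<^sup>2) * exp (- c * (norm (x - a))\<^sup>2) * exp (- c * (norm (\<omega> - b))\<^sup>2)
        = exp (- c * (x\<^sup>2 + \<omega>\<^sup>2 + (t - x)\<^sup>2 + (x - a)\<^sup>2 + (\<omega> - b)\<^sup>2))"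
        unfolding exp_add[symmetric] by (simp add: z norm_Pair distrib_left)
      then show ?thesis by (simp only: mult_ac)
    qed
    also have "\<dots> \<le> (C1 * C2 * C3 * C4) * exp (- (c / 6) * (x\<^sup>2 + \<omega>\<^sup>2 + t\<^sup>2 + a\<^sup>2 + b\<^sup>2))"
    proof -
      have "c / 6 * (x\<^sup>2 + \<omega>\<^sup>2 + t\<^sup>2 + a\<^sup>2 + b\<^sup>2) \<le> c / 6 * (6 * (x\<^sup>2 + \<omega>\<^sup>2 + (t - x)\<^sup>2 + (x - a)\<^sup>2 + (\<omega> - b)\<^sup>2))"
        using c(1) by (intro mult_left_mono square_sum_bound) auto
      then show ?thesis using 1(1) 2(1) 3(1) 4(1) by (intro mult_left_mono) (auto simp: algebra_simps)
    qed
    also have "exp (- (c / 6) * (x\<^sup>2 + \<omega>\<^sup>2 + t\<^sup>2 + a\<^sup>2 + b\<^sup>2)) = exp (- (c / 6) * (t\<^sup>2 + a\<^sup>2 + b\<^sup>2)) * exp (- (c / 6) * (norm z)\<^sup>2)"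
      unfolding exp_add[symmetric] by (simp add: z norm_Pair algebra_simps)
    finally show ?thesis by (simp add: mult.assoc)
  qed
  moreover have "C1 * C2 * C3 * C4 > 0" "c / 6 > 0" using 1 2 3 4 c by auto
  ultimately show ?thesis by blast
qed

text \<open>The frequencies are absent from the majorant: decay in frequency is expressed by
  bounding a kernel times powers of e1 and e2 in this sense.\<close>

definition gauss_dominated :: "(real \<Rightarrow> real \<Rightarrow> real \<Rightarrow> real \<Rightarrow> real \<Rightarrow> complex) \<Rightarrow> bool" where
  "gauss_dominated \<kappa> \<longleftrightarrow> (\<exists>C>0. \<exists>c>0. \<forall>t a b e1 e2. cmod (\<kappa> t a b e1 e2) \<le> C * exp (- c * (t\<^sup>2 + a\<^sup>2 + b\<^sup>2)))"

lemma gauss_dominated_add: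
  assumes "gauss_dominated \<kappa>" "gauss_dominated \<mu>"
  shows "gauss_dominated (\<lambda>t a b e1 e2. \<kappa> t a b e1 e2 + \<mu> t a b e1 e2)"
proof -
  obtain C c D d where C: "C > 0" "c > 0" "\<And>t a b e1 e2. cmod (\<kappa> t a b e1 e2) \<le> C * exp (- c * (t\<^sup>2 + a\<^sup>2 + b\<^sup>2))"
    and D: "D > 0" "d > 0" "\<And>t a b e1 e2. cmod (\<mu> t a b e1 e2) \<le> D * exp (- d * (t\<^sup>2 + a\<^sup>2 + b\<^sup>2))"
    using assms unfolding gauss_dominated_def by blast
  have "cmod (\<kappa> t a b e1 e2 + \<mu> t a b e1 e2) \<le> (C + D) * exp (- min c d * (t\<^sup>2 + a\<^sup>2 + b\<^sup>2))" for t a b e1 e2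
  proof -
    have "exp (- c * (t\<^sup>2 + a\<^sup>2 + b\<^sup>2)) \<le> exp (- min c d * (t\<^sup>2 + a\<^sup>2 + b\<^sup>2))"
         "exp (- d * (t\<^sup>2 + a\<^sup>2 + b\<^sup>2)) \<le> exp (- min c d * (t\<^sup>2 + a\<^sup>2 + b\<^sup>2))"
      by (auto intro!: mult_right_mono)
    then have "C * exp (- c * (t\<^sup>2 + a\<^sup>2 + b\<^sup>2)) + D * exp (- d * (t\<^sup>2 + a\<^sup>2 + b\<^sup>2))
      \<le> C * exp (- min c d * (t\<^sup>2 + a\<^sup>2 + b\<^sup>2)) + D * exp (- min c d * (t\<^sup>2 + a\<^sup>2 + b\<^sup>2))"
      using C(1) D(1) by (intro add_mono mult_left_mono) auto
    then show ?thesis using C(3)[of t a b e1 e2] D(3)[of t a b e1 e2] norm_triangle_ineq[of "\<kappa> t a b e1 e2" "\<mu> t a b e1 e2"]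
      by (simp add: distrib_right)
  qed
  moreover have "C + D > 0" "min c d > 0" using C D by auto
  ultimately show ?thesis unfolding gauss_dominated_def by blast
qed

lemma gauss_dominated_scale:
  assumes "gauss_dominated \<kappa>"
  shows "gauss_dominated (\<lambda>t a b e1 e2. s * \<kappa> t a b e1 e2)"
proof -
  obtain C c where C: "C > 0" "c > 0" "\<And>t a b e1 e2. cmod (\<kappa> t a b e1 e2) \<le> C * exp (- c * (t\<^sup>2 + a\<^sup>2 + b\<^sup>2))"
    using assms unfolding gauss_dominated_def by blast
  have "cmod (s * \<kappa> t a b e1 e2) \<le> (1 + cmod s) * C * exp (- c * (t\<^sup>2 + a\<^sup>2 + b\<^sup>2))" for t a b e1 e2
    unfolding norm_mult mult.assoc using C by (intro mult_mono) auto
  moreover have "(1 + cmod s) * C > 0" using C(1) by (intro mult_pos_pos) (auto intro: add_pos_nonneg)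
  ultimately show ?thesis unfolding gauss_dominated_def using C(2) by blast
qed

context
  fixes A :: "real \<times> real \<Rightarrow> complex" and v g1 g2 :: "real \<Rightarrow> complex"
  assumes PT: "A \<in> poly_times chirp_gauss" "v \<in> poly_times gauss1" "g1 \<in> poly_times gauss1" "g2 \<in> poly_times gauss1"
begin

lemma tf_integrand_bound':
  "\<exists>C>0. \<exists>c>0. \<forall>t a b e1 e2 z. cmod (tf_integrand A v g1 g2 t a b e1 e2 z)
     \<le> C * exp (- c * (t\<^sup>2 + a\<^sup>2 + b\<^sup>2)) * exp (- c * (norm z)\<^sup>2)"
  using PT by (intro tf_integrand_bound poly_times_gauss_bounded[OF _ chirp_gauss_bounded] poly_times_gauss_bounded[OF _ gauss1_bounded])

lemma tf_integrand_gauss_bounded: "gauss_bounded (tf_integrand A v g1 g2 t a b e1 e2)"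
proof -
  obtain C c where C: "C > 0" "c > 0" "\<And>t a b e1 e2 z. cmod (tf_integrand A v g1 g2 t a b e1 e2 z)
     \<le> C * exp (- c * (t\<^sup>2 + a\<^sup>2 + b\<^sup>2)) * exp (- c * (norm z)\<^sup>2)"
    using tf_integrand_bound' by blast
  then show ?thesis unfolding gauss_bounded_def
    by (intro exI[of _ "C * exp (- c * (t\<^sup>2 + a\<^sup>2 + b\<^sup>2))"] conjI exI[of _ c]) auto
qed

lemma tf_integrand_continuous: "continuous_on UNIV (tf_integrand A v g1 g2 t a b e1 e2)"
proof -
  have [continuous_intros]: "continuous_on S f \<Longrightarrow> continuous_on S (\<lambda>x. v (f x))"
    "continuous_on S f \<Longrightarrow> continuous_on S (\<lambda>x. g1 (f x))"
    "continuous_on S f \<Longrightarrow> continuous_on S (\<lambda>x. g2 (f x))" for S :: "(real \<times> real) set" and f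
    by (rule continuous_on_compose2[OF poly_times_continuous[OF _ gauss1_closed, of _ UNIV]], rule PT, simp, simp)+
  have [continuous_intros]: "continuous_on S A" for S
    by (rule poly_times_continuous[OF PT(1) chirp_gauss_closed])
  show ?thesis unfolding tf_integrand_def by (intro continuous_intros)
qed

lemma tf_integrand_integrable: "integrable lborel (tf_integrand A v g1 g2 t a b e1 e2)"
  by (intro gauss_bounded_integrable tf_integrand_gauss_bounded borel_measurable_continuous_onI tf_integrand_continuous)

lemma tf_kernel_has_integral:
  "has_bochner_integral lborel (tf_integrand A v g1 g2 t a b e1 e2) (tf_kernel A v g1 g2 t a b e1 e2)"
  unfolding tf_kernel_def by (rule has_bochner_integral_integrable[OF tf_integrand_integrable])

lemma tf_kernel_dominated: "gauss_dominated (tf_kernel A v g1 g2)"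
proof -
  obtain C c where C: "C > 0" "c > 0" "\<And>t a b e1 e2 z. cmod (tf_integrand A v g1 g2 t a b e1 e2 z)
     \<le> C * exp (- c * (t\<^sup>2 + a\<^sup>2 + b\<^sup>2)) * exp (- c * (norm z)\<^sup>2)"
    using tf_integrand_bound' by blast
  define M where "M = (LINT z|lborel. exp (- c * (norm (z :: real \<times> real))\<^sup>2))"
  have "M \<ge> 0" unfolding M_def by simp
  have "cmod (tf_kernel A v g1 g2 t a b e1 e2) \<le> (C * (M + 1)) * exp (- c * (t\<^sup>2 + a\<^sup>2 + b\<^sup>2))" for t a b e1 e2
  proof -
    have "cmod (tf_kernel A v g1 g2 t a b e1 e2) \<le> (LINT z|lborel. C * exp (- c * (t\<^sup>2 + a\<^sup>2 + b\<^sup>2)) * exp (- c * (norm (z :: real \<times> real))\<^sup>2))"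
      unfolding tf_kernel_def
      by (intro Bochner_Integration.integral_norm_bound_integral tf_integrand_integrable integrable_mult_right integrable_exp_norm_square C)
    also have "\<dots> = C * exp (- c * (t\<^sup>2 + a\<^sup>2 + b\<^sup>2)) * M" unfolding M_def by simp
    also have "\<dots> \<le> C * exp (- c * (t\<^sup>2 + a\<^sup>2 + b\<^sup>2)) * (M + 1)" using C by (intro mult_left_mono) auto
    finally show ?thesis by (simp add: mult_ac)
  qed
  moreover have "C * (M + 1) > 0" using C(1) \<open>M \<ge> 0\<close> by auto
  ultimately show ?thesis unfolding gauss_dominated_def using C(2) by blast
qed

end

lemma poly_times_affine_derivatives:
  fixes v v' :: "real \<Rightarrow> complex"
  assumes "\<And>t. (v has_vector_derivative v' t) (at t)"
  shows "((\<lambda>x. v (t - x)) has_vector_derivative - v' (t - x)) (at x)"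
    and "((\<lambda>x. v (x - a)) has_vector_derivative v' (x - a)) (at x)"
proof -
  have "((\<lambda>x. t - x) has_vector_derivative - 1) (at x)" "((\<lambda>x. x - a) has_vector_derivative 1) (at x)"
    by (auto intro!: derivative_eq_intros)
  from vector_diff_chain_at[OF this(1) assms] vector_diff_chain_at[OF this(2) assms]
  show "((\<lambda>x. v (t - x)) has_vector_derivative - v' (t - x)) (at x)"
    "((\<lambda>x. v (x - a)) has_vector_derivative v' (x - a)) (at x)" by (simp_all add: o_def)
qed

text \<open>Integration by parts trades a frequency factor for derivatives of the four functions.\<close>

lemma tf_kernel_step:
  assumes PT: "A \<in> poly_times chirp_gauss" "v \<in> poly_times gauss1" "g1 \<in> poly_times gauss1" "g2 \<in> poly_times gauss1"
  shows "\<exists>A1 \<in> poly_times chirp_gauss. \<exists>v' \<in> poly_times gauss1. \<exists>g1' \<in> poly_times gauss1. \<forall>t a b e1 e2.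
       2 * pi * \<i> * of_real e1 * tf_kernel A v g1 g2 t a b e1 e2 =
         tf_kernel A1 v g1 g2 t a b e1 e2 + - tf_kernel A v' g1 g2 t a b e1 e2 + tf_kernel A v g1' g2 t a b e1 e2"
    and "\<exists>A2 \<in> poly_times chirp_gauss. \<exists>g2' \<in> poly_times gauss1. \<forall>t a b e1 e2.
       2 * pi * \<i> * of_real e2 * tf_kernel A v g1 g2 t a b e1 e2 =
         tf_kernel A2 v g1 g2 t a b e1 e2 + tf_kernel A v g1 g2' t a b e1 e2"
proof -
  obtain A1 A2 where A0: "\<forall>x y. ((\<lambda>x. A (x, y)) has_vector_derivative A1 (x, y)) (at x)" "A1 \<in> poly_times chirp_gauss"
    "\<forall>x y. ((\<lambda>y. A (x, y)) has_vector_derivative A2 (x, y)) (at y)" "A2 \<in> poly_times chirp_gauss"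
    using poly_times_chirp_derivatives[OF PT(1)] by (elim bexE conjE)
  note A = A0(1)[rule_format] A0(2) A0(3)[rule_format] A0(4)
  obtain v' where v0: "\<forall>t. (v has_vector_derivative v' t) (at t)" "v' \<in> poly_times gauss1"
    using poly_times_gauss1_derivative[OF PT(2)] by (elim bexE)
  note v = v0(1)[rule_format] v0(2)
  obtain g1' where g10: "\<forall>t. (g1 has_vector_derivative g1' t) (at t)" "g1' \<in> poly_times gauss1"
    using poly_times_gauss1_derivative[OF PT(3)] by (elim bexE)
  note g1 = g10(1)[rule_format] g10(2)
  obtain g2' where g20: "\<forall>t. (g2 has_vector_derivative g2' t) (at t)" "g2' \<in> poly_times gauss1"
    using poly_times_gauss1_derivative[OF PT(4)] by (elim bexE)
  note g2 = g20(1)[rule_format] g20(2)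
  note T = tf_integrand_gauss_bounded tf_integrand_continuous
  have E1: "2 * pi * \<i> * of_real e1 * tf_kernel A v g1 g2 t a b e1 e2 =
       tf_kernel A1 v g1 g2 t a b e1 e2 + - tf_kernel A v' g1 g2 t a b e1 e2 + tf_kernel A v g1' g2 t a b e1 e2" for t a b e1 e2
  proof -
    define V where "V = tf_integrand A v g1 g2 t a b e1 e2"
    \<comment> \<open>The product rule; the sign of the \<open>v'\<close> term comes from evaluating
      \<open>v\<close> at t minus the first coordinate.\<close>
    define D where "D z = (- 2 * pi * \<i> * of_real e1) * V z + (tf_integrand A1 v g1 g2 t a b e1 e2 z + (-1) * tf_integrand A v' g1 g2 t a b e1 e2 z + tf_integrand A v g1' g2 t a b e1 e2 z)" for z
    have d: "((\<lambda>x. V (x, y)) has_vector_derivative D (x, y)) (at x)" for x y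
      unfolding V_def tf_integrand_def fst_conv snd_conv
      by (rule has_vector_derivative_eq_rhs,
          (rule has_vector_derivative_mult A(1) poly_times_affine_derivatives(1)[OF v(1)] poly_times_affine_derivatives(2)[OF g1(1)] wave_deriv has_vector_derivative_const)+)
        (simp only: D_def V_def tf_integrand_def fst_conv snd_conv, algebra)
    have g: "gauss_bounded V"
      unfolding V_def by (intro T A v g1 g2 PT)
    have "continuous_on UNIV D"
      unfolding D_def V_def by (intro continuous_intros T A v g1 g2 PT)
    moreover have "gauss_bounded D"
      unfolding D_def V_def by (intro gauss_bounded_add gauss_bounded_scale T A v g1 g2 PT)
    ultimately have "(LINT z|lborel. D z) = 0"
      by (intro integral_partial_derivative_eq_0(1)[OF g _ _ d])
    moreover have "has_bochner_integral lborel D ((- 2 * pi * \<i> * of_real e1) * tf_kernel A v g1 g2 t a b e1 e2 + (tf_kernel A1 v g1 g2 t a b e1 e2 + (-1) * tf_kernel A v' g1 g2 t a b e1 e2 + tf_kernel A v g1' g2 t a b e1 e2))"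
      unfolding D_def V_def by (intro has_bochner_integral_add has_bochner_integral_mult_right tf_kernel_has_integral A v g1 g2 PT)
    ultimately show ?thesis
      using has_bochner_integral_integral_eq[of lborel D] by (simp add: algebra_simps)
  qed
  have E2: "2 * pi * \<i> * of_real e2 * tf_kernel A v g1 g2 t a b e1 e2 =
       tf_kernel A2 v g1 g2 t a b e1 e2 + tf_kernel A v g1 g2' t a b e1 e2" for t a b e1 e2
  proof -
    define V where "V = tf_integrand A v g1 g2 t a b e1 e2"
    define D where "D z = (- 2 * pi * \<i> * of_real e2) * V z + (tf_integrand A2 v g1 g2 t a b e1 e2 z + tf_integrand A v g1 g2' t a b e1 e2 z)" for z
    have d: "((\<lambda>y. V (x, y)) has_vector_derivative D (x, y)) (at y)" for x y
      unfolding V_def tf_integrand_def fst_conv snd_conv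
      by (rule has_vector_derivative_eq_rhs,
          (rule has_vector_derivative_mult A(3) poly_times_affine_derivatives(2)[OF g2(1)] wave_deriv has_vector_derivative_const)+)
        (simp only: D_def V_def tf_integrand_def fst_conv snd_conv, algebra)
    have g: "gauss_bounded V"
      unfolding V_def by (intro T A v g1 g2 PT)
    have "continuous_on UNIV D"
      unfolding D_def V_def by (intro continuous_intros T A v g1 g2 PT)
    moreover have "gauss_bounded D"
      unfolding D_def V_def by (intro gauss_bounded_add gauss_bounded_scale T A v g1 g2 PT)
    ultimately have "(LINT z|lborel. D z) = 0"
      by (intro integral_partial_derivative_eq_0(2)[OF g _ _ d])
    moreover have "has_bochner_integral lborel D ((- 2 * pi * \<i> * of_real e2) * tf_kernel A v g1 g2 t a b e1 e2 + (tf_kernel A2 v g1 g2 t a b e1 e2 + tf_kernel A v g1 g2' t a b e1 e2))"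
      unfolding D_def V_def by (intro has_bochner_integral_add has_bochner_integral_mult_right tf_kernel_has_integral A v g1 g2 PT)
    ultimately show ?thesis
      using has_bochner_integral_integral_eq[of lborel D] by (simp add: algebra_simps)
  qed
  show "\<exists>A1 \<in> poly_times chirp_gauss. \<exists>v' \<in> poly_times gauss1. \<exists>g1' \<in> poly_times gauss1. \<forall>t a b e1 e2.
       2 * pi * \<i> * of_real e1 * tf_kernel A v g1 g2 t a b e1 e2 =
         tf_kernel A1 v g1 g2 t a b e1 e2 + - tf_kernel A v' g1 g2 t a b e1 e2 + tf_kernel A v g1' g2 t a b e1 e2"
    by (intro bexI[OF _ A(2)] bexI[OF _ v(2)] bexI[OF _ g1(2)] allI E1)
  show "\<exists>A2 \<in> poly_times chirp_gauss. \<exists>g2' \<in> poly_times gauss1. \<forall>t a b e1 e2.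
       2 * pi * \<i> * of_real e2 * tf_kernel A v g1 g2 t a b e1 e2 =
         tf_kernel A2 v g1 g2 t a b e1 e2 + tf_kernel A v g1 g2' t a b e1 e2"
    by (intro bexI[OF _ A(4)] bexI[OF _ g2(2)] allI E2)
qed

text \<open>Each power of a frequency is removed by one application of
  \<open>tf_kernel_step\<close>. The four functions must vary in the induction, since a step
  replaces one of them by its derivative.\<close>

lemma tf_kernel_moments:
  assumes "A \<in> poly_times chirp_gauss" "v \<in> poly_times gauss1" "g1 \<in> poly_times gauss1" "g2 \<in> poly_times gauss1"
  shows "gauss_dominated (\<lambda>t a b e1 e2. of_real (e1 ^ i) * (of_real (e2 ^ j) * tf_kernel A v g1 g2 t a b e1 e2))"
  using assms
proof (induction i arbitrary: A v g1 g2)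
  case 0
  then show ?case
  proof (induction j arbitrary: A v g1 g2)
    case 0
    then show ?case using tf_kernel_dominated by simp
  next
    case (Suc j)
    obtain A2 g2' where s0: "A2 \<in> poly_times chirp_gauss" "g2' \<in> poly_times gauss1"
      "\<forall>t a b e1 e2. 2 * pi * \<i> * of_real e2 * tf_kernel A v g1 g2 t a b e1 e2 =
       tf_kernel A2 v g1 g2 t a b e1 e2 + tf_kernel A v g1 g2' t a b e1 e2"
      using tf_kernel_step(2)[OF Suc.prems] by (elim bexE)
    note s = s0(1,2) s0(3)[rule_format]
    have e: "of_real (e1 ^ 0) * (of_real (e2 ^ Suc j) * tf_kernel A v g1 g2 t a b e1 e2) =
      (1 / (2 * pi * \<i>)) * (of_real (e1 ^ 0) * (of_real (e2 ^ j) * tf_kernel A2 v g1 g2 t a b e1 e2) +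
        of_real (e1 ^ 0) * (of_real (e2 ^ j) * tf_kernel A v g1 g2' t a b e1 e2))" for t a b e1 e2
    proof -
      have "of_real e2 * tf_kernel A v g1 g2 t a b e1 e2 = (1 / (2 * pi * \<i>)) * (2 * pi * \<i> * of_real e2 * tf_kernel A v g1 g2 t a b e1 e2)"
        by simp
      then have x: "of_real e2 * tf_kernel A v g1 g2 t a b e1 e2 = (1 / (2 * pi * \<i>)) *
        (tf_kernel A2 v g1 g2 t a b e1 e2 + tf_kernel A v g1 g2' t a b e1 e2)" unfolding s(3) .
      have "of_real (e1 ^ 0) * (of_real (e2 ^ Suc j) * tf_kernel A v g1 g2 t a b e1 e2) =
        of_real (e1 ^ 0) * of_real (e2 ^ j) * (of_real e2 * tf_kernel A v g1 g2 t a b e1 e2)" by (simp add: mult_ac)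
      also have "\<dots> = (1 / (2 * pi * \<i>)) * (of_real (e1 ^ 0) * (of_real (e2 ^ j) * tf_kernel A2 v g1 g2 t a b e1 e2) +
        of_real (e1 ^ 0) * (of_real (e2 ^ j) * tf_kernel A v g1 g2' t a b e1 e2))"
        unfolding x by (simp only: distrib_left mult_ac)
      finally show ?thesis .
    qed
    show ?case unfolding e
      by (intro gauss_dominated_scale gauss_dominated_add Suc.IH s Suc.prems)
  qed
next
  case (Suc i)
  obtain A1 v' g1' where s0: "A1 \<in> poly_times chirp_gauss" "v' \<in> poly_times gauss1" "g1' \<in> poly_times gauss1"
    "\<forall>t a b e1 e2. 2 * pi * \<i> * of_real e1 * tf_kernel A v g1 g2 t a b e1 e2 =
     tf_kernel A1 v g1 g2 t a b e1 e2 + - tf_kernel A v' g1 g2 t a b e1 e2 + tf_kernel A v g1' g2 t a b e1 e2"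
    using tf_kernel_step(1)[OF Suc.prems] by (elim bexE)
  note s = s0(1,2,3) s0(4)[rule_format]
  have e: "of_real (e1 ^ Suc i) * (of_real (e2 ^ j) * tf_kernel A v g1 g2 t a b e1 e2) =
    (1 / (2 * pi * \<i>)) * (of_real (e1 ^ i) * (of_real (e2 ^ j) * tf_kernel A1 v g1 g2 t a b e1 e2) +
      (-1) * (of_real (e1 ^ i) * (of_real (e2 ^ j) * tf_kernel A v' g1 g2 t a b e1 e2)) +
      of_real (e1 ^ i) * (of_real (e2 ^ j) * tf_kernel A v g1' g2 t a b e1 e2))" for t a b e1 e2
  proof -
    have "of_real e1 * tf_kernel A v g1 g2 t a b e1 e2 = (1 / (2 * pi * \<i>)) * (2 * pi * \<i> * of_real e1 * tf_kernel A v g1 g2 t a b e1 e2)"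
      by simp
    then have x: "of_real e1 * tf_kernel A v g1 g2 t a b e1 e2 = (1 / (2 * pi * \<i>)) *
      (tf_kernel A1 v g1 g2 t a b e1 e2 + - tf_kernel A v' g1 g2 t a b e1 e2 + tf_kernel A v g1' g2 t a b e1 e2)" unfolding s(4) .
    have "of_real (e1 ^ Suc i) * (of_real (e2 ^ j) * tf_kernel A v g1 g2 t a b e1 e2) =
      of_real (e1 ^ i) * of_real (e2 ^ j) * (of_real e1 * tf_kernel A v g1 g2 t a b e1 e2)" by (simp add: mult_ac)
    also have "\<dots> = (1 / (2 * pi * \<i>)) * (of_real (e1 ^ i) * (of_real (e2 ^ j) * tf_kernel A1 v g1 g2 t a b e1 e2) +
      (-1) * (of_real (e1 ^ i) * (of_real (e2 ^ j) * tf_kernel A v' g1 g2 t a b e1 e2)) +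
      of_real (e1 ^ i) * (of_real (e2 ^ j) * tf_kernel A v g1' g2 t a b e1 e2))"
      unfolding x by (simp only: distrib_left mult_ac) simp
    finally show ?thesis .
  qed
  show ?case unfolding e
    by (intro gauss_dominated_scale gauss_dominated_add Suc.IH s Suc.prems)
qed

text \<open>The moments of orders 0 and 2 in each frequency add up to the factor (1 + e1^2) (1 +
  e2^2), whose inverse is integrable.\<close>

lemma tf_kernel_bound:
  assumes "A \<in> poly_times chirp_gauss" "v \<in> poly_times gauss1" "g1 \<in> poly_times gauss1" "g2 \<in> poly_times gauss1"
  shows "\<exists>C>0. \<exists>c>0. \<forall>t a b e1 e2. cmod (tf_kernel A v g1 g2 t a b e1 e2) \<le>
     C * exp (- c * (t\<^sup>2 + a\<^sup>2 + b\<^sup>2)) * (inverse (1 + e1\<^sup>2) * inverse (1 + e2\<^sup>2))"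
proof -
  let ?m = "\<lambda>i j t a b e1 e2. of_real (e1 ^ i) * (of_real (e2 ^ j) * tf_kernel A v g1 g2 t a b e1 e2)"
  have "gauss_dominated (\<lambda>t a b e1 e2. (?m 0 0 t a b e1 e2 + ?m 2 0 t a b e1 e2) + (?m 0 2 t a b e1 e2 + ?m 2 2 t a b e1 e2))"
    by (intro gauss_dominated_add tf_kernel_moments assms)
  moreover have "(?m 0 0 t a b e1 e2 + ?m 2 0 t a b e1 e2) + (?m 0 2 t a b e1 e2 + ?m 2 2 t a b e1 e2) =
    of_real ((1 + e1\<^sup>2) * (1 + e2\<^sup>2)) * tf_kernel A v g1 g2 t a b e1 e2" for t a b e1 e2
    by (simp add: algebra_simps)
  ultimately obtain C c where C: "C > 0" "c > 0"
    and b: "\<And>t a b e1 e2. cmod (of_real ((1 + e1\<^sup>2) * (1 + e2\<^sup>2)) * tf_kernel A v g1 g2 t a b e1 e2) \<le> C * exp (- c * (t\<^sup>2 + a\<^sup>2 + b\<^sup>2))"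
    unfolding gauss_dominated_def by auto
  have "cmod (tf_kernel A v g1 g2 t a b e1 e2) \<le> C * exp (- c * (t\<^sup>2 + a\<^sup>2 + b\<^sup>2)) * (inverse (1 + e1\<^sup>2) * inverse (1 + e2\<^sup>2))" for t a b e1 e2
  proof -
    have p: "(1 + e1\<^sup>2) * (1 + e2\<^sup>2) > 0" by (intro mult_pos_pos add_pos_nonneg) auto
    then have "(1 + e1\<^sup>2) * (1 + e2\<^sup>2) * cmod (tf_kernel A v g1 g2 t a b e1 e2) \<le> C * exp (- c * (t\<^sup>2 + a\<^sup>2 + b\<^sup>2))"
      using b[of e1 e2 t a b] unfolding norm_mult norm_of_real by simp
    then have "cmod (tf_kernel A v g1 g2 t a b e1 e2) \<le> C * exp (- c * (t\<^sup>2 + a\<^sup>2 + b\<^sup>2)) / ((1 + e1\<^sup>2) * (1 + e2\<^sup>2))"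
      using p by (subst pos_le_divide_eq) (auto simp: mult.commute)
    then show ?thesis by (simp add: divide_inverse)
  qed
  then show ?thesis using C by blast
qed

section \<open>Polar coordinates\<close>

lemma borel_measurable_vec_nth [measurable (raw)]:
  "f \<in> borel_measurable M \<Longrightarrow> (\<lambda>x. (f x :: real^'d::finite) $ j) \<in> borel_measurable M"
  using measurable_compose[OF _ vec_nth_measurable] .

definition sqr_moduli :: "'d::finite phase \<Rightarrow> real ^ 'd" where
  "sqr_moduli z = (\<chi> j. pi * (moduli z $ j)\<^sup>2)"

lemma moduli_nth: "(moduli z $ j)\<^sup>2 = (fst z $ j)\<^sup>2 + (snd z $ j)\<^sup>2"
  by (simp add: moduli_def case_prod_unfold cmod_power2)

lemma moduli_nonneg: "moduli z $ j \<ge> 0"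
  by (simp add: moduli_def case_prod_unfold)

lemma sqr_moduli_nth: "sqr_moduli z $ j = pi * ((fst z $ j)\<^sup>2 + (snd z $ j)\<^sup>2)"
  by (simp add: sqr_moduli_def moduli_nth)

lemma sqr_moduli_measurable [measurable]: "(sqr_moduli :: 'd::finite phase \<Rightarrow> _) \<in> borel_measurable borel"
proof -
  have "(\<lambda>z::'d phase. \<chi> j. pi * ((fst z $ j)\<^sup>2 + (snd z $ j)\<^sup>2)) \<in> borel_measurable (borel \<Otimes>\<^sub>M borel)"
    by measurable
  moreover have "sqr_moduli = (\<lambda>z::'d phase. \<chi> j. pi * ((fst z $ j)\<^sup>2 + (snd z $ j)\<^sup>2))"
    by (auto simp: fun_eq_iff vec_eq_iff sqr_moduli_nth)
  ultimately show ?thesis by (simp add: borel_prod)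
qed

text \<open>The disc of radius sqrt (a / pi) has area a; the factor pi in the substitution is chosen
  for this.\<close>

lemma emeasure_disc: "emeasure lborel {p :: real \<times> real. pi * ((fst p)\<^sup>2 + (snd p)\<^sup>2) \<le> a} = ennreal (max 0 a)"
proof (cases "a < 0")
  case True
  have "{p :: real \<times> real. pi * ((fst p)\<^sup>2 + (snd p)\<^sup>2) \<le> a} = {}"
  proof -
    have "0 \<le> pi * ((fst p)\<^sup>2 + (snd p)\<^sup>2)" for p :: "real \<times> real" by simp
    then show ?thesis using True by (auto simp: not_le intro: less_le_trans)
  qed
  then show ?thesis using True by simp
next
  case False
  have "pi * ((fst p)\<^sup>2 + (snd p)\<^sup>2) \<le> a \<longleftrightarrow> norm p \<le> sqrt (a / pi)" for p :: "real \<times> real"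
  proof -
    have "pi * ((fst p)\<^sup>2 + (snd p)\<^sup>2) \<le> a \<longleftrightarrow> (fst p)\<^sup>2 + (snd p)\<^sup>2 \<le> a / pi"
      by (simp add: field_simps)
    then show ?thesis by (simp add: norm_prod_def)
  qed
  then have "{p :: real \<times> real. pi * ((fst p)\<^sup>2 + (snd p)\<^sup>2) \<le> a} = cball 0 (sqrt (a / pi))"
    by auto
  then have "emeasure lborel {p :: real \<times> real. pi * ((fst p)\<^sup>2 + (snd p)\<^sup>2) \<le> a} = ennreal (unit_ball_vol 2 * (sqrt (a / pi))\<^sup>2)"
    using False by (simp add: emeasure_cball)
  also have "unit_ball_vol 2 * (sqrt (a / pi))\<^sup>2 = a"
    using False by (simp add: unit_ball_vol_2)
  finally show ?thesis using False by (simp add: max_def)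
qed

text \<open>Both measures give the orthant \<open>{..a}\<close> the product of the numbers max 0
  a_j, by \<open>emeasure_disc\<close> on one side and interval lengths on the other, and the
  orthants form a generator of the Borel sets stable under intersection.\<close>

lemma distr_sqr_moduli: "distr lborel borel (sqr_moduli :: 'd::finite phase \<Rightarrow> _) = density lborel (indicator Vd)"
proof (rule measure_eqI_generator_eq)
  let ?M = "distr lborel borel (sqr_moduli :: 'd phase \<Rightarrow> _)" and ?N = "density lborel (indicator Vd) :: (real^'d) measure"
  have Vd[measurable]: "Vd \<in> sets (borel :: (real^'d) measure)"
    unfolding Vd_def by measurable
  have M: "emeasure ?M {..a} = (\<Prod>j\<in>UNIV. ennreal (max 0 (a $ j)))" for a
  proof -
    have "emeasure ?M {..a} = (\<integral>\<^sup>+z. (\<Prod>j\<in>UNIV. indicator {p. pi * ((fst p)\<^sup>2 + (snd p)\<^sup>2) \<le> a $ j} (fst (z :: 'd phase) $ j, snd z $ j)) \<partial>lborel)"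
    proof -
      have i: "indicator (sqr_moduli -` {..a}) z = (\<Prod>j\<in>UNIV. indicator {p. pi * ((fst p)\<^sup>2 + (snd p)\<^sup>2) \<le> a $ j} (fst z $ j, snd z $ j) :: ennreal)" for z
        by (auto simp: indicator_def less_eq_vec_def sqr_moduli_nth)
      have "emeasure ?M {..a} = emeasure lborel (sqr_moduli -` {..a} :: 'd phase set)"
        by (subst emeasure_distr) auto
      also have "\<dots> = (\<integral>\<^sup>+z. indicator (sqr_moduli -` {..a}) (z :: 'd phase) \<partial>lborel)"
        by (subst nn_integral_indicator) (auto intro!: measurable_sets_borel[OF sqr_moduli_measurable])
      finally show ?thesis unfolding i .
    qed
    also have "\<dots> = (\<Prod>j\<in>UNIV. \<integral>\<^sup>+s. indicator {p. pi * ((fst p)\<^sup>2 + (snd p)\<^sup>2) \<le> a $ j} s \<partial>lborel)"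
    proof (rule nn_integral_phase_prod)
      fix j
      have "(\<lambda>p::real\<times>real. pi * ((fst p)\<^sup>2 + (snd p)\<^sup>2)) \<in> borel_measurable (borel \<Otimes>\<^sub>M borel)" by measurable
      then have "{p::real\<times>real. pi * ((fst p)\<^sup>2 + (snd p)\<^sup>2) \<le> a $ j} \<in> sets borel"
        unfolding borel_prod by measurable
      then show "indicator {p::real\<times>real. pi * ((fst p)\<^sup>2 + (snd p)\<^sup>2) \<le> a $ j} \<in> borel_measurable borel" by measurable
    qed
    also have "\<dots> = (\<Prod>j\<in>UNIV. ennreal (max 0 (a $ j)))"
    proof (intro prod.cong refl)
      fix j
      have "(\<lambda>p::real\<times>real. pi * ((fst p)\<^sup>2 + (snd p)\<^sup>2)) \<in> borel_measurable (borel \<Otimes>\<^sub>M borel)" by measurable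
      then have "{p::real\<times>real. pi * ((fst p)\<^sup>2 + (snd p)\<^sup>2) \<le> a $ j} \<in> sets borel"
        unfolding borel_prod by measurable
      then show "(\<integral>\<^sup>+s. indicator {p::real\<times>real. pi * ((fst p)\<^sup>2 + (snd p)\<^sup>2) \<le> a $ j} s \<partial>lborel) = ennreal (max 0 (a $ j))"
        by (subst nn_integral_indicator) (auto simp: emeasure_disc)
    qed
    finally show ?thesis .
  qed
  have N: "emeasure ?N {..a} = (\<Prod>j\<in>UNIV. ennreal (max 0 (a $ j)))" for a
  proof -
    have "emeasure ?N {..a} = (\<integral>\<^sup>+u. (\<Prod>j\<in>UNIV. indicator {0..a $ j} (u $ j)) \<partial>lborel)"
      by (subst emeasure_density) (auto intro!: nn_integral_cong simp: indicator_def Vd_def less_eq_vec_def)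
    also have "\<dots> = (\<Prod>j\<in>UNIV. \<integral>\<^sup>+s. indicator {0..a $ j} s \<partial>lborel)"
      by (rule nn_integral_vec_prod) auto
    also have "\<dots> = (\<Prod>j\<in>UNIV. ennreal (max 0 (a $ j)))"
      by (intro prod.cong refl) (auto simp: max_def)
    finally show ?thesis .
  qed
  show "Int_stable (range atMost :: (real^'d) set set)"
  proof (rule Int_stableI)
    fix X Y :: "(real^'d) set" assume "X \<in> range atMost" "Y \<in> range atMost"
    then obtain x y where "X = {..x}" "Y = {..y}" by auto
    then have "X \<inter> Y = {..inf x y}" by auto
    then show "X \<inter> Y \<in> range atMost" by blast
  qed
  show "emeasure ?M X = emeasure ?N X" if "X \<in> range atMost" for X
    using that M N by auto
  show "sets ?M = sigma_sets UNIV (range atMost)" "sets ?N = sigma_sets UNIV (range atMost)"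
    by (simp_all add: borel_eq_atMost)
  show "range (\<lambda>i::nat. {..(\<chi> j. real i) :: real^'d}) \<subseteq> range atMost" by auto
  show "(\<Union>i::nat. {..(\<chi> j. real i) :: real^'d}) = UNIV"
  proof (intro equalityI subsetI UNIV_I)
    fix u :: "real^'d"
    obtain i where i: "Max (range (\<lambda>j. u $ j)) \<le> real i" using real_arch_simple by blast
    have "u $ j \<le> real i" for j
      using i Max_ge[of "range (\<lambda>j. u $ j)" "u $ j"] by auto
    then show "u \<in> (\<Union>i::nat. {..(\<chi> j. real i)})" by (auto simp: less_eq_vec_def)
  qed
  show "emeasure ?M {..(\<chi> j. real i)} \<noteq> \<infinity>" for i
    unfolding M by (subst prod_ennreal) auto
qed auto

lemma pairing_polyradial:
  fixes F :: "'d::finite phase distr \<Rightarrow> complex"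
  assumes F: "polyradial_representation F F0" and \<phi>: "(\<lambda>z. w (sqr_moduli z)) \<in> schwartz"
  shows "pairing F (\<lambda>z. w (sqr_moduli z)) = (LINT u:Vd|lborel. w u * F0 (\<chi> j. sqrt (u $ j / pi)))"
proof -
  define H where "H z = F0 (moduli z) * w (sqr_moduli z)" for z :: "'d phase"
  \<comment> \<open>A measurable choice of a point with prescribed squared moduli, all of whose
    complex coordinates are real. Measurability is available only for \<open>F0\<close> composed
    with \<open>moduli\<close> and multiplied by a test function; pulling that back along \<sigma>
    yields a measurable function on \<open>Vd\<close>. The maximum affects only points outside
    \<open>Vd\<close>.\<close>
  define \<sigma> where "\<sigma> u = ((\<chi> j. sqrt (max 0 (u $ j) / pi)), 0 :: real^'d)" for u :: "real^'d"
  define G where "G u = indicator Vd u *\<^sub>R H (\<sigma> u)" for u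
  have Vd[measurable]: "Vd \<in> sets (borel :: (real^'d) measure)"
    unfolding Vd_def by measurable
  have "integrable lborel H" and p: "pairing F (\<lambda>z. w (sqr_moduli z)) = (LINT z|lborel. H z)"
    using F \<phi> unfolding polyradial_representation_def H_def by auto
  then have [measurable]: "H \<in> borel_measurable borel" using borel_measurable_integrable by fastforce
  have "\<sigma> \<in> borel \<rightarrow>\<^sub>M borel \<Otimes>\<^sub>M borel" unfolding \<sigma>_def by measurable
  then have [measurable]: "\<sigma> \<in> borel \<rightarrow>\<^sub>M borel" by (simp add: borel_prod)
  have [measurable]: "G \<in> borel_measurable borel" unfolding G_def by measurable
  have m: "moduli (\<sigma> u) = (\<chi> j. sqrt (u $ j / pi))" "sqr_moduli (\<sigma> u) = u" if "u \<in> Vd" for u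
  proof -
    have "u $ j \<ge> 0" for j using that by (simp add: Vd_def)
    then show "moduli (\<sigma> u) = (\<chi> j. sqrt (u $ j / pi))" "sqr_moduli (\<sigma> u) = u"
      by (auto simp: vec_eq_iff moduli_def sqr_moduli_def \<sigma>_def case_prod_unfold cmod_def)
  qed
  have GH: "H z = G (sqr_moduli z)" for z
  proof -
    have V: "sqr_moduli z \<in> Vd" by (auto simp: Vd_def sqr_moduli_nth)
    have "moduli (\<sigma> (sqr_moduli z)) = moduli z"
      unfolding m(1)[OF V] by (simp add: vec_eq_iff sqr_moduli_def moduli_nonneg)
    then show ?thesis using V unfolding G_def H_def m(2)[OF V] by simp
  qed
  have "pairing F (\<lambda>z. w (sqr_moduli z)) = (LINT u|distr lborel borel (sqr_moduli :: 'd phase \<Rightarrow> _). G u)"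
    unfolding p GH by (subst integral_distr) auto
  also have "\<dots> = (LINT u|density lborel (\<lambda>u. ennreal (indicator Vd u)). G u)"
    unfolding distr_sqr_moduli by (simp add: ennreal_indicator)
  also have "\<dots> = (LINT u|lborel. indicator Vd u *\<^sub>R G u)"
    by (subst integral_density) auto
  also have "\<dots> = (LINT u:Vd|lborel. w u * F0 (\<chi> j. sqrt (u $ j / pi)))"
    unfolding set_lebesgue_integral_def
    by (intro Bochner_Integration.integral_cong refl) (auto simp: G_def H_def m indicator_def)
  finally show ?thesis .
qed

section \<open>The short-time Fourier transform on the configuration space\<close>

lemma continuous_on_hermite [continuous_intros]:
  "continuous_on S g \<Longrightarrow> continuous_on S (\<lambda>t. hermite n (g t))"
  unfolding hermite_def by (intro continuous_intros)

lemma hermite_measurable [measurable]: "hermite n \<in> borel_measurable borel"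
  by (intro borel_measurable_continuous_onI continuous_on_hermite continuous_on_id)

lemma tf_shift_measurable [measurable (raw)]:
  fixes f g :: "'b \<Rightarrow> 'a::euclidean_space"
  assumes [measurable]: "f \<in> borel_measurable M" "g \<in> borel_measurable M" "h \<in> borel_measurable M" "\<phi> \<in> borel_measurable borel"
  shows "(\<lambda>x. tf_shift (f x, g x) \<phi> (h x)) \<in> borel_measurable M"
  unfolding tf_shift_def prod.case by measurable

lemma exp_inner_wave:
  "exp (- (2 * pi * \<i> * of_real (t \<bullet> \<omega>))) = (\<Prod>j\<in>UNIV. wave (t $ j * \<omega> $ j))" for t \<omega> :: "real ^ 'd::finite"
proof -
  have "- (2 * pi * \<i> * of_real (t \<bullet> \<omega>)) = (\<Sum>j\<in>UNIV. - 2 * pi * \<i> * of_real (t $ j * \<omega> $ j))"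
    by (simp add: inner_vec_def sum_distrib_left sum_negf)
  then show ?thesis by (simp add: exp_sum)
qed

lemma cnj_tf_shift:
  "cnj (tf_shift (x, \<omega>) g t) = exp (- (2 * pi * \<i> * of_real (t \<bullet> \<omega>))) * cnj (g (t - x))"
  by (simp add: tf_shift_def exp_cnj)

lemma cnj_hermite [simp]: "cnj (hermite n t) = hermite n t"
  by (simp add: hermite_def)

lemma stft_hermite:
  "stft (hermite k) (hermite n) z = (\<Prod>j\<in>UNIV. hstft (n $ j) (k $ j) (fst z $ j, snd z $ j))"
proof -
  obtain x \<omega> where z: "z = (x, \<omega>)" by (cases z)
  have "stft (hermite k) (hermite n) z = (LINT t|lborel. (\<Prod>j\<in>UNIV.
      of_real (hermite1 (n $ j) (t $ j)) * of_real (hermite1 (k $ j) (t $ j - x $ j)) * wave (t $ j * \<omega> $ j)))"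
    unfolding stft_def L2_inner_def z cnj_tf_shift exp_inner_wave
    by (intro Bochner_Integration.integral_cong refl) (simp add: hermite_def prod.distrib mult_ac)
  also have "\<dots> = (\<Prod>j\<in>UNIV. LINT s|lborel. of_real (hermite1 (n $ j) s) * of_real (hermite1 (k $ j) (s - x $ j)) * wave (s * \<omega> $ j))"
    by (rule integral_vec_prod[OF hstft_integrable])
  finally show ?thesis by (simp add: z hstft_def)
qed

section \<open>Schwartz functions and regular distributions\<close>

lemma schwartzD:
  assumes "f \<in> schwartz" "set bs \<subseteq> Basis"
  shows "partials bs f differentiable (at x)" "bounded (range (\<lambda>x. (1 + norm x) ^ N *\<^sub>R partials bs f x))"
  using assms unfolding schwartz_def by auto

lemma schwartz_bounded:
  assumes "f \<in> schwartz"
  shows "cmod (f x) \<le> schwartz_norm 0 f"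
proof -
  have "bounded (range (\<lambda>x. (1 + norm x) ^ 0 *\<^sub>R partials [] f x))"
    by (rule schwartzD(2)[OF assms]) simp
  then obtain B where B: "\<And>x. cmod (f x) \<le> B" unfolding bounded_iff by auto
  have "(\<lambda>(bs, x). (1 + norm x) ^ 0 * cmod (partials bs f x)) ([], x) \<le>
    (SUP (bs, x) \<in> {bs. set bs \<subseteq> Basis \<and> length bs \<le> 0} \<times> UNIV. (1 + norm x) ^ 0 * cmod (partials bs f x))"
    using B by (intro cSUP_upper bdd_aboveI[of _ B]) auto
  then show ?thesis unfolding schwartz_norm_def by simp
qed

lemma schwartz_measurable: "f \<in> schwartz \<Longrightarrow> f \<in> borel_measurable borel"
proof -
  assume "f \<in> schwartz"
  then have "partials [] f differentiable (at x)" for x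
    by (rule schwartzD(1)) simp
  then have "continuous_on UNIV f"
    by (auto intro!: continuous_at_imp_continuous_on differentiable_imp_continuous_within)
  then show ?thesis by (rule borel_measurable_continuous_onI)
qed

text \<open>\<open>frechet_derivative\<close> is additive only at points of differentiability, which
  membership in \<open>schwartz\<close> guarantees at every stage of the list.\<close>

lemma partials_add:
  assumes "f \<in> schwartz" "g \<in> schwartz" "set bs \<subseteq> Basis"
  shows "partials bs (\<lambda>x. f x + g x) = (\<lambda>x. partials bs f x + partials bs g x)"
  using assms(3)
proof (induction bs)
  case (Cons b bs)
  have d: "partials bs f differentiable (at x)" "partials bs g differentiable (at x)" for x
    using assms Cons.prems unfolding schwartz_def by auto
  show ?case
  proof
    fix x
    have "((\<lambda>x. partials bs f x + partials bs g x) has_derivative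
      (\<lambda>v. frechet_derivative (partials bs f) (at x) v + frechet_derivative (partials bs g) (at x) v)) (at x)"
      using d by (intro has_derivative_add) (auto simp: frechet_derivative_works[symmetric])
    from fun_cong[OF frechet_derivative_at[OF this], of b, symmetric]
    show "partials (b # bs) (\<lambda>x. f x + g x) x = partials (b # bs) f x + partials (b # bs) g x"
      using Cons by simp
  qed
qed simp

lemma partials_scale:
  assumes "f \<in> schwartz" "set bs \<subseteq> Basis"
  shows "partials bs (\<lambda>x. c * f x) = (\<lambda>x. c * partials bs f x)"
  using assms(2)
proof (induction bs)
  case (Cons b bs)
  have d: "partials bs f differentiable (at x)" for x
    using assms Cons.prems unfolding schwartz_def by auto
  show ?case
  proof
    fix x
    have "((\<lambda>x. c * partials bs f x) has_derivative (\<lambda>v. c * frechet_derivative (partials bs f) (at x) v)) (at x)"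
      using d by (intro has_derivative_mult_right) (auto simp: frechet_derivative_works[symmetric])
    from fun_cong[OF frechet_derivative_at[OF this], of b, symmetric]
    show "partials (b # bs) (\<lambda>x. c * f x) x = c * partials (b # bs) f x"
      using Cons by simp
  qed
qed simp

lemma schwartz_add:
  assumes "f \<in> schwartz" "g \<in> schwartz"
  shows "(\<lambda>x. f x + g x) \<in> schwartz"
proof -
  have "(\<forall>x. partials bs (\<lambda>x. f x + g x) differentiable (at x)) \<and>
     (\<forall>N. bounded (range (\<lambda>x. (1 + norm x) ^ N *\<^sub>R partials bs (\<lambda>x. f x + g x) x)))" if bs: "set bs \<subseteq> Basis" for bs
  proof -
    have f: "\<And>x. partials bs f differentiable (at x)" "\<And>N. bounded (range (\<lambda>x. (1 + norm x) ^ N *\<^sub>R partials bs f x))"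
      and g: "\<And>x. partials bs g differentiable (at x)" "\<And>N. bounded (range (\<lambda>x. (1 + norm x) ^ N *\<^sub>R partials bs g x))"
      using assms bs unfolding schwartz_def by auto
    have "bounded (range (\<lambda>x. (1 + norm x) ^ N *\<^sub>R partials bs f x + (1 + norm x) ^ N *\<^sub>R partials bs g x))" for N
      by (rule bounded_plus_comp[OF f(2) g(2)])
    then show ?thesis unfolding partials_add[OF assms bs] using f g
      by (auto simp: scaleR_add_right intro: differentiable_add)
  qed
  then show ?thesis unfolding schwartz_def by blast
qed

lemma schwartz_scale:
  assumes "f \<in> schwartz"
  shows "(\<lambda>x. c * f x) \<in> schwartz"
proof -
  have "(\<forall>x. partials bs (\<lambda>x. c * f x) differentiable (at x)) \<and>
     (\<forall>N. bounded (range (\<lambda>x. (1 + norm x) ^ N *\<^sub>R partials bs (\<lambda>x. c * f x) x)))" if bs: "set bs \<subseteq> Basis" for bs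
  proof -
    have f: "\<And>x. partials bs f differentiable (at x)" "\<And>N. bounded (range (\<lambda>x. (1 + norm x) ^ N *\<^sub>R partials bs f x))"
      using assms bs unfolding schwartz_def by auto
    have "bounded (range (\<lambda>x. c * ((1 + norm x) ^ N *\<^sub>R partials bs f x)))" for N
    proof -
      obtain B where "\<And>x. norm ((1 + norm x) ^ N *\<^sub>R partials bs f x) \<le> B"
        using f(2)[of N] unfolding bounded_iff by blast
      then have "norm (c * ((1 + norm x) ^ N *\<^sub>R partials bs f x)) \<le> cmod c * B" for x
        unfolding norm_mult by (intro mult_left_mono) auto
      then show ?thesis by (intro boundedI) blast
    qed
    then show ?thesis unfolding partials_scale[OF assms bs] using f by auto
  qed
  then show ?thesis unfolding schwartz_def by blast
qed

section \<open>Regular distributions and their transform with a Gaussian window\<close>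

lemma integrable_mult_schwartz:
  assumes "integrable lborel f" "\<phi> \<in> schwartz"
  shows "integrable lborel (\<lambda>t. f t * \<phi> t)"
proof (rule Bochner_Integration.integrable_bound)
  show "integrable lborel (\<lambda>t. schwartz_norm 0 \<phi> *\<^sub>R f t)" using assms(1) by simp
  have [measurable]: "\<phi> \<in> borel_measurable borel" using schwartz_measurable assms(2) by blast
  have [measurable]: "f \<in> borel_measurable borel" using assms(1) by (auto dest: borel_measurable_integrable)
  show "(\<lambda>t. f t * \<phi> t) \<in> borel_measurable lborel" by measurable
  have "norm (f x * \<phi> x) \<le> norm (schwartz_norm 0 \<phi> *\<^sub>R f x)" for x
    using schwartz_bounded[OF assms(2), of x]
    by (simp add: norm_mult mult.commute[of _ "cmod (f x)"] mult_left_mono)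
  then show "AE x in lborel. norm (f x * \<phi> x) \<le> norm (schwartz_norm 0 \<phi> *\<^sub>R f x)" by simp
qed

lemma regular_distr_add:
  assumes "integrable lborel f" "integrable lborel g"
  shows "regular_distr (\<lambda>t. f t + g t) = (\<lambda>\<phi>. regular_distr f \<phi> + regular_distr g \<phi>)"
  using integrable_mult_schwartz[OF assms(1)] integrable_mult_schwartz[OF assms(2)]
  by (auto simp: regular_distr_def fun_eq_iff distrib_right)

lemma regular_distr_scale:
  "regular_distr (\<lambda>t. c * f t) = (\<lambda>\<phi>. c * regular_distr f \<phi>)"
  by (auto simp: regular_distr_def fun_eq_iff mult.assoc)

text \<open>An integrable density gives a distribution of order zero: the supremum of the test
  function alone bounds the pairing.\<close>

lemma regular_distr_tempered:
  assumes "integrable lborel f"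
  shows "regular_distr f \<in> tempered"
  unfolding tempered_def
proof (intro CollectI conjI ballI allI impI)
  fix \<phi> \<psi> :: "'a \<Rightarrow> complex" assume "\<phi> \<in> schwartz" "\<psi> \<in> schwartz"
  then show "regular_distr f (\<lambda>t. \<phi> t + \<psi> t) = regular_distr f \<phi> + regular_distr f \<psi>"
    using integrable_mult_schwartz[OF assms] by (simp add: regular_distr_def schwartz_add distrib_left)
next
  fix c and \<phi> :: "'a \<Rightarrow> complex" assume "\<phi> \<in> schwartz"
  then show "regular_distr f (\<lambda>t. c * \<phi> t) = c * regular_distr f \<phi>"
    by (simp add: regular_distr_def schwartz_scale mult.left_commute[of _ c])
next
  have "cmod (regular_distr f \<phi>) \<le> (LINT t|lborel. cmod (f t)) * schwartz_norm 0 \<phi>" if p: "\<phi> \<in> schwartz" for \<phi>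
  proof -
    have "cmod (regular_distr f \<phi>) \<le> (LINT t|lborel. cmod (f t) * schwartz_norm 0 \<phi>)"
      unfolding regular_distr_def if_P[OF p]
    proof (rule Bochner_Integration.integral_norm_bound_integral)
      show "integrable lborel (\<lambda>t. cmod (f t) * schwartz_norm 0 \<phi>)" using assms by simp
      show "norm (f x * \<phi> x) \<le> cmod (f x) * schwartz_norm 0 \<phi>" for x
        unfolding norm_mult by (intro mult_left_mono schwartz_bounded p) auto
    qed (rule integrable_mult_schwartz[OF assms p])
    then show ?thesis by simp
  qed
  then show "\<exists>C N. \<forall>\<phi>\<in>schwartz. cmod (regular_distr f \<phi>) \<le> C * schwartz_norm N \<phi>" by blast
qed (simp add: regular_distr_def)

text \<open>Up to the factor in \<open>std_gauss\<close> this is the conjugate of the time-frequency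
  shift of the Gaussian window. The conjugate is built in because distributions act
  bilinearly.\<close>

definition shifted_gauss :: "'a::euclidean_space \<times> 'a \<Rightarrow> 'a \<Rightarrow> complex" where
  "shifted_gauss z = (\<lambda>t. exp (- pi * \<i> * 2 * of_real (t \<bullet> snd z)) * of_real (exp (- pi * (norm (t - fst z))\<^sup>2)))"

lemma shifted_gauss_closed: "diff_closed (shifted_gauss z)"
proof -
  define \<beta> where "\<beta> b = of_real (2 * pi * (fst z \<bullet> b)) - pi * \<i> * 2 * of_real (snd z \<bullet> b)" for b
  let ?E = "\<lambda>t. exp (of_real (- pi) * of_real (t \<bullet> t) + (\<Sum>b\<in>Basis. of_real (t \<bullet> b) * \<beta> b))"
  have e: "shifted_gauss z t = of_real (exp (- pi * (norm (fst z))\<^sup>2)) * ?E t" for t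
  proof -
    have s: "(\<Sum>b\<in>Basis. of_real (t \<bullet> b) * \<beta> b) = of_real (2 * pi * (t \<bullet> fst z)) - pi * \<i> * 2 * of_real (t \<bullet> snd z)"
      unfolding \<beta>_def euclidean_inner[of t "fst z"] euclidean_inner[of t "snd z"]
      by (simp add: right_diff_distrib sum_subtractf sum_distrib_left mult_ac)
    have n: "(norm (t - fst z))\<^sup>2 = t \<bullet> t - 2 * (t \<bullet> fst z) + (norm (fst z))\<^sup>2"
      by (simp add: power2_norm_eq_inner inner_diff_left inner_diff_right inner_commute)
    show ?thesis unfolding shifted_gauss_def s n exp_of_real[symmetric] exp_add[symmetric]
      by (rule arg_cong[where f=exp]) (simp add: algebra_simps)
  qed
  have E: "diff_closed ?E" by (rule exp_quadratic_diff_closed)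
  have p: "(\<lambda>t. of_real (exp (- pi * (norm (fst z))\<^sup>2)) * ?E t) \<in> poly_times ?E"
    by (rule poly_times.scale[OF poly_times.base])
  obtain D where D: "\<forall>x. (?E has_derivative D x) (at x)" "\<forall>v. (\<lambda>x. D x v) \<in> poly_times ?E"
    using E unfolding diff_closed_def by blast
  define c where "c = complex_of_real (exp (- pi * (norm (fst z))\<^sup>2))"
  have g: "shifted_gauss z = (\<lambda>t. c * ?E t)" using e unfolding c_def by (rule ext)
  have "c \<noteq> 0" unfolding c_def by simp
  \<comment> \<open>The class depends on its generator; since c is nonzero, the class of ?E is
    contained in that of c times ?E.\<close>
  have sub: "f \<in> poly_times ?E \<Longrightarrow> f \<in> poly_times (\<lambda>t. c * ?E t)" for f
  proof (induction rule: poly_times.induct)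
    case base
    have "(\<lambda>t. (1 / c) * (c * ?E t)) \<in> poly_times (\<lambda>t. c * ?E t)"
      by (rule poly_times.scale[OF poly_times.base])
    then show ?case using \<open>c \<noteq> 0\<close> by simp
  qed (auto intro: poly_times.intros)
  show ?thesis unfolding diff_closed_def g
  proof (intro exI conjI allI)
    show "((\<lambda>t. c * ?E t) has_derivative (\<lambda>v. c * D x v)) (at x)" for x
      using D(1) by (intro has_derivative_mult_right) auto
    show "(\<lambda>x. c * D x v) \<in> poly_times (\<lambda>t. c * ?E t)" for v
      using D(2) by (intro sub poly_times.scale) auto
  qed
qed

lemma shifted_gauss_bounded: "gauss_bounded (shifted_gauss z)"
proof -
  have "cmod (shifted_gauss z t) \<le> exp (pi * (norm (fst z))\<^sup>2) * exp (- (pi / 2) * (norm t)\<^sup>2)" for t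
  proof -
    have "norm t \<le> norm (t - fst z) + norm (fst z)" using norm_triangle_sub[of t "fst z"] by simp
    then have "(norm t)\<^sup>2 \<le> (norm (t - fst z) + norm (fst z))\<^sup>2" by (intro power_mono) auto
    also have "\<dots> \<le> 2 * (norm (t - fst z))\<^sup>2 + 2 * (norm (fst z))\<^sup>2"
      using zero_le_power2[of "norm (t - fst z) - norm (fst z)"] by (simp add: power2_eq_square algebra_simps)
    finally have "pi * (norm t)\<^sup>2 \<le> pi * (2 * (norm (t - fst z))\<^sup>2 + 2 * (norm (fst z))\<^sup>2)"
      by (intro mult_left_mono) auto
    then have "- pi * (norm (t - fst z))\<^sup>2 \<le> pi * (norm (fst z))\<^sup>2 + - (pi / 2) * (norm t)\<^sup>2"
      by (simp add: algebra_simps)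
    then show ?thesis unfolding shifted_gauss_def exp_add[symmetric] by (simp add: norm_mult)
  qed
  moreover have "exp (pi * (norm (fst z))\<^sup>2) > 0" "pi / 2 > 0" by auto
  ultimately show ?thesis unfolding gauss_bounded_def by blast
qed

lemma cnj_tf_shift_std_gauss:
  "(\<lambda>t. cnj (tf_shift z std_gauss t)) = (\<lambda>t. of_real (2 powr (DIM('a) / 4)) * shifted_gauss z t)" for z :: "'a::euclidean_space \<times> 'a"
proof
  fix t
  show "cnj (tf_shift z std_gauss t) = of_real (2 powr (DIM('a) / 4)) * shifted_gauss z t"
    by (cases z) (simp add: cnj_tf_shift std_gauss_def shifted_gauss_def mult_ac)
qed

lemma cnj_tf_shift_std_gauss_schwartz: "(\<lambda>t. cnj (tf_shift z std_gauss t)) \<in> schwartz"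
  unfolding cnj_tf_shift_std_gauss
  by (rule poly_times_schwartz[OF poly_times.scale[OF poly_times.base] shifted_gauss_closed shifted_gauss_bounded])

lemma stft_distr_regular:
  "stft_distr std_gauss (regular_distr f) z = (LINT t|lborel. f t * (of_real (2 powr (DIM('a) / 4)) * shifted_gauss z t))" for z :: "'a::euclidean_space \<times> 'a"
  using cnj_tf_shift_std_gauss_schwartz[of z]
  by (simp add: stft_distr_def regular_distr_def fun_cong[OF cnj_tf_shift_std_gauss])

lemma borel_measurable_cnj [measurable (raw)]:
  "f \<in> borel_measurable M \<Longrightarrow> (\<lambda>x. cnj (f x)) \<in> borel_measurable M"
  by (rule borel_measurable_continuous_on[of cnj]) (intro continuous_intros)

section \<open>The feature functions lie in the Feichtinger algebra\<close>

text \<open>The inequality t^2 + |z|^2 \<le> 3 (|z|^2 + (t - x)^2) separates the decay in t from the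
  decay in z, with one third of the rate for each.\<close>

lemma hstft_hermite1_bound:
  "\<exists>D>0. \<exists>d>0. \<forall>z t. cmod (hstft n k z) * \<bar>hermite1 k (t - fst z)\<bar> \<le> D * exp (- d * t\<^sup>2) * exp (- d * (norm z)\<^sup>2)"
proof -
  obtain C1 c1 where 1: "C1 > 0" "c1 > 0" "\<And>d x. 0 < d \<Longrightarrow> d \<le> c1 \<Longrightarrow> cmod (hstft n k x) \<le> C1 * exp (- d * (norm x)\<^sup>2)"
    using gauss_bounded_exponent[OF poly_times_gauss_bounded[OF hstft_poly_times[of n k] chirp_gauss_bounded]] by blast
  obtain C2 c2 where 2: "C2 > 0" "c2 > 0" "\<And>d x. 0 < d \<Longrightarrow> d \<le> c2 \<Longrightarrow> cmod (of_real (hermite1 k x)) \<le> C2 * exp (- d * (norm x)\<^sup>2)"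
    using gauss_bounded_exponent[OF hermite1_gauss_bounded[of k]] by blast
  define c where "c = min c1 c2"
  have c: "c > 0" "c \<le> c1" "c \<le> c2" using 1 2 unfolding c_def by auto
  have "cmod (hstft n k z) * \<bar>hermite1 k (t - fst z)\<bar> \<le> (C1 * C2) * exp (- (c / 3) * t\<^sup>2) * exp (- (c / 3) * (norm z)\<^sup>2)" for z t
  proof -
    have "t\<^sup>2 \<le> 2 * (fst z)\<^sup>2 + 2 * (t - fst z)\<^sup>2"
      using zero_le_power2[of "t - 2 * fst z"] by (simp add: power2_eq_square algebra_simps)
    moreover have "(norm z)\<^sup>2 = (fst z)\<^sup>2 + (snd z)\<^sup>2" by (simp add: norm_prod_def)
    ultimately have "t\<^sup>2 + (norm z)\<^sup>2 \<le> 3 * ((norm z)\<^sup>2 + (t - fst z)\<^sup>2)"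
      using zero_le_power2[of "snd z"] zero_le_power2[of "t - fst z"] unfolding distrib_left by linarith
    then have "c / 3 * (t\<^sup>2 + (norm z)\<^sup>2) \<le> c / 3 * (3 * ((norm z)\<^sup>2 + (t - fst z)\<^sup>2))"
      using c(1) by (intro mult_left_mono) auto
    then have e: "exp (- c * ((norm z)\<^sup>2 + (t - fst z)\<^sup>2)) \<le> exp (- (c / 3) * (t\<^sup>2 + (norm z)\<^sup>2))" by (simp add: algebra_simps)
    have "cmod (hstft n k z) * \<bar>hermite1 k (t - fst z)\<bar> \<le> (C1 * exp (- c * (norm z)\<^sup>2)) * (C2 * exp (- c * (t - fst z)\<^sup>2))"
      using 1(1) 1(3)[OF c(1,2), of z] 2(3)[OF c(1,3), of "t - fst z"] by (intro mult_mono) auto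
    also have "\<dots> = C1 * C2 * exp (- c * ((norm z)\<^sup>2 + (t - fst z)\<^sup>2))"
      by (simp add: exp_add[symmetric] distrib_left)
    also have "\<dots> \<le> C1 * C2 * exp (- (c / 3) * (t\<^sup>2 + (norm z)\<^sup>2))"
      using e 1 2 by (intro mult_left_mono) auto
    also have "\<dots> = C1 * C2 * exp (- (c / 3) * t\<^sup>2) * exp (- (c / 3) * (norm z)\<^sup>2)"
      unfolding mult.assoc exp_add[symmetric] by (simp add: distrib_left)
    finally show ?thesis .
  qed
  moreover have "C1 * C2 > 0" "c / 3 > 0" using 1 2 c by auto
  ultimately show ?thesis by blast
qed

lemma integrable_pair_mult:
  fixes f :: "'a::euclidean_space \<Rightarrow> real" and g :: "'b::euclidean_space \<Rightarrow> real"
  assumes "integrable lborel f" "integrable lborel g"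
  shows "integrable (lborel \<Otimes>\<^sub>M lborel) (\<lambda>(x, y). f x * g y)"
proof -
  have [measurable]: "f \<in> borel_measurable borel" "g \<in> borel_measurable borel"
    using assms by (auto dest: borel_measurable_integrable)
  show ?thesis
  proof (rule lborel_pair.Fubini_integrable)
    show "integrable lborel (\<lambda>x. LINT y|lborel. norm (case (x, y) of (x, y) \<Rightarrow> f x * g y))"
      using assms(1) by (simp add: abs_mult)
    show "AE x in lborel. integrable lborel (\<lambda>y. case (x, y) of (x, y) \<Rightarrow> f x * g y)"
      using assms(2) by simp
  qed measurable
qed

lemma integrable_L2_mult:
  fixes h :: "'a::euclidean_space \<Rightarrow> complex" and g :: "'a \<Rightarrow> real"
  assumes "h \<in> L2" "g \<in> borel_measurable borel" "integrable lborel (\<lambda>t. (g t)\<^sup>2)"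
  shows "integrable lborel (\<lambda>t. cmod (h t) * g t)"
proof (rule Bochner_Integration.integrable_bound)
  show "integrable lborel (\<lambda>t. (cmod (h t))\<^sup>2 + (g t)\<^sup>2)" using assms unfolding L2_def by auto
  have [measurable]: "h \<in> borel_measurable borel" using assms unfolding L2_def by simp
  note assms(2)[measurable]
  show "(\<lambda>t. cmod (h t) * g t) \<in> borel_measurable lborel" by measurable
  have "\<bar>a * b\<bar> \<le> a\<^sup>2 + b\<^sup>2" for a b :: real
  proof -
    have "2 * (\<bar>a\<bar> * \<bar>b\<bar>) \<le> a\<^sup>2 + b\<^sup>2"
      using sum_squares_bound[of "\<bar>a\<bar>" "\<bar>b\<bar>"] by simp
    moreover have "0 \<le> \<bar>a\<bar> * \<bar>b\<bar>" by simp
    ultimately show ?thesis unfolding abs_mult by linarith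
  qed
  from this[of "cmod (h _)" "g _"] show "AE t in lborel. norm (cmod (h t) * g t) \<le> norm ((cmod (h t))\<^sup>2 + (g t)\<^sup>2)"
    by (intro AE_I2) simp
qed

lemma integrable_vec_prod_real:
  fixes f :: "'d::finite \<Rightarrow> real \<Rightarrow> real"
  assumes "\<And>j. integrable lborel (f j)"
  shows "integrable lborel (\<lambda>t::real^'d. \<Prod>j\<in>UNIV. f j (t $ j))"
proof -
  have "integrable lborel (\<lambda>t::real^'d. \<Prod>j\<in>UNIV. complex_of_real (f j (t $ j)))"
    using assms by (intro integrable_vec_prod) auto
  from integrable_Re[OF this] show ?thesis by (simp flip: of_real_prod)
qed

lemma integrable_gauss_prod_square:
  fixes C c :: "'d::finite \<Rightarrow> real"
  assumes "\<And>j. c j > 0"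
  shows "integrable lborel (\<lambda>t::real^'d. (\<Prod>j\<in>UNIV. C j * exp (- c j * (t $ j)\<^sup>2))\<^sup>2)"
proof -
  have "(\<Prod>j\<in>UNIV. C j * exp (- c j * (t $ j)\<^sup>2))\<^sup>2 = (\<Prod>j\<in>UNIV. (C j)\<^sup>2 * exp (- (2 * c j) * (t $ j)\<^sup>2))" for t :: "real^'d"
    unfolding prod_power_distrib by (auto simp: power_mult_distrib exp_double[symmetric] mult_ac)
  moreover have "integrable lborel (\<lambda>t::real^'d. \<Prod>j\<in>UNIV. (C j)\<^sup>2 * exp (- (2 * c j) * (t $ j)\<^sup>2))"
  proof (rule integrable_vec_prod_real)
    show "integrable lborel (\<lambda>s. (C j)\<^sup>2 * exp (- (2 * c j) * s\<^sup>2))" for j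
      using integrable_exp_square[of "2 * c j"] assms[of j] by (intro integrable_mult_right) auto
  qed
  ultimately show ?thesis by simp
qed

lemma integrable_phase_prod_real:
  fixes f :: "'d::finite \<Rightarrow> real \<times> real \<Rightarrow> real"
  assumes "\<And>j. integrable lborel (f j)"
  shows "integrable lborel (\<lambda>z::'d phase. \<Prod>j\<in>UNIV. f j (fst z $ j, snd z $ j))"
proof -
  have "integrable lborel (\<lambda>z::'d phase. \<Prod>j\<in>UNIV. complex_of_real (f j (fst z $ j, snd z $ j)))"
    using assms by (intro integrable_phase_prod) auto
  from integrable_Re[OF this] show ?thesis by (simp flip: of_real_prod)
qed

lemma tf_shift_hermite:
  "tf_shift (x, \<omega>) (hermite k) t = (\<Prod>j\<in>UNIV. wave (t $ j * - \<omega> $ j) * of_real (hermite1 (k $ j) (t $ j - x $ j)))"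
proof -
  have "exp (2 * pi * \<i> * (t \<bullet> \<omega>)) = exp (- (2 * pi * \<i> * of_real (t \<bullet> - \<omega>)))"
    by simp
  then show ?thesis
    unfolding tf_shift_def prod.case exp_inner_wave by (simp add: hermite_def prod.distrib)
qed

lemma shifted_gauss_phase:
  "shifted_gauss (\<zeta>, \<eta>) z = (\<Prod>j\<in>UNIV. gauss1 (fst z $ j - fst \<zeta> $ j) * gauss1 (snd z $ j - snd \<zeta> $ j)
     * wave (fst z $ j * fst \<eta> $ j) * wave (snd z $ j * snd \<eta> $ j))" for \<zeta> \<eta> z :: "'d::finite phase"
proof -
  have n: "(norm x)\<^sup>2 = (\<Sum>j\<in>UNIV. (x $ j)\<^sup>2)" for x :: "real^'d"
    unfolding power2_norm_eq_inner inner_vec_def by (simp add: power2_eq_square)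
  have "(norm (z - \<zeta>))\<^sup>2 = (\<Sum>j\<in>UNIV. (fst z $ j - fst \<zeta> $ j)\<^sup>2 + (snd z $ j - snd \<zeta> $ j)\<^sup>2)"
    by (simp add: norm_prod_def n sum.distrib sum_nonneg)
  then have 1: "exp (- pi * (norm (z - \<zeta>))\<^sup>2) = (\<Prod>j\<in>UNIV. exp (- pi * (fst z $ j - fst \<zeta> $ j)\<^sup>2) * exp (- pi * (snd z $ j - snd \<zeta> $ j)\<^sup>2))"
    by (simp add: exp_sum[symmetric] exp_add[symmetric] sum_distrib_left distrib_left)
  have "exp (- pi * \<i> * 2 * of_real (z \<bullet> \<eta>)) = exp (- (2 * pi * \<i> * of_real (fst z \<bullet> fst \<eta>))) * exp (- (2 * pi * \<i> * of_real (snd z \<bullet> snd \<eta>)))"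
    unfolding exp_add[symmetric] by (rule arg_cong[where f=exp]) (simp add: inner_prod_def algebra_simps)
  then have 2: "exp (- pi * \<i> * 2 * of_real (z \<bullet> \<eta>)) = (\<Prod>j\<in>UNIV. wave (fst z $ j * fst \<eta> $ j)) * (\<Prod>j\<in>UNIV. wave (snd z $ j * snd \<eta> $ j))"
    unfolding exp_inner_wave .
  show ?thesis unfolding shifted_gauss_def fst_conv snd_conv 1 2
    by (simp add: prod.distrib mult_ac)
qed

lemma norm_shifted_gauss_le: "cmod (shifted_gauss p z) \<le> 1"
  by (simp add: shifted_gauss_def norm_mult)

lemma shifted_gauss_measurable [measurable (raw)]:
  fixes f :: "'b \<Rightarrow> 'a::euclidean_space \<times> 'a"
  assumes f: "f \<in> borel_measurable M" and [measurable]: "g \<in> borel_measurable M"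
  shows "(\<lambda>x. shifted_gauss (f x) (g x)) \<in> borel_measurable M"
proof -
  have [measurable]: "(\<lambda>x. fst (f x)) \<in> borel_measurable M" "(\<lambda>x. snd (f x)) \<in> borel_measurable M"
    using f unfolding borel_prod[symmetric] by measurable
  show ?thesis unfolding shifted_gauss_def by measurable
qed

section \<open>The superposition kernel and the bound for the feature functions\<close>

context
  fixes n k :: "nat ^ 'd::finite"
begin

definition feature_kernel :: "real ^ 'd \<Rightarrow> 'd phase \<Rightarrow> complex" where
  "feature_kernel t z = stft (hermite k) (hermite n) z * tf_shift z (hermite k) t"

lemma feature_kernel_eq:
  "feature_kernel t z = (\<Prod>j\<in>UNIV. hstft (n $ j) (k $ j) (fst z $ j, snd z $ j) *
     (wave (t $ j * - snd z $ j) * of_real (hermite1 (k $ j) (t $ j - fst z $ j))))"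
  by (cases z) (simp add: feature_kernel_def stft_hermite tf_shift_hermite prod.distrib)

lemma stft_hermite_measurable [measurable]: "stft (hermite k) (hermite n) \<in> borel_measurable borel"
proof -
  have h: "hstft a b \<in> borel_measurable (borel \<Otimes>\<^sub>M borel)" for a b by (simp add: borel_prod)
  have [measurable]: "(\<lambda>z::'d phase. hstft a b (fst z $ j, snd z $ j)) \<in> borel_measurable (borel \<Otimes>\<^sub>M borel)" for a b j
    by (rule measurable_compose[OF _ h]) measurable
  have "(\<lambda>z::'d phase. \<Prod>j\<in>UNIV. hstft (n $ j) (k $ j) (fst z $ j, snd z $ j)) \<in> borel_measurable (borel \<Otimes>\<^sub>M borel)"
    by measurable
  moreover have "stft (hermite k) (hermite n) = (\<lambda>z. \<Prod>j\<in>UNIV. hstft (n $ j) (k $ j) (fst z $ j, snd z $ j))"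
    using stft_hermite by (rule ext)
  ultimately show ?thesis by (simp add: borel_prod)
qed

lemma tf_shift_phase_measurable [measurable (raw)]:
  fixes f :: "'b \<Rightarrow> 'd phase"
  assumes f: "f \<in> borel_measurable M" and [measurable]: "g \<in> borel_measurable M"
  shows "(\<lambda>x. tf_shift (f x) (hermite k) (g x)) \<in> borel_measurable M"
proof -
  have [measurable]: "(\<lambda>x. fst (f x)) \<in> borel_measurable M" "(\<lambda>x. snd (f x)) \<in> borel_measurable M"
    using f unfolding borel_prod[symmetric] by measurable
  have "(\<lambda>x. tf_shift (fst (f x), snd (f x)) (hermite k) (g x)) \<in> borel_measurable M" by measurable
  then show ?thesis by simp
qed

lemma feature_kernel_measurable [measurable (raw)]:
  fixes f :: "'b \<Rightarrow> 'd phase"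
  assumes [measurable]: "f \<in> borel_measurable M" "g \<in> borel_measurable M"
  shows "(\<lambda>x. feature_kernel (g x) (f x)) \<in> borel_measurable M"
  unfolding feature_kernel_def by measurable

text \<open>The majorant is a product: \<open>G\<close> is square integrable, to be paired with
  \<open>h\<close>, and \<open>H\<close> is integrable over phase space. The constants are those of
  \<open>hstft_hermite1_bound\<close>, chosen separately for each coordinate.\<close>

lemma feature_kernel_bound:
  "\<exists>G H. (\<forall>t z. cmod (feature_kernel t z) \<le> G t * H z) \<and> (\<forall>t. G t \<ge> 0) \<and> (\<forall>z. H z \<ge> 0) \<and>
     G \<in> borel_measurable borel \<and> integrable lborel (\<lambda>t. (G t)\<^sup>2) \<and> integrable lborel H"
proof -
  have "\<forall>j. \<exists>D. \<exists>d>0. D > 0 \<and> (\<forall>z t. cmod (hstft (n $ j) (k $ j) z) * \<bar>hermite1 (k $ j) (t - fst z)\<bar> \<le> D * exp (- d * t\<^sup>2) * exp (- d * (norm z)\<^sup>2))"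
    using hstft_hermite1_bound by meson
  then obtain D where "\<forall>j. \<exists>d>0. D j > 0 \<and> (\<forall>z t. cmod (hstft (n $ j) (k $ j) z) * \<bar>hermite1 (k $ j) (t - fst z)\<bar> \<le> D j * exp (- d * t\<^sup>2) * exp (- d * (norm z)\<^sup>2))"
    by (auto dest: choice)
  then have "\<forall>j. \<exists>d. d > 0 \<and> D j > 0 \<and> (\<forall>z t. cmod (hstft (n $ j) (k $ j) z) * \<bar>hermite1 (k $ j) (t - fst z)\<bar> \<le> D j * exp (- d * t\<^sup>2) * exp (- d * (norm z)\<^sup>2))"
    by blast
  from choice[OF this] obtain d where d: "\<And>j. d j > 0" "\<And>j. D j > 0"
    "\<And>j z t. cmod (hstft (n $ j) (k $ j) z) * \<bar>hermite1 (k $ j) (t - fst z)\<bar> \<le> D j * exp (- d j * t\<^sup>2) * exp (- d j * (norm z)\<^sup>2)"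
    by blast
  define G where "G t = (\<Prod>j\<in>UNIV. D j * exp (- d j * (t $ j)\<^sup>2))" for t :: "real^'d"
  define H where "H z = (\<Prod>j\<in>UNIV. exp (- d j * (norm (fst z $ j, snd z $ j))\<^sup>2))" for z :: "'d phase"
  have 1: "cmod (feature_kernel t z) \<le> G t * H z" for t z
  proof -
    have "cmod (feature_kernel t z) = (\<Prod>j\<in>UNIV. cmod (hstft (n $ j) (k $ j) (fst z $ j, snd z $ j)) * \<bar>hermite1 (k $ j) (t $ j - fst z $ j)\<bar>)"
      unfolding feature_kernel_eq prod_norm[symmetric] norm_mult norm_wave by simp
    also have "\<dots> \<le> (\<Prod>j\<in>UNIV. D j * exp (- d j * (t $ j)\<^sup>2) * exp (- d j * (norm (fst z $ j, snd z $ j))\<^sup>2))"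
      using d(3)[of _ "(fst z $ _, snd z $ _)" "t $ _"] by (intro prod_mono) auto
    also have "\<dots> = G t * H z" unfolding G_def H_def by (rule prod.distrib)
    finally show ?thesis .
  qed
  have 2: "G t \<ge> 0" "H z \<ge> 0" for t z
    unfolding G_def H_def by (auto intro!: prod_nonneg mult_nonneg_nonneg less_imp_le[OF d(2)])
  have 3: "G \<in> borel_measurable borel" unfolding G_def by measurable
  have 4: "integrable lborel (\<lambda>t. (G t)\<^sup>2)"
    unfolding G_def by (rule integrable_gauss_prod_square[OF d(1)])
  have 5: "integrable lborel H"
    unfolding H_def using integrable_phase_prod_real[of "\<lambda>j s. exp (- d j * (norm s)\<^sup>2)"] integrable_exp_norm_square d(1) by blast
  show ?thesis using 1 2 3 4 5 by blast
qed

text \<open>The bounded weight \<open>w\<close> allows two uses: the constant 1 yields integrability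
  of the feature function, and a shifted Gaussian justifies interchanging the integrals in its
  transform.\<close>

lemma feature_kernel_integrable:
  fixes h :: "real ^ 'd \<Rightarrow> complex"
  assumes h: "h \<in> L2" and [measurable]: "w \<in> borel_measurable borel" and w: "\<And>z. cmod (w z) \<le> 1"
  shows "integrable (lborel \<Otimes>\<^sub>M lborel) (\<lambda>(z, t). cnj (h t) * (feature_kernel t z * w z))"
proof -
  obtain G H where GH: "\<And>t z. cmod (feature_kernel t z) \<le> G t * H z" "\<And>t. G t \<ge> 0" "\<And>z. H z \<ge> 0"
     "G \<in> borel_measurable borel" "integrable lborel (\<lambda>t. (G t)\<^sup>2)" "integrable lborel H"
    using feature_kernel_bound by blast
  have [measurable]: "h \<in> borel_measurable borel" using h unfolding L2_def by simp
  have [measurable]: "(\<lambda>x. feature_kernel (snd x) (fst x)) \<in> borel_measurable (lborel \<Otimes>\<^sub>M lborel)"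
    by (rule feature_kernel_measurable) measurable
  show ?thesis
  proof (rule Bochner_Integration.integrable_bound)
    show "integrable (lborel \<Otimes>\<^sub>M lborel) (\<lambda>(z, t). H z * (cmod (h t) * G t))"
      by (intro integrable_pair_mult GH integrable_L2_mult h)
    show "(\<lambda>(z, t). cnj (h t) * (feature_kernel t z * w z)) \<in> borel_measurable (lborel \<Otimes>\<^sub>M lborel)"
      by measurable
    have "cmod (cnj (h t) * (feature_kernel t z * w z)) \<le> H z * (cmod (h t) * G t)" for z t
    proof -
      have "cmod (feature_kernel t z * w z) \<le> (G t * H z) * 1"
        unfolding norm_mult using GH(1) w GH(2,3) by (intro mult_mono) auto
      then have "cmod (h t) * cmod (feature_kernel t z * w z) \<le> cmod (h t) * ((G t * H z) * 1)"
        by (intro mult_left_mono) auto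
      then show ?thesis unfolding norm_mult complex_mod_cnj by (simp add: mult_ac)
    qed
    then show "AE x in lborel \<Otimes>\<^sub>M lborel. norm (case x of (z, t) \<Rightarrow> cnj (h t) * (feature_kernel t z * w z))
       \<le> norm (case x of (z, t) \<Rightarrow> H z * (cmod (h t) * G t))"
      by (intro AE_I2) (auto intro: order_trans[OF _ abs_ge_self])
  qed
qed

text \<open>The functional \<open>F\<close> maps this function to the inner product of \<open>A\<^sub>F \<phi>\<^sub>n\<close> with \<open>h\<close>.\<close>

definition feature :: "(real ^ 'd \<Rightarrow> complex) \<Rightarrow> 'd phase \<Rightarrow> complex" where
  "feature h z = stft (hermite k) (hermite n) z * cnj (stft (hermite k) h z)"

lemma feature_mult_eq:
  "feature h z * w = (LINT t|lborel. cnj (h t) * (feature_kernel t z * w))"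
proof -
  have "cnj (stft (hermite k) h z) = (LINT t|lborel. cnj (h t) * tf_shift z (hermite k) t)"
    unfolding stft_def L2_inner_def by (simp flip: Bochner_Integration.integral_cnj)
  then have "feature h z * w = (stft (hermite k) (hermite n) z * w) * (LINT t|lborel. cnj (h t) * tf_shift z (hermite k) t)"
    by (simp add: feature_def mult_ac)
  also have "\<dots> = (LINT t|lborel. (stft (hermite k) (hermite n) z * w) * (cnj (h t) * tf_shift z (hermite k) t))"
    by (rule integral_mult_right_zero[symmetric])
  finally show ?thesis by (simp add: feature_kernel_def mult_ac)
qed

lemma feature_integrable:
  assumes "h \<in> L2"
  shows "integrable lborel (feature h)"
proof -
  have "feature h = (\<lambda>z. LINT t|lborel. cnj (h t) * (feature_kernel t z * 1))"
    using feature_mult_eq[of h _ 1] by (simp add: fun_eq_iff)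
  then show ?thesis
    using lborel_pair.integrable_fst'[OF feature_kernel_integrable[OF assms, of "\<lambda>_. 1"]] by simp
qed

lemma feature_stft:
  assumes h: "h \<in> L2"
  shows "(LINT z|lborel. feature h z * shifted_gauss p z) =
    (LINT t|lborel. cnj (h t) * (LINT z|lborel. feature_kernel t z * shifted_gauss p z))"
proof -
  have "(LINT z|lborel. feature h z * shifted_gauss p z) = (LINT z|lborel. LINT t|lborel. cnj (h t) * (feature_kernel t z * shifted_gauss p z))"
    unfolding feature_mult_eq ..
  also have "\<dots> = (LINT t|lborel. LINT z|lborel. cnj (h t) * (feature_kernel t z * shifted_gauss p z))"
    by (rule lborel_pair.Fubini_integral[symmetric], rule feature_kernel_integrable[OF h])
      (auto simp: norm_shifted_gauss_le)
  finally show ?thesis by simp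
qed

text \<open>The modulation exp (2 pi i t \<omega>) inside \<open>tf_shift\<close> merges with the
  character of frequency \<eta>, which shifts the second frequency to \<eta> - t; the rest factors
  over the coordinates.\<close>

lemma feature_kernel_stft:
  "(LINT z|lborel. feature_kernel t z * shifted_gauss (\<zeta>, \<eta>) z) =
    (\<Prod>j\<in>UNIV. tf_kernel (hstft (n $ j) (k $ j)) (\<lambda>s. of_real (hermite1 (k $ j) s)) gauss1 gauss1
      (t $ j) (fst \<zeta> $ j) (snd \<zeta> $ j) (fst \<eta> $ j) (snd \<eta> $ j - t $ j))"
proof -
  have w: "wave (t * - s) * wave (s * e) = wave (s * (e - t))" for t s e
    unfolding exp_add[symmetric] by (rule arg_cong[where f=exp]) (simp add: algebra_simps)
  have "feature_kernel t z * shifted_gauss (\<zeta>, \<eta>) z =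
    (\<Prod>j\<in>UNIV. tf_integrand (hstft (n $ j) (k $ j)) (\<lambda>s. of_real (hermite1 (k $ j) s)) gauss1 gauss1
      (t $ j) (fst \<zeta> $ j) (snd \<zeta> $ j) (fst \<eta> $ j) (snd \<eta> $ j - t $ j) (fst z $ j, snd z $ j))" for z
    unfolding feature_kernel_eq shifted_gauss_phase prod.distrib[symmetric] tf_integrand_def fst_conv snd_conv w[symmetric]
    by (simp only: mult_ac)
  then show ?thesis unfolding tf_kernel_def
    by (simp only: integral_phase_prod[OF tf_integrand_integrable[OF hstft_poly_times hermite1_poly_times poly_times.base poly_times.base]])
qed

lemma feature_kernel_stft_bound:
  "\<exists>C c. (\<forall>j. C j > 0) \<and> (\<forall>j. c j > 0) \<and> (\<forall>t \<zeta> \<eta>. cmod (LINT z|lborel. feature_kernel t z * shifted_gauss (\<zeta>, \<eta>) z) \<le>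
     (\<Prod>j\<in>UNIV. C j * exp (- c j * (t $ j)\<^sup>2)) * (\<Prod>j\<in>UNIV. exp (- c j * (norm (fst \<zeta> $ j, snd \<zeta> $ j))\<^sup>2)) *
     (\<Prod>j\<in>UNIV. inverse (1 + (fst \<eta> $ j)\<^sup>2) * inverse (1 + (snd \<eta> $ j - t $ j)\<^sup>2)))"
proof -
  let ?K = "\<lambda>j. tf_kernel (hstft (n $ j) (k $ j)) (\<lambda>s. of_real (hermite1 (k $ j) s)) gauss1 gauss1"
  have "\<forall>j. \<exists>C c. C > 0 \<and> c > 0 \<and> (\<forall>t a b e1 e2. cmod (?K j t a b e1 e2) \<le>
     C * exp (- c * (t\<^sup>2 + a\<^sup>2 + b\<^sup>2)) * (inverse (1 + e1\<^sup>2) * inverse (1 + e2\<^sup>2)))"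
    using tf_kernel_bound[OF hstft_poly_times hermite1_poly_times poly_times.base poly_times.base] by blast
  from choice[OF this] obtain C where "\<forall>j. \<exists>c. C j > 0 \<and> c > 0 \<and> (\<forall>t a b e1 e2. cmod (?K j t a b e1 e2) \<le>
     C j * exp (- c * (t\<^sup>2 + a\<^sup>2 + b\<^sup>2)) * (inverse (1 + e1\<^sup>2) * inverse (1 + e2\<^sup>2)))" by blast
  from choice[OF this] obtain c where c: "\<And>j. C j > 0" "\<And>j. c j > 0" "\<And>j t a b e1 e2. cmod (?K j t a b e1 e2) \<le>
     C j * exp (- c j * (t\<^sup>2 + a\<^sup>2 + b\<^sup>2)) * (inverse (1 + e1\<^sup>2) * inverse (1 + e2\<^sup>2))" by blast
  have "cmod (LINT z|lborel. feature_kernel t z * shifted_gauss (\<zeta>, \<eta>) z) \<le>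
     (\<Prod>j\<in>UNIV. C j * exp (- c j * (t $ j)\<^sup>2)) * (\<Prod>j\<in>UNIV. exp (- c j * (norm (fst \<zeta> $ j, snd \<zeta> $ j))\<^sup>2)) *
     (\<Prod>j\<in>UNIV. inverse (1 + (fst \<eta> $ j)\<^sup>2) * inverse (1 + (snd \<eta> $ j - t $ j)\<^sup>2))" for t \<zeta> \<eta>
  proof -
    have e: "C j * exp (- c j * ((t $ j)\<^sup>2 + (fst \<zeta> $ j)\<^sup>2 + (snd \<zeta> $ j)\<^sup>2)) =
      C j * exp (- c j * (t $ j)\<^sup>2) * exp (- c j * (norm (fst \<zeta> $ j, snd \<zeta> $ j))\<^sup>2)" for j
      unfolding mult.assoc exp_add[symmetric] by (simp add: norm_Pair algebra_simps)
    have "cmod (LINT z|lborel. feature_kernel t z * shifted_gauss (\<zeta>, \<eta>) z) \<le>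
      (\<Prod>j\<in>UNIV. C j * exp (- c j * ((t $ j)\<^sup>2 + (fst \<zeta> $ j)\<^sup>2 + (snd \<zeta> $ j)\<^sup>2)) *
        (inverse (1 + (fst \<eta> $ j)\<^sup>2) * inverse (1 + (snd \<eta> $ j - t $ j)\<^sup>2)))"
      unfolding feature_kernel_stft prod_norm[symmetric] by (intro prod_mono conjI norm_ge_zero c(3))
    then show ?thesis unfolding e prod.distrib .
  qed
  then show ?thesis using c(1,2) by blast
qed

lemma nn_integral_inverse_square: "(\<integral>\<^sup>+s. ennreal (inverse (1 + s\<^sup>2)) \<partial>lborel) < \<infinity>"
proof -
  have "integrable lborel (\<lambda>s::real. inverse (1 + s\<^sup>2))"
    using integrable_inverse_1_plus_square by (simp add: set_integrable_def einterval_eq)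
  then show ?thesis by (auto simp: integrable_iff_bounded)
qed

text \<open>Translation invariance makes the value independent of s. Applied with s = t_j, it
  removes the frequency shift by t.\<close>

lemma nn_integral_shifted_pair:
  "(\<integral>\<^sup>+e. ennreal (inverse (1 + (fst e)\<^sup>2) * inverse (1 + (snd e - s)\<^sup>2)) \<partial>(lborel :: (real \<times> real) measure)) =
     (\<integral>\<^sup>+s. ennreal (inverse (1 + s\<^sup>2)) \<partial>lborel) * (\<integral>\<^sup>+s. ennreal (inverse (1 + s\<^sup>2)) \<partial>lborel)"
proof -
  let ?r = "\<lambda>s::real. ennreal (inverse (1 + s\<^sup>2))"
  have t: "(\<integral>\<^sup>+y. ?r (y - s) \<partial>lborel) = (\<integral>\<^sup>+y. ?r y \<partial>lborel)"
    using nn_integral_real_affine[of ?r 1 "- s"] by simp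
  have "(\<integral>\<^sup>+e. ennreal (inverse (1 + (fst e)\<^sup>2) * inverse (1 + (snd e - s)\<^sup>2)) \<partial>(lborel :: (real \<times> real) measure)) =
    (\<integral>\<^sup>+e. ?r (fst e) * ?r (snd e - s) \<partial>(lborel \<Otimes>\<^sub>M lborel))"
    unfolding lborel_prod by (intro nn_integral_cong) (simp add: ennreal_mult)
  also have "\<dots> = (\<integral>\<^sup>+x. \<integral>\<^sup>+y. ?r x * ?r (y - s) \<partial>lborel \<partial>lborel)"
    by (subst lborel.nn_integral_fst[symmetric]) auto
  also have "\<dots> = (\<integral>\<^sup>+x. ?r x * (\<integral>\<^sup>+y. ?r y \<partial>lborel) \<partial>lborel)"
    by (subst nn_integral_cmult) (auto simp: t)
  also have "\<dots> = (\<integral>\<^sup>+x. ?r x \<partial>lborel) * (\<integral>\<^sup>+y. ?r y \<partial>lborel)"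
    by (rule nn_integral_multc) auto
  finally show ?thesis .
qed

text \<open>The bound is linear in the norm of \<open>h\<close>, phrased with a positive \<epsilon>
  that majorizes this norm. In place of the Cauchy-Schwarz inequality, the product of |h| and the
  Gaussian factor in t is then estimated by a^2 / \<epsilon> + b^2 \<epsilon>.\<close>

lemma feature_S0_bound:
  "\<exists>K\<ge>0. \<forall>h\<in>L2. \<forall>\<epsilon>>0. (LINT t|lborel. (cmod (h t))\<^sup>2) \<le> \<epsilon>\<^sup>2 \<longrightarrow>
     (\<integral>\<^sup>+p. ennreal (cmod (stft_distr std_gauss (regular_distr (feature h)) p)) \<partial>lborel) \<le> ennreal (K * \<epsilon>)"
proof -
  obtain C c where C: "\<And>j. C j > 0" and c: "\<And>j. c j > 0" and
    b: "\<And>t \<zeta> \<eta>. cmod (LINT z|lborel. feature_kernel t z * shifted_gauss (\<zeta>, \<eta>) z) \<le>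
     (\<Prod>j\<in>UNIV. C j * exp (- c j * (t $ j)\<^sup>2)) * (\<Prod>j\<in>UNIV. exp (- c j * (norm (fst \<zeta> $ j, snd \<zeta> $ j))\<^sup>2)) *
     (\<Prod>j\<in>UNIV. inverse (1 + (fst \<eta> $ j)\<^sup>2) * inverse (1 + (snd \<eta> $ j - t $ j)\<^sup>2))"
    using feature_kernel_stft_bound by blast
  define P1 where "P1 t = (\<Prod>j\<in>UNIV. C j * exp (- c j * (t $ j)\<^sup>2))" for t :: "real^'d"
  define P2 where "P2 \<zeta> = (\<Prod>j\<in>UNIV. ennreal (exp (- c j * (norm (fst \<zeta> $ j, snd \<zeta> $ j))\<^sup>2)))" for \<zeta> :: "'d phase"
  define P3 where "P3 t \<eta> = (\<Prod>j\<in>UNIV. ennreal (inverse (1 + (fst \<eta> $ j)\<^sup>2) * inverse (1 + (snd \<eta> $ j - t $ j)\<^sup>2)))" for t :: "real^'d" and \<eta> :: "'d phase"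
  define R where "R = (\<integral>\<^sup>+s. ennreal (inverse (1 + s\<^sup>2)) \<partial>lborel)"
  define M where "M = (\<integral>\<^sup>+\<zeta>. P2 \<zeta> \<partial>lborel)"
  define g where "g = 2 powr (DIM('d phase) / 4)"
  have P1_nonneg: "P1 t \<ge> 0" for t
    unfolding P1_def by (intro prod_nonneg ballI mult_nonneg_nonneg less_imp_le[OF C]) auto
  have [measurable]: "P1 \<in> borel_measurable borel" unfolding P1_def by measurable
  have "R < \<infinity>" unfolding R_def by (rule nn_integral_inverse_square)
  have P2_m: "P2 \<in> borel_measurable borel"
  proof -
    have "P2 \<in> borel_measurable (borel \<Otimes>\<^sub>M borel)" unfolding P2_def norm_Pair by measurable
    then show ?thesis by (simp add: borel_prod)
  qed
  have "M < \<infinity>"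
  proof -
    have "M = (\<Prod>j\<in>UNIV. \<integral>\<^sup>+s. ennreal (exp (- c j * (norm (s :: real \<times> real))\<^sup>2)) \<partial>lborel)"
      unfolding M_def P2_def by (rule nn_integral_phase_prod) auto
    also have "\<dots> < \<infinity>"
      using integrable_exp_norm_square[OF c, where 'a="real \<times> real"]
      by (auto simp: less_top[symmetric] ennreal_prod_eq_top integrable_iff_bounded)
    finally show ?thesis .
  qed
  have P3_int: "(\<integral>\<^sup>+\<eta>. P3 t \<eta> \<partial>lborel) = (R * R) ^ CARD('d)" for t
  proof -
    have "(\<integral>\<^sup>+\<eta>. P3 t \<eta> \<partial>lborel) = (\<integral>\<^sup>+\<eta>. (\<Prod>j\<in>UNIV. (\<lambda>j e. ennreal (inverse (1 + (fst e)\<^sup>2) * inverse (1 + (snd e - t $ j)\<^sup>2))) j (fst (\<eta> :: 'd phase) $ j, snd \<eta> $ j)) \<partial>lborel)"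
      unfolding P3_def by simp
    also have "\<dots> = (\<Prod>j\<in>UNIV. \<integral>\<^sup>+e. (\<lambda>j e. ennreal (inverse (1 + (fst e)\<^sup>2) * inverse (1 + (snd e - t $ j)\<^sup>2))) j e \<partial>lborel)"
    proof (rule nn_integral_phase_prod)
      fix j
      have "(\<lambda>e. ennreal (inverse (1 + (fst e)\<^sup>2) * inverse (1 + (snd e - t $ j)\<^sup>2))) \<in> borel_measurable (borel \<Otimes>\<^sub>M borel)" by measurable
      then show "(\<lambda>e. ennreal (inverse (1 + (fst e)\<^sup>2) * inverse (1 + (snd e - t $ j)\<^sup>2))) \<in> borel_measurable borel" by (simp add: borel_prod)
    qed
    also have "\<dots> = (R * R) ^ CARD('d)"
      unfolding nn_integral_shifted_pair R_def by simp
    finally show ?thesis .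
  qed
  have P1_int: "integrable lborel (\<lambda>t. (P1 t)\<^sup>2)"
    unfolding P1_def by (rule integrable_gauss_prod_square[OF c])
  define B where "B = (LINT t|lborel. (P1 t)\<^sup>2)"
  have "B \<ge> 0" unfolding B_def by simp
  define L where "L = M * (R * R) ^ CARD('d)"
  have "L < \<infinity>" unfolding L_def using \<open>R < \<infinity>\<close> \<open>M < \<infinity>\<close>
    by (auto simp: ennreal_mult_less_top less_top[symmetric] power_eq_top_ennreal ennreal_mult_eq_top_iff)
  \<comment> \<open>\<open>g\<close> normalizes the Gaussian window, \<open>L\<close> is the
    integral over position and frequency, and 1 + \<open>B\<close> comes from the integral over
    t.\<close>
  define K where "K = g * enn2real L * (1 + B)"
  have "K \<ge> 0" unfolding K_def g_def using \<open>B \<ge> 0\<close> by simp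
  moreover have "(\<integral>\<^sup>+p. ennreal (cmod (stft_distr std_gauss (regular_distr (feature h)) p)) \<partial>lborel) \<le> ennreal (K * \<epsilon>)"
    if h: "h \<in> L2" and \<epsilon>: "\<epsilon> > 0" "(LINT t|lborel. (cmod (h t))\<^sup>2) \<le> \<epsilon>\<^sup>2" for h \<epsilon>
  proof -
    have [measurable]: "h \<in> borel_measurable borel" using h unfolding L2_def by simp
    have P3_m: "(\<lambda>x. P3 (snd x) (fst x)) \<in> borel_measurable (lborel \<Otimes>\<^sub>M lborel)"
    proof -
      have "(\<lambda>x. P3 (snd x) (fst x)) \<in> borel_measurable ((lborel \<Otimes>\<^sub>M lborel) \<Otimes>\<^sub>M lborel)"
        unfolding P3_def by measurable
      then show ?thesis by (simp add: lborel_prod)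
    qed
    have P3_m': "(\<lambda>\<eta>. P3 t \<eta>) \<in> borel_measurable lborel" for t
    proof -
      have "(\<lambda>x. P3 t x) \<in> borel_measurable (lborel \<Otimes>\<^sub>M lborel)"
        unfolding P3_def by measurable
      then show ?thesis by (simp add: lborel_prod)
    qed
    have feat_m[measurable]: "feature h \<in> borel_measurable borel"
      using borel_measurable_integrable[OF feature_integrable[OF h]] by simp
    let ?S = "stft_distr std_gauss (regular_distr (feature h))"
    let ?H = "\<integral>\<^sup>+t. ennreal (cmod (h t)) * ennreal (P1 t) \<partial>lborel"
    have S: "?S p = of_real g * (LINT z|lborel. feature h z * shifted_gauss p z)" for p
      unfolding stft_distr_regular g_def mult.left_commute[of "feature h _"] by (rule integral_mult_right_zero)
    have S_m: "?S \<in> borel_measurable borel"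
    proof -
      have "(\<lambda>p. LINT z|lborel. feature h z * shifted_gauss p z) \<in> borel_measurable lborel"
        by measurable
      then show ?thesis unfolding S by simp
    qed
    have bd: "ennreal (cmod (?S (\<zeta>, \<eta>))) \<le> ennreal g * (\<integral>\<^sup>+t. (ennreal (cmod (h t)) * ennreal (P1 t)) * (P2 \<zeta> * P3 t \<eta>) \<partial>lborel)" for \<zeta> \<eta>
    proof -
      have "ennreal (cmod (?S (\<zeta>, \<eta>))) = ennreal g * ennreal (cmod (LINT t|lborel. cnj (h t) * (LINT z|lborel. feature_kernel t z * shifted_gauss (\<zeta>, \<eta>) z)))"
        unfolding S feature_stft[OF h] norm_mult g_def by (simp add: ennreal_mult)
      also have "\<dots> \<le> ennreal g * (\<integral>\<^sup>+t. ennreal (cmod (cnj (h t) * (LINT z|lborel. feature_kernel t z * shifted_gauss (\<zeta>, \<eta>) z))) \<partial>lborel)"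
      \<comment> \<open>If the integrand is not integrable, its integral is 0 by convention and the
        bound is trivial.\<close>
      proof (cases "integrable lborel (\<lambda>t. cnj (h t) * (LINT z|lborel. feature_kernel t z * shifted_gauss (\<zeta>, \<eta>) z))")
        case True
        then show ?thesis by (intro mult_left_mono integral_norm_bound_ennreal) auto
      qed (simp add: not_integrable_integral_eq)
      also have "\<dots> \<le> ennreal g * (\<integral>\<^sup>+t. (ennreal (cmod (h t)) * ennreal (P1 t)) * (P2 \<zeta> * P3 t \<eta>) \<partial>lborel)"
      proof (intro mult_left_mono nn_integral_mono)
        fix t
        have e: "P2 \<zeta> * P3 t \<eta> = ennreal ((\<Prod>j\<in>UNIV. exp (- c j * (norm (fst \<zeta> $ j, snd \<zeta> $ j))\<^sup>2)) *
           (\<Prod>j\<in>UNIV. inverse (1 + (fst \<eta> $ j)\<^sup>2) * inverse (1 + (snd \<eta> $ j - t $ j)\<^sup>2)))"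
          unfolding P2_def P3_def by (subst ennreal_mult) (auto simp: prod_ennreal intro!: prod_nonneg)
        have "cmod (cnj (h t) * (LINT z|lborel. feature_kernel t z * shifted_gauss (\<zeta>, \<eta>) z)) \<le>
          cmod (h t) * (P1 t * ((\<Prod>j\<in>UNIV. exp (- c j * (norm (fst \<zeta> $ j, snd \<zeta> $ j))\<^sup>2)) *
           (\<Prod>j\<in>UNIV. inverse (1 + (fst \<eta> $ j)\<^sup>2) * inverse (1 + (snd \<eta> $ j - t $ j)\<^sup>2))))"
          unfolding norm_mult complex_mod_cnj using b[of t \<zeta> \<eta>] unfolding P1_def by (intro mult_left_mono) (auto simp: mult.assoc)
        then show "ennreal (cmod (cnj (h t) * (LINT z|lborel. feature_kernel t z * shifted_gauss (\<zeta>, \<eta>) z))) \<le>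
          (ennreal (cmod (h t)) * ennreal (P1 t)) * (P2 \<zeta> * P3 t \<eta>)"
          unfolding e using P1_nonneg[of t]
          by (subst ennreal_mult[symmetric], simp, simp, subst ennreal_mult[symmetric])
            (auto intro!: ennreal_leI mult_nonneg_nonneg prod_nonneg simp: mult.assoc)
      qed auto
      finally show ?thesis .
    qed
    have "(\<integral>\<^sup>+p. ennreal (cmod (?S p)) \<partial>lborel) = (\<integral>\<^sup>+\<zeta>. \<integral>\<^sup>+\<eta>. ennreal (cmod (?S (\<zeta>, \<eta>))) \<partial>lborel \<partial>lborel)"
      using lborel.nn_integral_fst[of "\<lambda>p. ennreal (cmod (?S p))" "lborel"] S_m by (simp add: lborel_prod)
    also have "\<dots> \<le> (\<integral>\<^sup>+\<zeta>. \<integral>\<^sup>+\<eta>. ennreal g * (\<integral>\<^sup>+t. (ennreal (cmod (h t)) * ennreal (P1 t)) * (P2 \<zeta> * P3 t \<eta>) \<partial>lborel) \<partial>lborel \<partial>lborel)"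
      by (intro nn_integral_mono bd)
    \<comment> \<open>The frequency integral is taken before that over t: its value does not depend
      on t, so the integrals over t and over the position separate.\<close>
    also have "\<dots> = (\<integral>\<^sup>+\<zeta>. P2 \<zeta> * (ennreal g * (?H * (R * R) ^ CARD('d))) \<partial>lborel)"
    proof (intro nn_integral_cong)
      fix \<zeta>
      have m: "(\<lambda>(\<eta>, t). (ennreal (cmod (h t)) * ennreal (P1 t)) * (P2 \<zeta> * P3 t \<eta>)) \<in> borel_measurable (lborel \<Otimes>\<^sub>M lborel)"
        unfolding case_prod_unfold using P3_m by measurable
      have "(\<integral>\<^sup>+\<eta>. ennreal g * (\<integral>\<^sup>+t. (ennreal (cmod (h t)) * ennreal (P1 t)) * (P2 \<zeta> * P3 t \<eta>) \<partial>lborel) \<partial>lborel) =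
        ennreal g * (\<integral>\<^sup>+\<eta>. \<integral>\<^sup>+t. (ennreal (cmod (h t)) * ennreal (P1 t)) * (P2 \<zeta> * P3 t \<eta>) \<partial>lborel \<partial>lborel)"
        using lborel.borel_measurable_nn_integral[OF m] by (intro nn_integral_cmult) simp
      also have "(\<integral>\<^sup>+\<eta>. \<integral>\<^sup>+t. (ennreal (cmod (h t)) * ennreal (P1 t)) * (P2 \<zeta> * P3 t \<eta>) \<partial>lborel \<partial>lborel) =
         (\<integral>\<^sup>+t. \<integral>\<^sup>+\<eta>. (ennreal (cmod (h t)) * ennreal (P1 t)) * (P2 \<zeta> * P3 t \<eta>) \<partial>lborel \<partial>lborel)"
        using lborel_pair.Fubini'[OF m] by simp
      also have "\<dots> = (\<integral>\<^sup>+t. (ennreal (cmod (h t)) * ennreal (P1 t)) * (P2 \<zeta> * (R * R) ^ CARD('d)) \<partial>lborel)"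
      proof (intro nn_integral_cong)
        fix t
        have "(\<integral>\<^sup>+\<eta>. (ennreal (cmod (h t)) * ennreal (P1 t)) * (P2 \<zeta> * P3 t \<eta>) \<partial>lborel) =
          (\<integral>\<^sup>+\<eta>. ((ennreal (cmod (h t)) * ennreal (P1 t)) * P2 \<zeta>) * P3 t \<eta> \<partial>lborel)" by (simp only: mult.assoc)
        also have "\<dots> = ((ennreal (cmod (h t)) * ennreal (P1 t)) * P2 \<zeta>) * (R * R) ^ CARD('d)"
          unfolding P3_int[of t, symmetric] by (rule nn_integral_cmult[OF P3_m'])
        finally show "(\<integral>\<^sup>+\<eta>. (ennreal (cmod (h t)) * ennreal (P1 t)) * (P2 \<zeta> * P3 t \<eta>) \<partial>lborel) =
          (ennreal (cmod (h t)) * ennreal (P1 t)) * (P2 \<zeta> * (R * R) ^ CARD('d))" by (simp only: mult.assoc)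
      qed
      also have "\<dots> = ?H * (P2 \<zeta> * (R * R) ^ CARD('d))"
        by (intro nn_integral_multc) measurable
      finally show "(\<integral>\<^sup>+\<eta>. ennreal g * (\<integral>\<^sup>+t. (ennreal (cmod (h t)) * ennreal (P1 t)) * (P2 \<zeta> * P3 t \<eta>) \<partial>lborel) \<partial>lborel) =
        P2 \<zeta> * (ennreal g * (?H * (R * R) ^ CARD('d)))" by (simp only: mult_ac)
    qed
    also have "\<dots> = M * (ennreal g * (?H * (R * R) ^ CARD('d)))"
      unfolding M_def using P2_m by (intro nn_integral_multc) simp
    also have "\<dots> = ennreal g * L * ?H" unfolding L_def by (simp only: mult_ac)
    also have "\<dots> \<le> ennreal g * L * ennreal ((1 + B) * \<epsilon>)"
    proof (intro mult_left_mono)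
      \<comment> \<open>The weights 1 / \<epsilon> and \<epsilon> are chosen so that the assumed
        bound \<epsilon>^2 makes both terms of order \<epsilon>.\<close>
      have "?H \<le> (\<integral>\<^sup>+t. ennreal ((cmod (h t))\<^sup>2 / \<epsilon> + (P1 t)\<^sup>2 * \<epsilon>) \<partial>lborel)"
      proof (intro nn_integral_mono)
        fix t
        let ?a = "cmod (h t)" and ?b = "P1 t"
        have "2 * (?a * (?b * \<epsilon>)) \<le> ?a\<^sup>2 + (?b * \<epsilon>)\<^sup>2"
          using sum_squares_bound[of ?a "?b * \<epsilon>"] by simp
        moreover have "0 \<le> ?a * (?b * \<epsilon>)" using P1_nonneg[of t] \<epsilon>(1) by simp
        moreover have "(?a\<^sup>2 / \<epsilon> + ?b\<^sup>2 * \<epsilon>) * \<epsilon> = ?a\<^sup>2 + (?b * \<epsilon>)\<^sup>2"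
          using \<epsilon>(1) by (simp add: field_simps power2_eq_square)
        ultimately have "?a * ?b * \<epsilon> \<le> (?a\<^sup>2 / \<epsilon> + ?b\<^sup>2 * \<epsilon>) * \<epsilon>"
          unfolding mult.assoc by linarith
        then have "?a * ?b \<le> ?a\<^sup>2 / \<epsilon> + ?b\<^sup>2 * \<epsilon>" using \<epsilon>(1) by (simp only: mult_le_cancel_right_pos)
        then show "ennreal ?a * ennreal ?b \<le> ennreal (?a\<^sup>2 / \<epsilon> + ?b\<^sup>2 * \<epsilon>)"
          using P1_nonneg[of t] by (subst ennreal_mult[symmetric]) (auto intro: ennreal_leI)
      qed
      also have "\<dots> = ennreal (LINT t|lborel. (cmod (h t))\<^sup>2 / \<epsilon> + (P1 t)\<^sup>2 * \<epsilon>)"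
        using h P1_int \<epsilon>(1) unfolding L2_def by (intro nn_integral_eq_integral) auto
      also have "(LINT t|lborel. (cmod (h t))\<^sup>2 / \<epsilon> + (P1 t)\<^sup>2 * \<epsilon>) = (LINT t|lborel. (cmod (h t))\<^sup>2) / \<epsilon> + B * \<epsilon>"
        using h P1_int unfolding L2_def B_def by (subst Bochner_Integration.integral_add) auto
      also have "ennreal \<dots> \<le> ennreal (\<epsilon>\<^sup>2 / \<epsilon> + B * \<epsilon>)"
        using \<epsilon> by (intro ennreal_leI add_right_mono divide_right_mono) auto
      also have "\<epsilon>\<^sup>2 / \<epsilon> + B * \<epsilon> = (1 + B) * \<epsilon>" using \<epsilon>(1) by (simp add: power2_eq_square algebra_simps)
      finally show "?H \<le> ennreal ((1 + B) * \<epsilon>)" .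
    qed auto
    also have "\<dots> = ennreal (K * \<epsilon>)"
    proof -
      have "L = ennreal (enn2real L)" using \<open>L < \<infinity>\<close> by simp
      then have "ennreal g * L * ennreal ((1 + B) * \<epsilon>) = ennreal g * ennreal (enn2real L) * ennreal ((1 + B) * \<epsilon>)" by simp
      also have "\<dots> = ennreal (g * enn2real L * ((1 + B) * \<epsilon>))"
        using \<open>B \<ge> 0\<close> \<epsilon>(1) unfolding g_def by (simp add: ennreal_mult)
      finally show ?thesis unfolding K_def by (simp only: mult.assoc)
    qed
    finally show ?thesis .
  qed
  ultimately show ?thesis by blast
qed

lemma feature_S0:
  "\<exists>K\<ge>0. \<forall>h\<in>L2. regular_distr (feature h) \<in> S0 \<and>
     (\<forall>\<epsilon>>0. (LINT t|lborel. (cmod (h t))\<^sup>2) \<le> \<epsilon>\<^sup>2 \<longrightarrow> S0_norm (regular_distr (feature h)) \<le> K * \<epsilon>)"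
proof -
  obtain K where K: "K \<ge> 0" "\<And>h \<epsilon>. h \<in> L2 \<Longrightarrow> \<epsilon> > 0 \<Longrightarrow> (LINT t|lborel. (cmod (h t))\<^sup>2) \<le> \<epsilon>\<^sup>2 \<Longrightarrow>
     (\<integral>\<^sup>+p. ennreal (cmod (stft_distr std_gauss (regular_distr (feature h)) p)) \<partial>lborel) \<le> ennreal (K * \<epsilon>)"
    using feature_S0_bound by blast
  have "regular_distr (feature h) \<in> S0 \<and>
     (\<forall>\<epsilon>>0. (LINT t|lborel. (cmod (h t))\<^sup>2) \<le> \<epsilon>\<^sup>2 \<longrightarrow> S0_norm (regular_distr (feature h)) \<le> K * \<epsilon>)" if h: "h \<in> L2" for h
  proof -
    let ?S = "stft_distr std_gauss (regular_distr (feature h))"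
    have [measurable]: "feature h \<in> borel_measurable borel"
      using borel_measurable_integrable[OF feature_integrable[OF h]] by simp
    have S_m: "?S \<in> borel_measurable lborel"
      unfolding stft_distr_regular[abs_def] by measurable
    define a where "a = (LINT t|lborel. (cmod (h t))\<^sup>2)"
    have "a \<ge> 0" unfolding a_def by simp
    \<comment> \<open>The value sqrt a + 1 is admissible for every \<open>h\<close>: it is positive
      even when a = 0, and its square is at least a.\<close>
    have "a \<le> (sqrt a + 1)\<^sup>2" using \<open>a \<ge> 0\<close> by (simp add: power2_eq_square algebra_simps)
    then have "(\<integral>\<^sup>+p. ennreal (cmod (?S p)) \<partial>lborel) \<le> ennreal (K * (sqrt a + 1))"
      using \<open>a \<ge> 0\<close> by (intro K(2)[OF h]) (auto simp: a_def intro: add_nonneg_pos)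
    then have i: "integrable lborel ?S"
      by (intro integrableI_bounded S_m) (auto simp: less_top[symmetric] top_unique)
    have "S0_norm (regular_distr (feature h)) \<le> K * \<epsilon>" if e: "\<epsilon> > 0" "a \<le> \<epsilon>\<^sup>2" for \<epsilon>
    proof -
      have "ennreal (S0_norm (regular_distr (feature h))) = (\<integral>\<^sup>+p. ennreal (cmod (?S p)) \<partial>lborel)"
        unfolding S0_norm_def using i by (intro nn_integral_eq_integral[symmetric]) auto
      also have "\<dots> \<le> ennreal (K * \<epsilon>)" using e by (intro K(2)[OF h]) (auto simp: a_def)
      finally show ?thesis using K(1) e by (subst (asm) ennreal_le_iff) auto
    qed
    then show ?thesis using i regular_distr_tempered[OF feature_integrable[OF h]] unfolding S0_def a_def by auto
  qed
  then show ?thesis using K(1) by blast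
qed

end

section \<open>Completeness of the Hermite functions\<close>

lemma L2_measurable: "f \<in> L2 \<Longrightarrow> f \<in> borel_measurable borel"
  by (simp add: L2_def)

lemma L2_bound:
  assumes "f \<in> borel_measurable borel" "integrable lborel (\<lambda>t. (G t)\<^sup>2)" "\<And>t. cmod (f t) \<le> G t"
  shows "f \<in> L2"
proof -
  have "integrable lborel (\<lambda>t. (cmod (f t))\<^sup>2)"
  proof (rule Bochner_Integration.integrable_bound[OF assms(2)])
    have "(cmod (f t))\<^sup>2 \<le> (G t)\<^sup>2" for t using assms(3) by (intro power_mono) auto
    then show "AE t in lborel. norm ((cmod (f t))\<^sup>2) \<le> norm ((G t)\<^sup>2)" by simp
  qed (use assms(1) in measurable)
  then show ?thesis using assms(1) by (simp add: L2_def)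
qed

lemma power2_norm_add_le: "(cmod (a + b))\<^sup>2 \<le> 2 * (cmod a)\<^sup>2 + 2 * (cmod b)\<^sup>2"
proof -
  have "(cmod (a + b))\<^sup>2 \<le> (cmod a + cmod b)\<^sup>2" by (intro power_mono norm_triangle_ineq) auto
  also have "\<dots> \<le> 2 * (cmod a)\<^sup>2 + 2 * (cmod b)\<^sup>2"
    using sum_squares_bound[of "cmod a" "cmod b"] by (simp add: power2_sum)
  finally show ?thesis .
qed

lemma L2_add:
  assumes "f \<in> L2" "g \<in> L2"
  shows "(\<lambda>t. f t + g t) \<in> L2"
proof -
  have [measurable]: "f \<in> borel_measurable borel" "g \<in> borel_measurable borel" using assms by (auto simp: L2_def)
  have "integrable lborel (\<lambda>t. 2 * (cmod (f t))\<^sup>2 + 2 * (cmod (g t))\<^sup>2)" using assms by (auto simp: L2_def)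
  then have "integrable lborel (\<lambda>t. (cmod (f t + g t))\<^sup>2)"
    by (rule Bochner_Integration.integrable_bound) (auto simp: power2_norm_add_le intro!: order_trans[OF power2_norm_add_le])
  then show ?thesis by (simp add: L2_def)
qed

lemma L2_scale: "f \<in> L2 \<Longrightarrow> (\<lambda>t. c * f t) \<in> L2"
  by (auto simp: L2_def norm_mult power_mult_distrib)

lemma L2_diff: "f \<in> L2 \<Longrightarrow> g \<in> L2 \<Longrightarrow> (\<lambda>t. f t - g t) \<in> L2"
  using L2_add[of f "\<lambda>t. (-1) * g t"] L2_scale[of g "-1"] by simp

lemma L2_sum: "(\<And>i. i \<in> I \<Longrightarrow> f i \<in> L2) \<Longrightarrow> (\<lambda>t. \<Sum>i\<in>I. f i t) \<in> L2"
proof (induction I rule: infinite_finite_induct)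
  case (insert i I)
  then show ?case by (simp add: L2_add)
qed (simp_all add: L2_def)

text \<open>The square is kept, and the factor 2 in \<open>L2_dist2_triangle\<close> accepted, so
  that Minkowski's inequality can be avoided.\<close>

definition L2_dist2 :: "('a::euclidean_space \<Rightarrow> complex) \<Rightarrow> ('a \<Rightarrow> complex) \<Rightarrow> real" where
  "L2_dist2 f g = (LINT t|lborel. (cmod (f t - g t))\<^sup>2)"

lemma L2_dist2_triangle:
  assumes "f \<in> L2" "g \<in> L2" "h \<in> L2"
  shows "L2_dist2 f h \<le> 2 * L2_dist2 f g + 2 * L2_dist2 g h"
proof -
  have i: "integrable lborel (\<lambda>t. (cmod (f t - g t))\<^sup>2)" if "f \<in> L2" "g \<in> L2" for f g :: "'a \<Rightarrow> complex"
    using L2_diff[OF that] by (simp add: L2_def)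
  have p: "(cmod (f t - h t))\<^sup>2 \<le> 2 * (cmod (f t - g t))\<^sup>2 + 2 * (cmod (g t - h t))\<^sup>2" for t
    using power2_norm_add_le[of "f t - g t" "g t - h t"] by simp
  have "L2_dist2 f h \<le> (LINT t|lborel. 2 * (cmod (f t - g t))\<^sup>2 + 2 * (cmod (g t - h t))\<^sup>2)"
    unfolding L2_dist2_def using p i assms by (intro integral_mono) auto
  also have "\<dots> = 2 * L2_dist2 f g + 2 * L2_dist2 g h"
    unfolding L2_dist2_def using i assms by (subst Bochner_Integration.integral_add) auto
  finally show ?thesis .
qed

section \<open>The closed linear span of the Hermite functions\<close>

definition hermite_sum :: "(nat ^ 'd) set \<Rightarrow> (nat ^ 'd \<Rightarrow> complex) \<Rightarrow> real ^ 'd::finite \<Rightarrow> complex" where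
  "hermite_sum I a = (\<lambda>t. \<Sum>i\<in>I. a i * hermite i t)"

definition hermite_closure :: "(real ^ 'd::finite \<Rightarrow> complex) set" where
  "hermite_closure = {f \<in> L2. \<forall>\<epsilon>>0. \<exists>I a. finite I \<and> L2_dist2 f (hermite_sum I a) < \<epsilon>}"

lemma hermite_closureD:
  "f \<in> hermite_closure \<Longrightarrow> \<epsilon> > 0 \<Longrightarrow> \<exists>I a. finite I \<and> L2_dist2 f (hermite_sum I a) < \<epsilon>"
  by (simp add: hermite_closure_def)

lemma norm_hermite_0: "cmod (hermite 0 t) = (2 powr (1/4)) ^ CARD('d) * exp (- pi * (norm t)\<^sup>2)" for t :: "real ^ 'd::finite"
proof -
  have n: "(norm t)\<^sup>2 = (\<Sum>j\<in>UNIV. (t $ j)\<^sup>2)"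
    unfolding power2_norm_eq_inner inner_vec_def by (simp add: power2_eq_square)
  show ?thesis unfolding hermite_def norm_of_real
    by (simp add: hermite1_0 abs_prod prod.distrib n exp_sum[symmetric] sum_distrib_left sum_negf abs_mult)
qed

lemma hermite_0_pos: "\<exists>r>0. hermite 0 t = of_real r" for t :: "real ^ 'd::finite"
  unfolding hermite_def by (intro exI[of _ "\<Prod>j\<in>UNIV. hermite1 0 (t $ j)"]) (auto simp: hermite1_0 intro!: prod_pos)

text \<open>The majorant for the partial sums of the exponential series in
  \<open>hermite_closure_trig\<close>. Since 2 r |t| \<le> r^2 / pi + pi |t|^2, half of the Gaussian
  decay of the square survives.\<close>

lemma integrable_hermite_0_exp:
  "integrable lborel (\<lambda>t::real ^ 'd::finite. (exp (r * norm t) * cmod (hermite 0 t))\<^sup>2)"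
proof (rule Bochner_Integration.integrable_bound)
  define c where "c = ((2 powr (1/4)) ^ CARD('d))\<^sup>2 * exp (r\<^sup>2 / pi)"
  show "integrable lborel (\<lambda>t::real^'d. c * exp (- pi * (norm t)\<^sup>2))"
    by (intro integrable_mult_right integrable_exp_norm_square) simp
  have "(exp (r * norm t) * cmod (hermite 0 t))\<^sup>2 \<le> c * exp (- pi * (norm t)\<^sup>2)" for t :: "real^'d"
  proof -
    have "0 \<le> (r - pi * norm t)\<^sup>2 / pi" by simp
    also have "(r - pi * norm t)\<^sup>2 / pi = r\<^sup>2 / pi - 2 * (r * norm t) + pi * (norm t)\<^sup>2"
      by (simp add: power2_eq_square field_simps)
    finally have e: "2 * (r * norm t) + 2 * (- pi * (norm t)\<^sup>2) \<le> r\<^sup>2 / pi + - pi * (norm t)\<^sup>2" by simp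
    have "(exp (r * norm t) * cmod (hermite 0 t))\<^sup>2 = ((2 powr (1/4)) ^ CARD('d))\<^sup>2 * ((exp (r * norm t))\<^sup>2 * (exp (- pi * (norm t)\<^sup>2))\<^sup>2)"
      unfolding norm_hermite_0 power_mult_distrib by (simp only: mult_ac)
    also have "(exp (r * norm t))\<^sup>2 * (exp (- pi * (norm t)\<^sup>2))\<^sup>2 = exp (2 * (r * norm t) + 2 * (- pi * (norm t)\<^sup>2))"
      unfolding exp_double[symmetric] exp_add ..
    also have "((2 powr (1/4)) ^ CARD('d))\<^sup>2 * exp (2 * (r * norm t) + 2 * (- pi * (norm t)\<^sup>2)) \<le>
      ((2 powr (1/4)) ^ CARD('d))\<^sup>2 * exp (r\<^sup>2 / pi + - pi * (norm t)\<^sup>2)"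
      using e by (intro mult_left_mono) auto
    finally show ?thesis unfolding c_def exp_add by (simp only: mult.assoc)
  qed
  then show "AE t in lborel. norm ((exp (r * norm t) * cmod (hermite 0 t))\<^sup>2) \<le> norm (c * exp (- pi * (norm (t :: real^'d))\<^sup>2))"
    by (intro AE_I2) (auto intro: order_trans[OF _ abs_ge_self])
qed measurable

lemma hermite_gauss_integrable: "integrable lborel (\<lambda>t. hermite n t * cnj (hermite m t))" for n m :: "nat ^ 'd::finite"
proof -
  have i: "integrable lborel (\<lambda>s. of_real (hermite1 a s) * of_real (hermite1 b s) :: complex)" for a b
    using hstft_integrable[of a b 0 0] by simp
  have "integrable lborel (\<lambda>t::real^'d. \<Prod>j\<in>UNIV. of_real (hermite1 (n $ j) (t $ j)) * of_real (hermite1 (m $ j) (t $ j)) :: complex)"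
    by (rule integrable_vec_prod) (rule i)
  then show ?thesis by (simp add: hermite_def prod.distrib)
qed

lemma hermite_L2: "hermite n \<in> L2" for n :: "nat ^ 'd::finite"
proof -
  have "integrable lborel (\<lambda>t. Re (hermite n t * cnj (hermite n t)))"
    using hermite_gauss_integrable by (rule integrable_Re)
  then have "integrable lborel (\<lambda>t. (cmod (hermite n t))\<^sup>2)"
    by (simp only: complex_norm_square[symmetric] Re_complex_of_real)
  then show ?thesis by (simp add: L2_def)
qed

lemma hermite_sum_L2: "hermite_sum I a \<in> L2"
  unfolding hermite_sum_def by (intro L2_sum L2_scale hermite_L2)

lemma hermite_closure_hermite: "hermite n \<in> hermite_closure"
proof -
  have "hermite n = hermite_sum {n} (\<lambda>_. 1)" by (simp add: hermite_sum_def)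
  then have "L2_dist2 (hermite n) (hermite_sum {n} (\<lambda>_. 1)) = 0" by (simp add: L2_dist2_def)
  then show ?thesis unfolding hermite_closure_def using hermite_L2
    by (auto intro!: exI[of _ "{n}"] exI[of _ "\<lambda>_. 1"])
qed

lemma hermite_closure_scale:
  assumes "f \<in> hermite_closure"
  shows "(\<lambda>t. c * f t) \<in> hermite_closure"
proof -
  have f: "f \<in> L2" using assms by (simp add: hermite_closure_def)
  have "\<exists>I a. finite I \<and> L2_dist2 (\<lambda>t. c * f t) (hermite_sum I a) < \<epsilon>" if e: "\<epsilon> > 0" for \<epsilon>
  proof -
    \<comment> \<open>Adding 1 keeps the divisor positive when c = 0.\<close>
    have p: "(cmod c)\<^sup>2 + 1 > 0" by (intro add_nonneg_pos) auto
    obtain I a where I: "finite I" "L2_dist2 f (hermite_sum I a) < \<epsilon> / ((cmod c)\<^sup>2 + 1)"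
      using hermite_closureD[OF assms divide_pos_pos[OF e p]] by blast
    have "c * f t - hermite_sum I (\<lambda>i. c * a i) t = c * (f t - hermite_sum I a t)" for t
      by (simp add: hermite_sum_def right_diff_distrib sum_distrib_left mult.assoc)
    then have "L2_dist2 (\<lambda>t. c * f t) (hermite_sum I (\<lambda>i. c * a i)) = (cmod c)\<^sup>2 * L2_dist2 f (hermite_sum I a)"
      by (simp add: L2_dist2_def norm_mult power_mult_distrib)
    also have "\<dots> \<le> ((cmod c)\<^sup>2 + 1) * L2_dist2 f (hermite_sum I a)"
      by (intro mult_right_mono) (auto simp: L2_dist2_def)
    also have "\<dots> < \<epsilon>" using I(2) p by (simp add: field_simps)
    finally show ?thesis using I(1) by blast
  qed
  then show ?thesis using L2_scale[OF f] by (simp add: hermite_closure_def)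
qed

lemma hermite_closure_add:
  assumes "f \<in> hermite_closure" "g \<in> hermite_closure"
  shows "(\<lambda>t. f t + g t) \<in> hermite_closure"
proof -
  have fg: "f \<in> L2" "g \<in> L2" using assms by (auto simp: hermite_closure_def)
  have "\<exists>I a. finite I \<and> L2_dist2 (\<lambda>t. f t + g t) (hermite_sum I a) < \<epsilon>" if e: "\<epsilon> > 0" for \<epsilon>
  proof -
    obtain I a where I: "finite I" "L2_dist2 f (hermite_sum I a) < \<epsilon> / 4"
      using hermite_closureD[of _ "\<epsilon> / 4", OF assms(1)] e by auto
    obtain J b where J: "finite J" "L2_dist2 g (hermite_sum J b) < \<epsilon> / 4"
      using hermite_closureD[of _ "\<epsilon> / 4", OF assms(2)] e by auto
    define d where "d i = (if i \<in> I then a i else 0) + (if i \<in> J then b i else 0)" for i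
    have s: "hermite_sum (I \<union> J) d t = hermite_sum I a t + hermite_sum J b t" for t
    proof -
      have "(\<Sum>i\<in>I \<union> J. (if i \<in> I then a i else 0) * hermite i t) = (\<Sum>i\<in>I. a i * hermite i t)"
        using I J by (intro sum.mono_neutral_cong_right) auto
      moreover have "(\<Sum>i\<in>I \<union> J. (if i \<in> J then b i else 0) * hermite i t) = (\<Sum>i\<in>J. b i * hermite i t)"
        using I J by (intro sum.mono_neutral_cong_right) auto
      ultimately show ?thesis by (simp add: hermite_sum_def d_def distrib_right sum.distrib)
    qed
    have i: "integrable lborel (\<lambda>t. (cmod (f t - hermite_sum I a t))\<^sup>2)" "integrable lborel (\<lambda>t. (cmod (g t - hermite_sum J b t))\<^sup>2)"
      using L2_diff[OF fg(1) hermite_sum_L2] L2_diff[OF fg(2) hermite_sum_L2] by (auto simp: L2_def)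
    have "L2_dist2 (\<lambda>t. f t + g t) (hermite_sum (I \<union> J) d) \<le>
      (LINT t|lborel. 2 * (cmod (f t - hermite_sum I a t))\<^sup>2 + 2 * (cmod (g t - hermite_sum J b t))\<^sup>2)"
      unfolding L2_dist2_def
    proof (intro integral_mono)
      show "integrable lborel (\<lambda>t. (cmod (f t + g t - hermite_sum (I \<union> J) d t))\<^sup>2)"
        using L2_diff[OF L2_add[OF fg] hermite_sum_L2] by (simp add: L2_def)
      show "(cmod (f t + g t - hermite_sum (I \<union> J) d t))\<^sup>2 \<le> 2 * (cmod (f t - hermite_sum I a t))\<^sup>2 + 2 * (cmod (g t - hermite_sum J b t))\<^sup>2" for t
        using power2_norm_add_le[of "f t - hermite_sum I a t" "g t - hermite_sum J b t"] by (simp add: s algebra_simps)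
    qed (use i in auto)
    also have "\<dots> = 2 * L2_dist2 f (hermite_sum I a) + 2 * L2_dist2 g (hermite_sum J b)"
      unfolding L2_dist2_def using i by (subst Bochner_Integration.integral_add) auto
    also have "\<dots> < \<epsilon>" using I(2) J(2) by simp
    finally show ?thesis using I(1) J(1) by blast
  qed
  then show ?thesis using L2_add[OF fg] by (simp add: hermite_closure_def)
qed

lemma hermite_closure_sum:
  "(\<And>i. i \<in> I \<Longrightarrow> f i \<in> hermite_closure) \<Longrightarrow> finite I \<Longrightarrow> (\<lambda>t. \<Sum>i\<in>I. f i t) \<in> hermite_closure"
proof (induction I rule: infinite_finite_induct)
  case empty
  then show ?case using hermite_closure_scale[OF hermite_closure_hermite, of 0] by simp
qed (auto intro!: hermite_closure_add)

text \<open>Dominated convergence for |g - f m|^2, with majorant 4 G^2, turns pointwise convergence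
  into convergence in \<open>L2\<close>.\<close>

lemma hermite_closure_dominated:
  fixes f :: "nat \<Rightarrow> real ^ 'd::finite \<Rightarrow> complex"
  assumes f: "\<And>m. f m \<in> hermite_closure" and lim: "\<And>t. (\<lambda>m. f m t) \<longlonglongrightarrow> g t"
    and G: "integrable lborel (\<lambda>t. (G t)\<^sup>2)" "\<And>m t. cmod (f m t) \<le> G t"
  shows "g \<in> hermite_closure"
proof -
  have f2: "f m \<in> L2" for m using f by (auto simp: hermite_closure_def)
  then have [measurable]: "f m \<in> borel_measurable borel" for m by (rule L2_measurable)
  have [measurable]: "g \<in> borel_measurable borel"
    by (rule borel_measurable_LIMSEQ_metric[of f]) (auto simp: lim)
  have gG: "cmod (g t) \<le> G t" for t
    using lim[of t] G(2) by (intro tendsto_upperbound[OF tendsto_norm]) (auto intro: always_eventually)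
  have g2: "g \<in> L2" by (rule L2_bound[OF _ G(1) gG]) measurable
  have "(\<lambda>m. LINT t|lborel. (cmod (g t - f m t))\<^sup>2) \<longlonglongrightarrow> (LINT t|(lborel :: (real^'d) measure). 0)"
  proof (rule integral_dominated_convergence[where w="\<lambda>t. 4 * (G t)\<^sup>2"])
    show "integrable lborel (\<lambda>t. 4 * (G t)\<^sup>2)" using G(1) by simp
    show "AE t in lborel. (\<lambda>m. (cmod (g t - f m t))\<^sup>2) \<longlonglongrightarrow> 0"
    proof (intro AE_I2)
      fix t
      have "(\<lambda>m. (cmod (g t - f m t))\<^sup>2) \<longlonglongrightarrow> (cmod (g t - g t))\<^sup>2" by (intro tendsto_intros lim)
      then show "(\<lambda>m. (cmod (g t - f m t))\<^sup>2) \<longlonglongrightarrow> 0" by simp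
    qed
    show "AE t in lborel. norm ((cmod (g t - f m t))\<^sup>2) \<le> 4 * (G t)\<^sup>2" for m
    proof (intro AE_I2)
      fix t
      have "cmod (g t - f m t) \<le> 2 * G t" using norm_triangle_ineq4[of "g t" "f m t"] gG[of t] G(2)[of m t] by simp
      then have "(cmod (g t - f m t))\<^sup>2 \<le> (2 * G t)\<^sup>2" by (intro power_mono) auto
      then show "norm ((cmod (g t - f m t))\<^sup>2) \<le> 4 * (G t)\<^sup>2" by (simp add: power_mult_distrib)
    qed
  qed measurable
  then have l: "(\<lambda>m. L2_dist2 g (f m)) \<longlonglongrightarrow> 0" by (simp add: L2_dist2_def)
  have "\<exists>I a. finite I \<and> L2_dist2 g (hermite_sum I a) < \<epsilon>" if e: "\<epsilon> > 0" for \<epsilon>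
  proof -
    have "eventually (\<lambda>m. L2_dist2 g (f m) < \<epsilon> / 4) sequentially"
      by (rule order_tendstoD(2)[OF l]) (use e in simp)
    then obtain m where m: "L2_dist2 g (f m) < \<epsilon> / 4" by (auto dest: eventually_happens)
    obtain I a where I: "finite I" "L2_dist2 (f m) (hermite_sum I a) < \<epsilon> / 4"
      using hermite_closureD[of _ "\<epsilon> / 4", OF f[of m]] e by auto
    have "L2_dist2 g (hermite_sum I a) < \<epsilon>"
      using L2_dist2_triangle[OF g2 f2[of m] hermite_sum_L2[of I a]] m I(2) by simp
    then show ?thesis using I(1) by blast
  qed
  then show ?thesis using g2 by (simp add: hermite_closure_def)
qed

text \<open>The algebraic span is kept apart from its closure because multiplication by a coordinate
  is unbounded on \<open>L2\<close> and does not pass to limits.\<close>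

inductive_set hermite_span :: "(real ^ 'd::finite \<Rightarrow> complex) set" where
  hermite: "hermite n \<in> hermite_span"
| scale: "f \<in> hermite_span \<Longrightarrow> (\<lambda>t. c * f t) \<in> hermite_span"
| add: "f \<in> hermite_span \<Longrightarrow> g \<in> hermite_span \<Longrightarrow> (\<lambda>t. f t + g t) \<in> hermite_span"

lemma hermite_span_closure: "f \<in> hermite_span \<Longrightarrow> f \<in> hermite_closure"
  by (induction rule: hermite_span.induct) (auto intro: hermite_closure_hermite hermite_closure_scale hermite_closure_add)

lemma hermite_span_sum:
  "finite I \<Longrightarrow> (\<And>i. i \<in> I \<Longrightarrow> f i \<in> hermite_span) \<Longrightarrow> (\<lambda>t. \<Sum>i\<in>I. f i t) \<in> hermite_span"
proof (induction I rule: finite_induct)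
  case empty
  show ?case using hermite_span.scale[OF hermite_span.hermite, of 0] by simp
qed (auto intro!: hermite_span.add)

text \<open>The recurrence \<open>hermite1_Suc\<close>, solved for t times
  \<open>hermite1 n t\<close>, is applied in the j-th factor; the other factors are
  untouched.\<close>

lemma hermite_span_nth:
  assumes "f \<in> hermite_span"
  shows "(\<lambda>t. of_real (t $ j) * f t) \<in> hermite_span"
  using assms
proof induction
  case (hermite n)
  define u where "u m = (\<chi> i. if i = j then m else n $ i)" for m
  have h: "hermite (u m) t = of_real (hermite1 m (t $ j)) * (\<Prod>i\<in>UNIV - {j}. of_real (hermite1 (n $ i) (t $ i)))" for m t
    unfolding hermite_def of_real_prod by (subst prod.remove[of _ j]) (auto simp: u_def intro!: prod.cong)
  have n: "u (n $ j) = n" by (auto simp: u_def vec_eq_iff)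
  have r: "t $ j * hermite1 (n $ j) (t $ j) = (sqrt (Suc (n $ j)) / (2 * sqrt pi)) * hermite1 (Suc (n $ j)) (t $ j) +
      (sqrt (n $ j) / (2 * sqrt pi)) * hermite1 (n $ j - 1) (t $ j)" for t :: "real^'a"
    using hermite1_Suc[of "n $ j" "t $ j"] by (simp add: field_simps del: of_nat_Suc)
  have "of_real (t $ j) * hermite n t = of_real (sqrt (Suc (n $ j)) / (2 * sqrt pi)) * hermite (u (Suc (n $ j))) t +
      of_real (sqrt (n $ j) / (2 * sqrt pi)) * hermite (u (n $ j - 1)) t" for t
  proof -
    have "of_real (t $ j) * hermite n t = of_real (t $ j * hermite1 (n $ j) (t $ j)) * (\<Prod>i\<in>UNIV - {j}. of_real (hermite1 (n $ i) (t $ i)))"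
      using h[of "n $ j" t] unfolding n by simp
    then show ?thesis unfolding r h by (simp add: algebra_simps del: of_nat_Suc)
  qed
  moreover have "(\<lambda>t. of_real (sqrt (Suc (n $ j)) / (2 * sqrt pi)) * hermite (u (Suc (n $ j))) t +
      of_real (sqrt (n $ j) / (2 * sqrt pi)) * hermite (u (n $ j - 1)) t) \<in> hermite_span"
    by (intro hermite_span.intros)
  ultimately show ?case by (simp del: of_nat_Suc)
next
  case (scale f c)
  then show ?case using hermite_span.scale[of "\<lambda>t. of_real (t $ j) * f t" c] by (simp add: mult_ac)
next
  case (add f g)
  then show ?case using hermite_span.add[of "\<lambda>t. of_real (t $ j) * f t" "\<lambda>t. of_real (t $ j) * g t"] by (simp add: distrib_left)
qed

lemma hermite_span_inner_power: "(\<lambda>t. of_real ((t \<bullet> \<xi>) ^ m) * hermite 0 t) \<in> hermite_span"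
proof (induction m)
  case 0
  show ?case by (simp add: hermite_span.hermite)
next
  case (Suc m)
  have "(\<lambda>t. \<Sum>j\<in>UNIV. of_real (\<xi> $ j) * (of_real (t $ j) * (of_real ((t \<bullet> \<xi>) ^ m) * hermite 0 t))) \<in> hermite_span"
    by (intro hermite_span_sum hermite_span.scale hermite_span_nth Suc) auto
  moreover have "(\<Sum>j\<in>UNIV. of_real (\<xi> $ j) * (of_real (t $ j) * (of_real ((t \<bullet> \<xi>) ^ m) * hermite 0 t))) = of_real ((t \<bullet> \<xi>) ^ Suc m) * hermite 0 t" for t
    by (simp add: inner_vec_def sum_distrib_left sum_distrib_right mult_ac)
  ultimately show ?case by simp
qed

text \<open>The partial sums of the exponential series are polynomials times the ground state, and
  exp (|\<xi>| |t|) times the ground state dominates them all.\<close>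

lemma hermite_closure_trig: "(\<lambda>t. exp (\<i> * of_real (t \<bullet> \<xi>)) * hermite 0 t) \<in> hermite_closure"
proof (rule hermite_closure_dominated)
  define p where "p M t = (\<Sum>m<M. (\<i> * of_real (t \<bullet> \<xi>)) ^ m /\<^sub>R fact m) * hermite 0 t" for M t
  show "p M \<in> hermite_closure" for M
  proof -
    have "(\<lambda>t. \<Sum>m<M. (\<i> ^ m / fact m) * (of_real ((t \<bullet> \<xi>) ^ m) * hermite 0 t)) \<in> hermite_closure"
      by (intro hermite_closure_sum hermite_closure_scale hermite_span_closure hermite_span_inner_power) auto
    moreover have "(\<Sum>m<M. (\<i> ^ m / fact m) * (of_real ((t \<bullet> \<xi>) ^ m) * hermite 0 t)) = p M t" for t
      unfolding p_def sum_distrib_right by (intro sum.cong refl) (simp add: power_mult_distrib scaleR_conv_of_real divide_simps)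
    ultimately show ?thesis by simp
  qed
  show "(\<lambda>M. p M t) \<longlonglongrightarrow> exp (\<i> * of_real (t \<bullet> \<xi>)) * hermite 0 t" for t
    unfolding p_def using exp_converges[of "\<i> * of_real (t \<bullet> \<xi>)"] unfolding sums_def by (intro tendsto_intros)
  show "integrable lborel (\<lambda>t. (exp (norm \<xi> * norm t) * cmod (hermite 0 t))\<^sup>2)"
    by (rule integrable_hermite_0_exp)
  show "cmod (p M t) \<le> exp (norm \<xi> * norm t) * cmod (hermite 0 t)" for M t
  proof -
    have s: "summable (\<lambda>m. \<bar>t \<bullet> \<xi>\<bar> ^ m /\<^sub>R fact m)" using exp_converges[of "\<bar>t \<bullet> \<xi>\<bar>"] by (rule sums_summable)
    have "cmod (\<Sum>m<M. (\<i> * of_real (t \<bullet> \<xi>)) ^ m /\<^sub>R fact m) \<le> (\<Sum>m<M. \<bar>t \<bullet> \<xi>\<bar> ^ m /\<^sub>R fact m)"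
      by (rule order_trans[OF norm_sum]) (auto intro!: sum_mono simp: norm_power norm_mult power_abs)
    also have "\<dots> \<le> exp \<bar>t \<bullet> \<xi>\<bar>"
      unfolding sums_unique[OF exp_converges[of "\<bar>t \<bullet> \<xi>\<bar>"]] by (rule sum_le_suminf[OF s]) auto
    also have "\<dots> \<le> exp (norm \<xi> * norm t)" using Cauchy_Schwarz_ineq2[of t \<xi>] by (simp add: mult.commute)
    finally show ?thesis unfolding p_def norm_mult by (intro mult_right_mono) auto
  qed
qed

text \<open>The functional monotone class of the characters; it is an algebra by the usual two-step induction.\<close>

inductive_set trig_limits :: "('a::euclidean_space \<Rightarrow> complex) set" where
  trig: "(\<lambda>t. exp (\<i> * of_real (t \<bullet> \<xi>))) \<in> trig_limits"
| scale: "f \<in> trig_limits \<Longrightarrow> (\<lambda>t. c * f t) \<in> trig_limits"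
| add: "f \<in> trig_limits \<Longrightarrow> g \<in> trig_limits \<Longrightarrow> (\<lambda>t. f t + g t) \<in> trig_limits"
| lim: "(\<And>m. f m \<in> trig_limits) \<Longrightarrow> (\<And>m t. cmod (f m t) \<le> B) \<Longrightarrow> (\<And>t. (\<lambda>m::nat. f m t) \<longlonglongrightarrow> g t) \<Longrightarrow> g \<in> trig_limits"

lemma trig_limits_bounded:
  assumes "f \<in> trig_limits"
  shows "\<exists>B. \<forall>t. cmod (f t) \<le> B"
  using assms
proof induction
  case (trig \<xi>)
  show ?case by (intro exI[of _ 1]) simp
next
  case (scale f c)
  then obtain B where "\<And>t. cmod (f t) \<le> B" by blast
  then show ?case by (intro exI[of _ "cmod c * B"]) (auto simp: norm_mult intro: mult_left_mono)
next
  case (add f g)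
  then obtain B D where "\<And>t. cmod (f t) \<le> B" "\<And>t. cmod (g t) \<le> D" by blast
  then show ?case by (intro exI[of _ "B + D"]) (auto intro: norm_triangle_mono)
next
  case (lim f B g)
  have "cmod (g t) \<le> B" for t
    by (rule LIMSEQ_le_const2[OF tendsto_norm[OF lim.hyps(3)[of t]]]) (use lim.hyps(2) in auto)
  then show ?case by blast
qed

text \<open>The bound \<open>B\<close> in the limit rule pays off here: uniformly bounded sequences
  become sequences dominated by \<open>B\<close> times the ground state, which is square
  integrable.\<close>

lemma trig_limits_closure:
  assumes "f \<in> trig_limits"
  shows "(\<lambda>t. f t * hermite 0 t) \<in> hermite_closure"
  using assms
proof induction
  case (trig \<xi>)
  show ?case by (rule hermite_closure_trig)
next
  case (scale f c)
  then show ?case using hermite_closure_scale[of "\<lambda>t. f t * hermite 0 t" c] by (simp add: mult.assoc)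
next
  case (add f g)
  then show ?case using hermite_closure_add[of "\<lambda>t. f t * hermite 0 t" "\<lambda>t. g t * hermite 0 t"] by (simp add: distrib_right)
next
  case (lim f B g)
  have "integrable lborel (\<lambda>t::real^'a. B\<^sup>2 * (exp (0 * norm t) * cmod (hermite 0 t))\<^sup>2)"
    by (intro integrable_mult_right integrable_hermite_0_exp)
  then have "integrable lborel (\<lambda>t::real^'a. (B * cmod (hermite 0 t))\<^sup>2)" by (simp add: power_mult_distrib)
  then show ?case
    by (rule hermite_closure_dominated[OF lim.IH, rotated]) (auto simp: norm_mult intro!: mult_right_mono lim.hyps tendsto_intros)
qed

lemma trig_limits_mult:
  assumes "f \<in> trig_limits" "g \<in> trig_limits"
  shows "(\<lambda>t. f t * g t) \<in> trig_limits"
proof -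
  have 1: "(\<lambda>t. f t * exp (\<i> * of_real (t \<bullet> \<xi>))) \<in> trig_limits" if "f \<in> trig_limits" for f and \<xi> :: 'a
    using that
  proof induction
    case (trig \<eta>)
    have "(\<lambda>t. exp (\<i> * of_real (t \<bullet> (\<eta> + \<xi>)))) \<in> trig_limits" by (rule trig_limits.trig)
    then show ?case by (simp add: inner_add_right exp_add[symmetric] distrib_left)
  next
    case (scale f c)
    then show ?case using trig_limits.scale[of "\<lambda>t. f t * exp (\<i> * of_real (t \<bullet> \<xi>))" c] by (simp add: mult.assoc)
  next
    case (add f g)
    then show ?case using trig_limits.add[OF add.IH] by (simp add: distrib_right)
  next
    case (lim f B g)
    show ?case by (rule trig_limits.lim[where B=B, OF lim.IH]) (auto simp: norm_mult intro!: lim.hyps tendsto_intros)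
  qed
  show ?thesis using assms(2)
  proof induction
    case (trig \<xi>)
    show ?case by (rule 1[OF assms(1)])
  next
    case (scale g c)
    then show ?case using trig_limits.scale[of "\<lambda>t. f t * g t" c] by (simp add: mult_ac)
  next
    case (add g h)
    then show ?case using trig_limits.add[OF add.IH] by (simp add: distrib_left)
  next
    case (lim g B h)
    obtain D where D: "\<And>t. cmod (f t) \<le> D" using trig_limits_bounded[OF assms(1)] by blast
    have "cmod (f t * g m t) \<le> \<bar>D\<bar> * \<bar>B\<bar>" for m t
      unfolding norm_mult using D[of t] lim.hyps(2)[of m t] by (intro mult_mono) auto
    then show ?case by (rule trig_limits.lim[OF lim.IH]) (auto intro!: lim.hyps tendsto_intros)
  qed
qed

lemma trig_limits_const: "(\<lambda>t. c) \<in> trig_limits"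
  using trig_limits.scale[OF trig_limits.trig[of 0], of c] by simp

lemma trig_limits_power: "f \<in> trig_limits \<Longrightarrow> (\<lambda>t. f t ^ n) \<in> trig_limits"
  by (induction n) (auto intro: trig_limits_const trig_limits_mult)

lemma trig_limits_sum: "finite I \<Longrightarrow> (\<And>i. i \<in> I \<Longrightarrow> f i \<in> trig_limits) \<Longrightarrow> (\<lambda>t. \<Sum>i\<in>I. f i t) \<in> trig_limits"
  by (induction I rule: finite_induct) (auto intro: trig_limits_const trig_limits.add)

text \<open>The Bernstein polynomials of \<open>g\<close> converge uniformly, and polynomials in
  \<open>r\<close> are available because the class is an algebra.\<close>

lemma trig_limits_continuous:
  fixes r :: "'a::euclidean_space \<Rightarrow> real"
  assumes r: "(\<lambda>t. of_real (r t)) \<in> trig_limits" "\<And>t. r t \<in> {0..1}" and g: "continuous_on {0..1} g"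
  shows "(\<lambda>t. of_real (g (r t))) \<in> trig_limits"
proof -
  define p where "p n x = (\<Sum>k\<le>n. g (k / n) * Bernstein n k x)" for n x
  have p: "(\<lambda>t. of_real (p n (r t))) \<in> trig_limits" for n
  proof -
    have "(\<lambda>t. \<Sum>k\<le>n. of_real (g (k / n) * (n choose k)) * (of_real (r t) ^ k * (1 + (-1) * of_real (r t)) ^ (n - k))) \<in> trig_limits"
      by (intro trig_limits_sum trig_limits.scale trig_limits_mult trig_limits_power trig_limits.add trig_limits_const r) auto
    then show ?thesis by (simp add: p_def Bernstein_def mult_ac)
  qed
  have "\<exists>N. \<forall>n\<ge>N. \<forall>x\<in>{0..1}. \<bar>g x - p n x\<bar> < e" if "e > 0" for e
    using Bernstein_Weierstrass[OF g that] unfolding p_def by blast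
  then have l: "\<exists>N. \<forall>n\<ge>N. \<forall>t. \<bar>g (r t) - p n (r t)\<bar> < e" if "e > 0" for e
    using that r(2) by meson
  obtain N where N: "\<And>n t. n \<ge> N \<Longrightarrow> \<bar>g (r t) - p n (r t)\<bar> < 1" using l[of 1] by auto
  have "compact (g ` {0..1})" by (intro compact_continuous_image g) auto
  then have "\<exists>B. \<forall>x\<in>{0..1}. \<bar>g x\<bar> \<le> B"
    using compact_imp_bounded[of "g ` {0..1}"] unfolding bounded_iff by auto
  then obtain B where B: "\<And>x. x \<in> {0..1} \<Longrightarrow> \<bar>g x\<bar> \<le> B" by blast
  show ?thesis
  \<comment> \<open>Dropping the first \<open>N\<close> terms gives the uniform bound that the limit
    rule demands; B + 1 comes from accuracy 1 beyond \<open>N\<close>.\<close>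
  proof (rule trig_limits.lim[of "\<lambda>n t. of_real (p (n + N) (r t))" "B + 1"])
    show "cmod (of_real (p (n + N) (r t))) \<le> B + 1" for n t
      using N[of "n + N" t] B[OF r(2)[of t]] by simp
    show "(\<lambda>n. complex_of_real (p (n + N) (r t))) \<longlonglongrightarrow> of_real (g (r t))" for t
    proof (intro tendsto_of_real LIMSEQ_ignore_initial_segment LIMSEQ_I)
      fix e :: real assume "e > 0"
      then show "\<exists>no. \<forall>n\<ge>no. norm (p n (r t) - g (r t)) < e"
        using l[of e] by (metis abs_minus_commute real_norm_def)
    qed
  qed (rule p)
qed

text \<open>The indicator of a half-space is not periodic, so the period is stretched with m. With s
  = t \<bullet> b - a and M = m + 1, the function \<open>g m (r m t)\<close> is M^2 sin (s / M)
  clamped to [0, 1]. For large M this sine term behaves like M s, so the limit is 1 for s > 0 and 0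
  for s \<le> 0, in accordance with the strict inequality.\<close>

lemma trig_limits_halfspace: "(\<lambda>t. indicator {t. a < t \<bullet> b} t) \<in> (trig_limits :: ('a::euclidean_space \<Rightarrow> complex) set)"
proof -
  define r where "r m t = (1 + sin ((t \<bullet> b - a) / real (Suc m))) / 2" for m and t :: 'a
  define g where "g m y = min 1 (max 0 ((real (Suc m))\<^sup>2 * (2 * y - 1)))" for m and y :: real
  have r01: "r m t \<in> {0..1}" for m t
  proof -
    define s where "s = sin ((t \<bullet> b - a) / real (Suc m))"
    have "- 1 \<le> s" "s \<le> 1" by (simp_all add: s_def del: of_nat_Suc)
    then show ?thesis unfolding r_def s_def[symmetric] by simp
  qed
  have "(\<lambda>t. of_real (r m t)) \<in> trig_limits" for m
  proof -
    define \<xi> where "\<xi> = (1 / real (Suc m)) *\<^sub>R b"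
    define \<alpha> where "\<alpha> = a / real (Suc m)"
    have e: "(t \<bullet> b - a) / real (Suc m) = t \<bullet> \<xi> - \<alpha>" for t
      by (simp add: \<xi>_def \<alpha>_def diff_divide_distrib del: of_nat_Suc)
    have sn: "complex_of_real (sin x) = (exp (\<i> * of_real x) - exp (- (\<i> * of_real x))) / (2 * \<i>)" for x
      by (simp only: sin_of_real[symmetric] sin_exp_eq)
    have "complex_of_real (r m t) = 1 / 2 + (exp (- (\<i> * \<alpha>)) / (4 * \<i>)) * exp (\<i> * of_real (t \<bullet> \<xi>))
       + (- exp (\<i> * \<alpha>) / (4 * \<i>)) * exp (\<i> * of_real (t \<bullet> (- \<xi>)))" for t
    proof -
      have 1: "exp (\<i> * of_real (t \<bullet> \<xi> - \<alpha>)) = exp (- (\<i> * \<alpha>)) * exp (\<i> * of_real (t \<bullet> \<xi>))"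
        unfolding exp_add[symmetric] by (rule arg_cong[where f=exp]) (simp add: algebra_simps)
      have 2: "exp (- (\<i> * of_real (t \<bullet> \<xi> - \<alpha>))) = exp (\<i> * \<alpha>) * exp (\<i> * of_real (t \<bullet> (- \<xi>)))"
        unfolding exp_add[symmetric] by (rule arg_cong[where f=exp]) (simp add: algebra_simps)
      have "complex_of_real (r m t) = 1 / 2 + complex_of_real (sin (t \<bullet> \<xi> - \<alpha>)) / 2"
        unfolding r_def e by (simp add: add_divide_distrib)
      also have "complex_of_real (sin (t \<bullet> \<xi> - \<alpha>)) / 2 =
         (exp (- (\<i> * \<alpha>)) / (4 * \<i>)) * exp (\<i> * of_real (t \<bullet> \<xi>)) + (- exp (\<i> * \<alpha>) / (4 * \<i>)) * exp (\<i> * of_real (t \<bullet> (- \<xi>)))"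
        unfolding sn 1 2 by (simp only: diff_divide_distrib) (simp add: mult.assoc)
      finally show ?thesis by (simp only: add.assoc)
    qed
    then show ?thesis by (simp only:) (intro trig_limits.add trig_limits.scale trig_limits_const trig_limits.trig)
  qed
  then have "(\<lambda>t. of_real (g m (r m t))) \<in> trig_limits" for m
    by (rule trig_limits_continuous[OF _ r01]) (auto simp: g_def intro!: continuous_intros)
  then show ?thesis
  proof (rule trig_limits.lim[where B=1])
    show "cmod (of_real (g m (r m t))) \<le> 1" for m t by (simp add: g_def)
    show "(\<lambda>m. complex_of_real (g m (r m t))) \<longlonglongrightarrow> indicator {t. a < t \<bullet> b} t" for t
    proof -
      have gr: "g m (r m t) = min 1 (max 0 ((real (Suc m))\<^sup>2 * sin ((t \<bullet> b - a) / real (Suc m))))" for m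
        by (simp add: g_def r_def field_simps del: of_nat_Suc)
      show ?thesis
      proof (cases "t \<bullet> b - a > 0")
        case True
        then have "eventually (\<lambda>m. 1 \<le> (real (Suc m))\<^sup>2 * sin ((t \<bullet> b - a) / real (Suc m))) sequentially"
          by real_asymp
        then have "eventually (\<lambda>m. complex_of_real (g m (r m t)) = 1) sequentially"
          by eventually_elim (simp add: gr del: of_nat_Suc)
        then show ?thesis using True by (simp add: tendsto_eventually)
      next
        case False
        then have "eventually (\<lambda>m. (real (Suc m))\<^sup>2 * sin ((t \<bullet> b - a) / real (Suc m)) \<le> 0) sequentially"
        proof (cases "t \<bullet> b - a = 0")
          case False
          with \<open>\<not> t \<bullet> b - a > 0\<close> have "t \<bullet> b - a < 0" by simp
          then show ?thesis by real_asymp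
        qed simp
        then have "eventually (\<lambda>m. complex_of_real (g m (r m t)) = 0) sequentially"
          by eventually_elim (simp add: gr del: of_nat_Suc)
        then show ?thesis using False by (simp add: tendsto_eventually)
      qed
    qed
  qed
qed

text \<open>Induction over the sigma-algebra generated by half-spaces. Since the unions need not be
  disjoint, finite unions are formed by inclusion-exclusion, which uses products, and countable
  unions are bounded limits of them.\<close>

lemma trig_limits_indicator:
  fixes A :: "'a::euclidean_space set"
  assumes "A \<in> sets borel"
  shows "indicator A \<in> (trig_limits :: ('a \<Rightarrow> complex) set)"
proof -
  have "A \<in> sigma_sets UNIV ((\<lambda>(a, i). {x::'a. a < x \<bullet> i}) ` (UNIV \<times> Basis))"
    using assms unfolding borel_eq_halfspace_greater by simp
  then show ?thesis
  proof induction
    case (Basic A)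
    then show ?case using trig_limits_halfspace by auto
  next
    case Empty
    show ?case using trig_limits_const[of 0] by (simp add: indicator_def[abs_def])
  next
    case (Compl A)
    have "(\<lambda>t. 1 + (-1) * indicator A t) \<in> trig_limits"
      by (intro trig_limits.add trig_limits.scale trig_limits_const Compl.IH)
    moreover have "indicator (UNIV - A) = (\<lambda>t. 1 + (-1) * indicator A t :: complex)"
      by (auto simp: indicator_def fun_eq_iff)
    ultimately show ?case by simp
  next
    case (Union A)
    have fin: "indicator (\<Union>i<n. A i) \<in> (trig_limits :: ('a \<Rightarrow> complex) set)" for n :: nat
    proof (induction n)
      case 0
      show ?case using trig_limits_const[of 0] by (simp add: indicator_def[abs_def])
    next
      case (Suc n)
      have "(\<lambda>t. (indicator (\<Union>i<n. A i) t + indicator (A n) t) + (-1) * (indicator (\<Union>i<n. A i) t * indicator (A n) t)) \<in> (trig_limits :: ('a \<Rightarrow> complex) set)"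
        by (intro trig_limits.add trig_limits.scale trig_limits_mult Suc Union.IH)
      moreover have "indicator (\<Union>i<Suc n. A i) = (\<lambda>t. (indicator (\<Union>i<n. A i) t + indicator (A n) t) + (-1) * (indicator (\<Union>i<n. A i) t * indicator (A n) t) :: complex)"
        by (auto simp: indicator_def fun_eq_iff less_Suc_eq)
      ultimately show ?case by simp
    qed
    show ?case
    proof (rule trig_limits.lim[OF fin, where B=1])
      show "(\<lambda>n. indicator (\<Union>i<n. A i) t) \<longlonglongrightarrow> (indicator (\<Union>i. A i) t :: complex)" for t
        by (rule LIMSEQ_indicator_UN)
    qed (simp add: indicator_def)
  qed
qed

lemma trig_limits_simple:
  fixes f :: "'a::euclidean_space \<Rightarrow> complex"
  assumes "simple_function borel f"
  shows "f \<in> trig_limits"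
proof -
  define w where "w y t = y * indicator (f -` {y}) t" for y t
  have fin: "finite (range f)" and sets: "\<And>y. y \<in> range f \<Longrightarrow> f -` {y} \<in> sets borel"
    using assms unfolding simple_function_def by auto
  have w: "w y \<in> trig_limits" if "y \<in> range f" for y
    unfolding w_def by (rule trig_limits.scale[OF trig_limits_indicator[OF sets[OF that]]])
  have sum: "(\<lambda>t. \<Sum>y\<in>range f. w y t) \<in> trig_limits"
    by (rule trig_limits_sum[OF fin]) (rule w)
  have "f t = (\<Sum>y\<in>range f. w y t)" for t
  proof -
    have "f t = (\<Sum>y\<in>range f. indicator (f -` {y}) t *\<^sub>R y)"
      using simple_function_indicator_representation_banach[OF assms, of t]
      unfolding space_borel Int_UNIV_right by blast
    also have "\<dots> = (\<Sum>y\<in>range f. w y t)"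
      by (intro sum.cong refl) (simp add: indicator_def w_def)
    finally show ?thesis .
  qed
  then have "f = (\<lambda>t. \<Sum>y\<in>range f. w y t)" by (rule ext)
  with sum show ?thesis by (rule back_subst[of "\<lambda>x. x \<in> trig_limits", OF _ sym])
qed

text \<open>Division by the positive ground state may produce an unbounded \<open>q\<close>, but
  simple functions with |s i| \<le> 2 |q| converge to it. Multiplied by the ground state, they are
  dominated by 2 |f|, which is square integrable.\<close>

lemma hermite_complete: "f \<in> L2 \<Longrightarrow> f \<in> hermite_closure" for f :: "real ^ 'd::finite \<Rightarrow> complex"
proof -
  assume f: "f \<in> L2"
  have [measurable]: "f \<in> borel_measurable borel" using f by (rule L2_measurable)
  define q where "q t = f t / hermite 0 t" for t
  have nz: "hermite 0 t \<noteq> 0" for t :: "real^'d" using hermite_0_pos[of t] by auto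
  have "q \<in> borel_measurable borel" unfolding q_def by measurable
  from borel_measurable_implies_sequence_metric[OF this, of 0] obtain s where
    s0: "\<forall>i. simple_function borel (s i)" "\<forall>t\<in>space borel. (\<lambda>i. s i t) \<longlonglongrightarrow> q t"
      "\<forall>i. \<forall>t\<in>space borel. dist (s i t) 0 \<le> 2 * dist (q t) 0"
    by (elim exE conjE)
  have s: "simple_function borel (s i)" "(\<lambda>i. s i t) \<longlonglongrightarrow> q t" "cmod (s i t) \<le> 2 * cmod (q t)" for i t
    using s0 by simp_all
  have st: "s i \<in> trig_limits" for i
    by (rule trig_limits_simple[OF s(1)])
  show "f \<in> hermite_closure"
  proof (rule hermite_closure_dominated[OF trig_limits_closure[OF st]])
    show "(\<lambda>i. s i t * hermite 0 t) \<longlonglongrightarrow> f t" for t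
    proof -
      have "(\<lambda>i. s i t * hermite 0 t) \<longlonglongrightarrow> q t * hermite 0 t" by (intro tendsto_intros s)
      then show ?thesis using nz[of t] by (simp add: q_def)
    qed
    show "integrable lborel (\<lambda>t. (2 * cmod (f t))\<^sup>2)"
      using f by (simp add: L2_def power_mult_distrib)
    show "cmod (s i t * hermite 0 t) \<le> 2 * cmod (f t)" for i t
    proof -
      have "cmod (s i t) * cmod (hermite 0 t) \<le> 2 * cmod (q t) * cmod (hermite 0 t)"
        by (intro mult_right_mono s) auto
      then show ?thesis using nz[of t] by (simp add: q_def norm_mult norm_divide)
    qed
  qed
qed

section \<open>Orthonormality\<close>

lemma hstft_poly_0: "hstft_poly n k 0 = (if n = k then 1 else 0)"
proof -
  have "hstft_poly n k 0 = (\<Sum>j\<in>{k}. of_nat (n choose j) * cnj 0 ^ (n - j) * (- 0) ^ (k - j) / fact (k - j))"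
    unfolding hstft_poly_def by (rule sum.mono_neutral_right) (auto simp: power_0_left)
  then show ?thesis by (auto simp: power_0_left)
qed

lemma hstft_origin: "hstft n k (0, 0) = (if n = k then 1 else 0)"
proof -
  have z: "of_real (sqrt pi) * Complex 0 0 = 0" by (simp add: complex_eq_iff)
  show ?thesis unfolding hstft_eq z hstft_poly_0 by (simp add: chirp_gauss_def)
qed

text \<open>The inner product is the value of the transform at the origin, where only the constant
  term of \<open>hstft_poly\<close> survives.\<close>

lemma hermite_orthonormal: "L2_inner (hermite n) (hermite m) = (if n = m then 1 else 0)" for n m :: "nat ^ 'd::finite"
proof -
  have "tf_shift (0, 0) (hermite m) = hermite m" by (simp add: tf_shift_def fun_eq_iff)
  then have "L2_inner (hermite n) (hermite m) = stft (hermite m) (hermite n) (0, 0)"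
    by (simp add: stft_def)
  also have "\<dots> = (\<Prod>j\<in>UNIV. if n $ j = m $ j then 1 else 0)"
    by (simp add: stft_hermite hstft_origin)
  also have "\<dots> = (if n = m then 1 else 0)" by (auto simp: vec_eq_iff)
  finally show ?thesis .
qed

lemma hermite_orthonormal_basis: "orthonormal_basis_L2 (hermite :: nat ^ 'd \<Rightarrow> real ^ 'd::finite \<Rightarrow> complex)"
  unfolding orthonormal_basis_L2_def
proof (intro conjI allI ballI impI)
  fix f :: "real ^ 'd \<Rightarrow> complex" and \<epsilon> :: real
  assume "f \<in> L2" "\<epsilon> > 0"
  then show "\<exists>I a. finite I \<and> (LINT t|lborel. (cmod (f t - (\<Sum>i\<in>I. a i * hermite i t)))\<^sup>2) < \<epsilon>"
    using hermite_complete[of f] unfolding hermite_closure_def L2_dist2_def hermite_sum_def by blast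
qed (auto simp: hermite_L2 hermite_orthonormal)

section \<open>Matrix entries of the localization operator\<close>

text \<open>This is the argument of \<open>hstft_poly\<close> in \<open>hstft_eq\<close>. Its
  squared modulus is u_j = pi |z_j|^2, the variable of the Laguerre polynomials.\<close>

definition phase_point :: "'d \<Rightarrow> 'd::finite phase \<Rightarrow> complex" where
  "phase_point j z = of_real (sqrt pi) * Complex (fst z $ j) (snd z $ j)"

abbreviation phase_gauss :: "'d::finite phase \<Rightarrow> complex" where
  "phase_gauss \<equiv> shifted_gauss (0, 0)"

lemma phase_gauss_eq: "phase_gauss z = (\<Prod>j\<in>UNIV. of_real (exp (- (cmod (phase_point j z))\<^sup>2)))"
  by (simp add: shifted_gauss_phase phase_point_def norm_mult cmod_def power_mult_distrib distrib_left exp_add[symmetric] of_real_mult[symmetric] del: of_real_mult)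

text \<open>The chirp phases of the two transforms cancel and their moduli multiply to exp (-
  |w|^2), which leaves a polynomial times a real Gaussian.\<close>

lemma hstft_cnj_hstft:
  "hstft n k (fst z $ j, snd z $ j) * cnj (hstft m k (fst z $ j, snd z $ j)) =
     of_real (sqrt (fact k / fact n) * sqrt (fact k / fact m)) *
     (hstft_poly n k (phase_point j z) * cnj (hstft_poly m k (phase_point j z))) * of_real (exp (- (cmod (phase_point j z))\<^sup>2))"
proof -
  have "chirp_gauss p * cnj (chirp_gauss p) = of_real (exp (- pi * (norm p)\<^sup>2))" for p
  proof -
    have "chirp_gauss p * cnj (chirp_gauss p) = of_real ((cmod (chirp_gauss p))\<^sup>2)"
      by (simp add: complex_mult_cnj cmod_power2)
    then show ?thesis unfolding norm_chirp_gauss exp_double[symmetric] by simp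
  qed
  then have c: "chirp_gauss (fst z $ j, snd z $ j) * cnj (chirp_gauss (fst z $ j, snd z $ j)) = of_real (exp (- (cmod (phase_point j z))\<^sup>2))"
    by (simp add: phase_point_def norm_mult power_mult_distrib cmod_def norm_Pair algebra_simps)
  show ?thesis unfolding hstft_eq phase_point_def[symmetric] c[symmetric] by (simp add: mult_ac)
qed

lemma feature_hermite:
  "feature n k (hermite m) z = of_real (\<Prod>j\<in>UNIV. sqrt (fact (k $ j) / fact (n $ j)) * sqrt (fact (k $ j) / fact (m $ j))) *
     ((\<Prod>j\<in>UNIV. hstft_poly (n $ j) (k $ j) (phase_point j z) * cnj (hstft_poly (m $ j) (k $ j) (phase_point j z))) * phase_gauss z)"
  unfolding feature_def stft_hermite cnj_prod prod.distrib[symmetric] hstft_cnj_hstft phase_gauss_eq of_real_prod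
  by (simp only: mult.assoc)

lemma poly_times_phase_point:
  assumes "f \<in> poly_times E"
  shows "(\<lambda>z. phase_point j z * f z) \<in> poly_times E" "(\<lambda>z. cnj (phase_point j z) * f z) \<in> poly_times E"
proof -
  have c: "(\<lambda>z. of_real (fst z $ j) * f z) \<in> poly_times E" "(\<lambda>z. of_real (snd z $ j) * f z) \<in> poly_times E"
    using poly_times.coord[OF assms, of "(axis j 1, 0)"] poly_times.coord[OF assms, of "(0, axis j 1)"]
    by (simp_all add: inner_prod_def inner_axis)
  have "(\<lambda>z. of_real (sqrt pi) * (of_real (fst z $ j) * f z) + (of_real (sqrt pi) * \<i>) * (of_real (snd z $ j) * f z)) \<in> poly_times E"
    "(\<lambda>z. of_real (sqrt pi) * (of_real (fst z $ j) * f z) + (of_real (sqrt pi) * - \<i>) * (of_real (snd z $ j) * f z)) \<in> poly_times E"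
    by (intro poly_times.add poly_times.scale c)+
  moreover have "phase_point j z * f z = of_real (sqrt pi) * (of_real (fst z $ j) * f z) + (of_real (sqrt pi) * \<i>) * (of_real (snd z $ j) * f z)"
    "cnj (phase_point j z) * f z = of_real (sqrt pi) * (of_real (fst z $ j) * f z) + (of_real (sqrt pi) * - \<i>) * (of_real (snd z $ j) * f z)" for z
    by (simp_all add: phase_point_def Complex_eq algebra_simps)
  ultimately show "(\<lambda>z. phase_point j z * f z) \<in> poly_times E" "(\<lambda>z. cnj (phase_point j z) * f z) \<in> poly_times E"
    by simp_all
qed

lemma poly_times_phase_point_power:
  assumes "f \<in> poly_times E"
  shows "(\<lambda>z. phase_point j z ^ a * f z) \<in> poly_times E" "(\<lambda>z. cnj (phase_point j z) ^ a * f z) \<in> poly_times E"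
proof -
  show "(\<lambda>z. phase_point j z ^ a * f z) \<in> poly_times E"
    by (induction a) (use assms poly_times_phase_point(1) in \<open>auto simp: mult.assoc\<close>)
  show "(\<lambda>z. cnj (phase_point j z) ^ a * f z) \<in> poly_times E"
    by (induction a) (use assms poly_times_phase_point(2) in \<open>auto simp: mult.assoc\<close>)
qed

lemma poly_times_hstft_poly:
  assumes f: "f \<in> poly_times E"
  shows "(\<lambda>z. hstft_poly n k (phase_point j z) * f z) \<in> poly_times E"
    and "(\<lambda>z. cnj (hstft_poly n k (phase_point j z)) * f z) \<in> poly_times E"
proof -
  have "(\<lambda>z. \<Sum>i\<le>k. (of_nat (n choose i) * (-1) ^ (k - i) / fact (k - i)) * (cnj (phase_point j z) ^ (n - i) * (phase_point j z ^ (k - i) * f z))) \<in> poly_times E"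
    by (intro poly_times_sum poly_times.scale poly_times_phase_point_power f)
  moreover have "hstft_poly n k (phase_point j z) * f z = (\<Sum>i\<le>k. (of_nat (n choose i) * (-1) ^ (k - i) / fact (k - i)) * (cnj (phase_point j z) ^ (n - i) * (phase_point j z ^ (k - i) * f z)))" for z
    unfolding hstft_poly_def sum_distrib_right by (intro sum.cong refl) (simp add: power_minus[of "phase_point j z"])
  ultimately show "(\<lambda>z. hstft_poly n k (phase_point j z) * f z) \<in> poly_times E" by simp
  have "(\<lambda>z. \<Sum>i\<le>k. (of_nat (n choose i) * (-1) ^ (k - i) / fact (k - i)) * (phase_point j z ^ (n - i) * (cnj (phase_point j z) ^ (k - i) * f z))) \<in> poly_times E"
    by (intro poly_times_sum poly_times.scale poly_times_phase_point_power f)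
  moreover have "cnj (hstft_poly n k (phase_point j z)) * f z = (\<Sum>i\<le>k. (of_nat (n choose i) * (-1) ^ (k - i) / fact (k - i)) * (phase_point j z ^ (n - i) * (cnj (phase_point j z) ^ (k - i) * f z)))" for z
    unfolding hstft_poly_def cnj_sum sum_distrib_right by (intro sum.cong refl) (simp add: power_minus[of "cnj (phase_point j z)"])
  ultimately show "(\<lambda>z. cnj (hstft_poly n k (phase_point j z)) * f z) \<in> poly_times E" by simp
qed

text \<open>Required because rotation invariance of a distribution, and its representation by a
  function, are tested on Schwartz functions only.\<close>

lemma feature_hermite_schwartz: "feature n k (hermite m) \<in> schwartz"
proof -
  have "(\<lambda>z. (\<Prod>j\<in>J. hstft_poly (n $ j) (k $ j) (phase_point j z) * cnj (hstft_poly (m $ j) (k $ j) (phase_point j z))) * phase_gauss z) \<in> poly_times phase_gauss"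
    if "finite J" for J
    using that
  proof (induction J rule: finite_induct)
    case empty
    show ?case by (simp add: poly_times.base)
  next
    case (insert i J)
    from poly_times_hstft_poly(1)[OF poly_times_hstft_poly(2)[OF insert.IH]] show ?case
      using insert.hyps by (simp add: mult.assoc)
  qed
  from poly_times.scale[OF this[of UNIV]] have "feature n k (hermite m) \<in> poly_times phase_gauss"
    unfolding feature_hermite[abs_def] by simp
  then show ?thesis by (rule poly_times_schwartz[OF _ shifted_gauss_closed shifted_gauss_bounded])
qed

section \<open>Rotations of the coordinates\<close>

lemma phase_point_rotate: "phase_point j (rotate_phase \<theta> z) = cis (\<theta> $ j) * phase_point j z"
  by (cases z) (simp add: phase_point_def rotate_phase_def complex_eq_iff algebra_simps)

text \<open>Every monomial contains k - j factors w and n - j factors \<open>cnj w\<close>, so its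
  phase depends on the difference k - n only. Terms with j > n carry a vanishing binomial
  coefficient, so truncated subtraction does no harm.\<close>

lemma hstft_poly_rotate: "hstft_poly n k (cis \<theta> * w) = cis (\<theta> * (real k - real n)) * hstft_poly n k w"
  unfolding hstft_poly_def sum_distrib_left
proof (intro sum.cong refl)
  fix j assume j: "j \<in> {..k}"
  show "of_nat (n choose j) * cnj (cis \<theta> * w) ^ (n - j) * (- (cis \<theta> * w)) ^ (k - j) / fact (k - j) =
    cis (\<theta> * (real k - real n)) * (of_nat (n choose j) * cnj w ^ (n - j) * (- w) ^ (k - j) / fact (k - j))"
  proof (cases "j \<le> n")
    case True
    have "cnj (cis \<theta> * w) ^ (n - j) * (- (cis \<theta> * w)) ^ (k - j) = (cis (- \<theta>) ^ (n - j) * cis \<theta> ^ (k - j)) * (cnj w ^ (n - j) * (- w) ^ (k - j))"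
      unfolding mult_minus_right[symmetric] complex_cnj_mult cis_cnj power_mult_distrib by (simp only: mult_ac)
    also have "cis (- \<theta>) ^ (n - j) * cis \<theta> ^ (k - j) = cis (\<theta> * (real k - real n))"
    proof -
      have "real (n - j) * - \<theta> + real (k - j) * \<theta> = \<theta> * (real k - real n)"
        using True j by (simp add: of_nat_diff algebra_simps)
      then show ?thesis by (simp only: Complex.DeMoivre cis_mult)
    qed
    finally show ?thesis by (simp add: mult_ac)
  qed (simp add: binomial_eq_0)
qed

lemma feature_hermite_rotate:
  "feature n k (hermite m) (rotate_phase \<theta> z) = (\<Prod>j\<in>UNIV. cis (\<theta> $ j * (real (m $ j) - real (n $ j)))) * feature n k (hermite m) z"
proof -
  have g: "phase_gauss (rotate_phase \<theta> z) = phase_gauss z"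
    unfolding phase_gauss_eq phase_point_rotate by (simp add: norm_mult)
  have "(\<Prod>j\<in>UNIV. hstft_poly (n $ j) (k $ j) (phase_point j (rotate_phase \<theta> z)) * cnj (hstft_poly (m $ j) (k $ j) (phase_point j (rotate_phase \<theta> z)))) =
    (\<Prod>j\<in>UNIV. cis (\<theta> $ j * (real (m $ j) - real (n $ j))) * (hstft_poly (n $ j) (k $ j) (phase_point j z) * cnj (hstft_poly (m $ j) (k $ j) (phase_point j z))))"
  proof (intro prod.cong refl)
    fix j
    let ?a = "hstft_poly (n $ j) (k $ j) (phase_point j z)" and ?b = "hstft_poly (m $ j) (k $ j) (phase_point j z)"
    have e: "cis (\<theta> $ j * (real (k $ j) - real (n $ j))) * cnj (cis (\<theta> $ j * (real (k $ j) - real (m $ j)))) = cis (\<theta> $ j * (real (m $ j) - real (n $ j)))"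
      unfolding cis_cnj cis_mult by (intro arg_cong[where f=cis]) (simp add: algebra_simps)
    show "hstft_poly (n $ j) (k $ j) (phase_point j (rotate_phase \<theta> z)) * cnj (hstft_poly (m $ j) (k $ j) (phase_point j (rotate_phase \<theta> z))) =
      cis (\<theta> $ j * (real (m $ j) - real (n $ j))) * (?a * cnj ?b)"
      unfolding phase_point_rotate hstft_poly_rotate complex_cnj_mult e[symmetric] by (simp only: mult_ac)
  qed
  then show ?thesis unfolding feature_hermite g prod.distrib by (simp only: mult_ac)
qed

section \<open>Identification with Laguerre polynomials\<close>

lemma hstft_poly_laguerre_le:
  assumes "k \<le> n"
  shows "hstft_poly n k w = cnj w ^ (n - k) * of_real (laguerre k (real n - real k) ((cmod w)\<^sup>2))"
proof -
  have w: "cnj w * (- w) = of_real (- (cmod w)\<^sup>2)"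
    by (simp only: mult_minus_right mult.commute[of "cnj w"] complex_norm_square of_real_minus)
  \<comment> \<open>Summing from the top, j = k - i, splits off the common power of
    \<open>cnj w\<close> and leaves ascending powers of |w|^2.\<close>
  have "hstft_poly n k w = (\<Sum>i\<le>k. of_nat (n choose (k - i)) * cnj w ^ (n - (k - i)) * (- w) ^ (k - (k - i)) / fact (k - (k - i)))"
    unfolding hstft_poly_def by (rule sum.nat_diff_reindex[of _ "Suc k", simplified lessThan_Suc_atMost, simplified, symmetric])
  also have "\<dots> = (\<Sum>i\<le>k. cnj w ^ (n - k) * of_real ((- 1) ^ i * (real n gchoose (k - i)) * ((cmod w)\<^sup>2) ^ i / fact i))"
  proof (intro sum.cong refl)
    fix i assume i: "i \<in> {..k}"
    then have e: "n - (k - i) = (n - k) + i" "k - (k - i) = i" using assms by auto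
    have p: "cnj w ^ i * (- w) ^ i = of_real ((- 1) ^ i * ((cmod w)\<^sup>2) ^ i)"
      unfolding power_mult_distrib[symmetric] w of_real_power[symmetric] by simp
    have "of_nat (n choose (k - i)) * cnj w ^ (n - (k - i)) * (- w) ^ (k - (k - i)) / fact (k - (k - i)) =
      cnj w ^ (n - k) * (of_nat (n choose (k - i)) * (cnj w ^ i * (- w) ^ i) / fact i)"
      unfolding e power_add by (simp add: mult_ac)
    also have "\<dots> = cnj w ^ (n - k) * of_real ((- 1) ^ i * (real n gchoose (k - i)) * ((cmod w)\<^sup>2) ^ i / fact i)"
      unfolding p by (simp add: binomial_gbinomial[symmetric] mult_ac)
    finally show "of_nat (n choose (k - i)) * cnj w ^ (n - (k - i)) * (- w) ^ (k - (k - i)) / fact (k - (k - i)) =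
      cnj w ^ (n - k) * of_real ((- 1) ^ i * (real n gchoose (k - i)) * ((cmod w)\<^sup>2) ^ i / fact i)" .
  qed
  finally show ?thesis by (simp only: laguerre_def sum_distrib_left of_real_sum) simp
qed

text \<open>For n < k the sum effectively stops at n, and the surplus power belongs to - w. The
  roles of n and k are exchanged, as in the reflection identity.\<close>

lemma hstft_poly_laguerre_gt:
  assumes "n < k"
  shows "hstft_poly n k w = (- w) ^ (k - n) * of_real (fact n / fact k * laguerre n (real k - real n) ((cmod w)\<^sup>2))"
proof -
  have w: "cnj w * (- w) = of_real (- (cmod w)\<^sup>2)"
    by (simp only: mult_minus_right mult.commute[of "cnj w"] complex_norm_square of_real_minus)
  have "hstft_poly n k w = (\<Sum>j\<le>n. of_nat (n choose j) * cnj w ^ (n - j) * (- w) ^ (k - j) / fact (k - j))"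
    unfolding hstft_poly_def using assms by (intro sum.mono_neutral_right) (auto simp: binomial_eq_0)
  also have "\<dots> = (\<Sum>i\<le>n. of_nat (n choose (n - i)) * cnj w ^ (n - (n - i)) * (- w) ^ (k - (n - i)) / fact (k - (n - i)))"
    by (rule sum.nat_diff_reindex[of _ "Suc n", simplified lessThan_Suc_atMost, simplified, symmetric])
  also have "\<dots> = (\<Sum>i\<le>n. (- w) ^ (k - n) * of_real (fact n / fact k * ((- 1) ^ i * (real k gchoose (n - i)) * ((cmod w)\<^sup>2) ^ i / fact i)))"
  proof (intro sum.cong refl)
    fix i assume i: "i \<in> {..n}"
    then have e: "n - (n - i) = i" "k - (n - i) = (k - n) + i" using assms by auto
    have p: "cnj w ^ i * (- w) ^ i = of_real ((- 1) ^ i * ((cmod w)\<^sup>2) ^ i)"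
      unfolding power_mult_distrib[symmetric] w of_real_power[symmetric] by simp
    \<comment> \<open>This replaces the binomial coefficient of n by the one of k, at the price of
      the factor n! / k!.\<close>
    have b: "real (n choose (n - i)) / fact ((k - n) + i) = fact n / fact k * (real (k choose (n - i)) / fact i)"
    proof -
      have "real (n choose (n - i)) = fact n / (fact (n - i) * fact i)"
        using binomial_fact[of "n - i" n, where 'a=real] unfolding e(1) by simp
      moreover have "real (k choose (n - i)) = fact k / (fact (n - i) * fact ((k - n) + i))"
        using binomial_fact[of "n - i" k, where 'a=real] assms unfolding e(2) by simp
      ultimately show ?thesis by simp
    qed
    have "of_nat (n choose (n - i)) * cnj w ^ (n - (n - i)) * (- w) ^ (k - (n - i)) / fact (k - (n - i)) =
      (- w) ^ (k - n) * (of_real (real (n choose (n - i)) / fact ((k - n) + i)) * (cnj w ^ i * (- w) ^ i))"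
      unfolding e power_add by (simp add: mult_ac)
    also have "\<dots> = (- w) ^ (k - n) * of_real (fact n / fact k * ((- 1) ^ i * (real k gchoose (n - i)) * ((cmod w)\<^sup>2) ^ i / fact i))"
      unfolding p b by (simp add: binomial_gbinomial[symmetric] mult_ac)
    finally show "of_nat (n choose (n - i)) * cnj w ^ (n - (n - i)) * (- w) ^ (k - (n - i)) / fact (k - (n - i)) =
      (- w) ^ (k - n) * of_real (fact n / fact k * ((- 1) ^ i * (real k gchoose (n - i)) * ((cmod w)\<^sup>2) ^ i / fact i))" .
  qed
  finally show ?thesis by (simp only: laguerre_def sum_distrib_left of_real_sum) simp
qed

text \<open>For n < k the factor \<open>laguerre_diff\<close> contains t to the power k - n; its
  square outweighs the negative exponent n - k, so one formula serves both cases.\<close>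

lemma hstft_poly_norm_square:
  "(cmod (hstft_poly n k w))\<^sup>2 = ((cmod w)\<^sup>2) powi (int n - int k) * (laguerre_diff k n ((cmod w)\<^sup>2))\<^sup>2"
proof (cases "k \<le> n")
  case True
  then have p: "((cmod w)\<^sup>2) powi (int n - int k) = ((cmod w)\<^sup>2) ^ (n - k)"
    by (simp add: power_int_def nat_diff_distrib)
  show ?thesis unfolding hstft_poly_laguerre_le[OF True] p using True
    by (simp add: laguerre_diff_def norm_mult norm_power power_mult_distrib power_mult[symmetric] mult.commute)
next
  case False
  then have nk: "n < k" by simp
  define t where "t = (cmod w)\<^sup>2"
  define L where "L = fact n / fact k * laguerre n (real k - real n) t"
  \<comment> \<open>At t = 0 both sides vanish, because n < k.\<close>
  have p: "t powi (int n - int k) * t ^ (2 * (k - n)) = t ^ (k - n)"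
  proof (cases "t = 0")
    case False
    have "t powi (int n - int k) = inverse (t ^ (k - n))"
      using nk by (simp add: power_int_def nat_diff_distrib power_inverse)
    then show ?thesis using False by (simp add: mult_2 power_add)
  qed (use nk in \<open>simp add: power_0_left\<close>)
  have sq: "(x ^ (k - n))\<^sup>2 = (x\<^sup>2) ^ (k - n)" for x :: real
    by (simp add: power_mult[symmetric] mult.commute)
  have "cmod (hstft_poly n k w) = cmod w ^ (k - n) * \<bar>L\<bar>"
    unfolding hstft_poly_laguerre_gt[OF nk] t_def[symmetric] L_def[symmetric]
    by (simp only: norm_mult norm_power norm_minus_cancel norm_of_real)
  then have "(cmod (hstft_poly n k w))\<^sup>2 = t ^ (k - n) * L\<^sup>2"
    unfolding t_def by (simp only: power_mult_distrib sq power2_abs)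
  moreover have "laguerre_diff k n t = (- t) ^ (k - n) * L"
    using nk by (simp add: laguerre_diff_def L_def)
  then have "(laguerre_diff k n t)\<^sup>2 = t ^ (2 * (k - n)) * L\<^sup>2"
    by (simp only: power_mult_distrib sq power2_minus power_mult)
  ultimately show ?thesis unfolding t_def[symmetric] by (simp only: p mult.assoc[symmetric])
qed

lemma sqr_moduli_phase_point: "sqr_moduli z $ j = (cmod (phase_point j z))\<^sup>2"
  by (simp add: sqr_moduli_nth phase_point_def norm_mult power_mult_distrib cmod_power2)

text \<open>On the diagonal every coordinate contributes a squared modulus, which
  \<open>hstft_poly_norm_square\<close> identifies as the Laguerre weight.\<close>

lemma feature_hermite_same:
  "feature n k (hermite n) z = of_real (multi_fact k / multi_fact n) * of_real (eigen_weight n k (sqr_moduli z))"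
proof -
  have c: "(\<Prod>j\<in>UNIV. sqrt (fact (k $ j) / fact (n $ j)) * sqrt (fact (k $ j) / fact (n $ j))) = multi_fact k / multi_fact n"
    by (simp add: multi_fact_def prod_dividef)
  have "(\<Prod>j\<in>UNIV. hstft_poly (n $ j) (k $ j) (phase_point j z) * cnj (hstft_poly (n $ j) (k $ j) (phase_point j z))) * phase_gauss z =
     of_real ((\<Prod>j\<in>UNIV. (cmod (hstft_poly (n $ j) (k $ j) (phase_point j z)))\<^sup>2) * (\<Prod>j\<in>UNIV. exp (- (cmod (phase_point j z))\<^sup>2)))"
    unfolding complex_norm_square[symmetric] phase_gauss_eq by simp
  also have "(\<Prod>j\<in>UNIV. (cmod (hstft_poly (n $ j) (k $ j) (phase_point j z)))\<^sup>2) * (\<Prod>j\<in>UNIV. exp (- (cmod (phase_point j z))\<^sup>2)) = eigen_weight n k (sqr_moduli z)"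
    unfolding eigen_weight_def hstft_poly_norm_square sqr_moduli_phase_point prod.distrib prod_power_distrib[symmetric]
    by (simp add: exp_sum[symmetric] sum_negf mult_ac)
  finally show ?thesis unfolding feature_hermite c by simp
qed

section \<open>Eigenvalues\<close>

lemma L2_inner_integrable:
  assumes "f \<in> L2" "h \<in> L2"
  shows "integrable lborel (\<lambda>t. f t * cnj (h t))"
proof -
  have [measurable]: "f \<in> borel_measurable borel" "h \<in> borel_measurable borel" using assms by (auto simp: L2_def)
  have "integrable lborel (\<lambda>t. cmod (f t) * cmod (h t))"
    using assms by (intro integrable_L2_mult) (auto simp: L2_def)
  then show ?thesis
    by (rule Bochner_Integration.integrable_bound) (auto simp: norm_mult)
qed

lemma L2_inner_add_right:
  assumes "f \<in> L2" "g \<in> L2" "h \<in> L2"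
  shows "L2_inner f (\<lambda>t. g t + h t) = L2_inner f g + L2_inner f h"
  using L2_inner_integrable[OF assms(1,2)] L2_inner_integrable[OF assms(1,3)]
  by (simp add: L2_inner_def distrib_left)

lemma L2_inner_scale_right: "L2_inner f (\<lambda>t. c * g t) = cnj c * L2_inner f g"
  unfolding L2_inner_def by (simp add: mult.left_commute[of _ "cnj c"])

lemma L2_inner_scale_left: "L2_inner (\<lambda>t. c * f t) g = c * L2_inner f g"
  unfolding L2_inner_def by (simp add: mult.assoc)

text \<open>The form with \<epsilon> matches \<open>feature_S0\<close>, so that both parts of the
  defect in \<open>pairing_feature_eigen\<close> are bounded by multiples of the same
  \<epsilon>.\<close>

lemma L2_inner_small:
  assumes "f \<in> L2" "h \<in> L2" "\<epsilon> > 0" "(LINT t|lborel. (cmod (h t))\<^sup>2) \<le> \<epsilon>\<^sup>2"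
  shows "cmod (L2_inner f h) \<le> ((LINT t|lborel. (cmod (f t))\<^sup>2) + 1) * \<epsilon>"
proof -
  have "cmod (L2_inner f h) \<le> (LINT t|lborel. (cmod (f t))\<^sup>2 * \<epsilon> + (cmod (h t))\<^sup>2 / \<epsilon>)"
    unfolding L2_inner_def
  proof (rule Bochner_Integration.integral_norm_bound_integral)
    show "integrable lborel (\<lambda>t. f t * cnj (h t))" by (rule L2_inner_integrable[OF assms(1,2)])
    show "integrable lborel (\<lambda>t. (cmod (f t))\<^sup>2 * \<epsilon> + (cmod (h t))\<^sup>2 / \<epsilon>)"
      using assms by (auto simp: L2_def)
    fix t
    let ?a = "cmod (f t)" and ?b = "cmod (h t)"
    have "2 * (?a * \<epsilon> * ?b) \<le> (?a * \<epsilon>)\<^sup>2 + ?b\<^sup>2"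
      using sum_squares_bound[of "?a * \<epsilon>" "?b"] by simp
    moreover have "0 \<le> ?a * \<epsilon> * ?b" using assms(3) by simp
    moreover have "(?a\<^sup>2 * \<epsilon> + ?b\<^sup>2 / \<epsilon>) * \<epsilon> = (?a * \<epsilon>)\<^sup>2 + ?b\<^sup>2"
      using assms(3) by (simp add: field_simps power2_eq_square)
    ultimately have "(?a * ?b) * \<epsilon> \<le> (?a\<^sup>2 * \<epsilon> + ?b\<^sup>2 / \<epsilon>) * \<epsilon>"
      by (simp only: mult.assoc mult.commute[of \<epsilon>])
    then show "norm (f t * cnj (h t)) \<le> ?a\<^sup>2 * \<epsilon> + ?b\<^sup>2 / \<epsilon>"
      using assms(3) by (simp only: mult_le_cancel_right_pos norm_mult complex_mod_cnj)
  qed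
  also have "\<dots> = (LINT t|lborel. (cmod (f t))\<^sup>2) * \<epsilon> + (LINT t|lborel. (cmod (h t))\<^sup>2) / \<epsilon>"
    using assms by (subst Bochner_Integration.integral_add) (auto simp: L2_def)
  also have "\<dots> \<le> (LINT t|lborel. (cmod (f t))\<^sup>2) * \<epsilon> + \<epsilon>\<^sup>2 / \<epsilon>"
    using assms by (intro add_left_mono divide_right_mono) auto
  also have "\<dots> = ((LINT t|lborel. (cmod (f t))\<^sup>2) + 1) * \<epsilon>"
    using assms(3) by (simp add: power2_eq_square algebra_simps)
  finally show ?thesis .
qed

lemma feature_eq: "feature n k h z = (LINT t|lborel. cnj (h t) * feature_kernel n k t z)"
  using feature_mult_eq[of n k h z 1] by simp

lemma feature_add:
  assumes "g \<in> L2" "h \<in> L2"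
  shows "feature n k (\<lambda>t. g t + h t) = (\<lambda>z. feature n k g z + feature n k h z)"
proof
  fix z
  obtain G H where GH: "\<And>t z. cmod (feature_kernel n k t z) \<le> G t * H z" "\<And>t. G t \<ge> 0" "\<And>z. H z \<ge> 0"
     "G \<in> borel_measurable borel" "integrable lborel (\<lambda>t. (G t)\<^sup>2)"
    using feature_kernel_bound[of n k] by blast
  have i: "integrable lborel (\<lambda>t. cnj (h t) * feature_kernel n k t z)" if h: "h \<in> L2" for h
  proof (rule Bochner_Integration.integrable_bound)
    show "integrable lborel (\<lambda>t. H z * (cmod (h t) * G t))"
      by (intro integrable_mult_right integrable_L2_mult h GH)
    have [measurable]: "h \<in> borel_measurable borel" using h by (simp add: L2_def)
    show "(\<lambda>t. cnj (h t) * feature_kernel n k t z) \<in> borel_measurable lborel" by measurable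
    have "cmod (h t) * cmod (feature_kernel n k t z) \<le> cmod (h t) * (G t * H z)" for t
      by (intro mult_left_mono GH) auto
    then have "norm (cnj (h t) * feature_kernel n k t z) \<le> H z * (cmod (h t) * G t)" for t
      by (simp add: norm_mult mult_ac)
    then show "AE t in lborel. norm (cnj (h t) * feature_kernel n k t z) \<le> norm (H z * (cmod (h t) * G t))"
      by (intro AE_I2) (auto intro: order_trans[OF _ abs_ge_self])
  qed
  show "feature n k (\<lambda>t. g t + h t) z = feature n k g z + feature n k h z"
    unfolding feature_eq using i[OF assms(1)] i[OF assms(2)] by (simp add: distrib_right)
qed

lemma feature_scale: "feature n k (\<lambda>t. c * h t) = (\<lambda>z. cnj c * feature n k h z)"
  unfolding feature_eq by (simp add: mult.assoc fun_eq_iff)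

section \<open>Linearity of the pairing and the eigenvalue identity\<close>

lemma pairing_scale:
  assumes "F \<in> S0_dual" "regular_distr f \<in> S0"
  shows "pairing F (\<lambda>z. c * f z) = c * pairing F f"
  using assms unfolding pairing_def regular_distr_scale S0_dual_def by blast

text \<open>Additivity of \<open>F\<close> refers to sums of distributions; integrability identifies
  such a sum with the regular distribution of the sum of the functions.\<close>

lemma pairing_add:
  assumes "F \<in> S0_dual" "regular_distr f \<in> S0" "regular_distr g \<in> S0" "integrable lborel f" "integrable lborel g"
  shows "pairing F (\<lambda>z. f z + g z) = pairing F f + pairing F g"
  using assms unfolding pairing_def regular_distr_add[OF assms(4,5)] S0_dual_def by blast

lemma feature_in_S0: "h \<in> L2 \<Longrightarrow> regular_distr (feature n k h) \<in> S0"
  using feature_S0[of n k] by blast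

text \<open>A rotation in one coordinate in which the indices differ multiplies the feature function by \<open>-1\<close>.\<close>

lemma pairing_feature_off_diagonal:
  fixes F :: "'d::finite phase distr \<Rightarrow> complex"
  assumes "F \<in> S0_dual" "polyradial (pairing F)" "n \<noteq> m"
  shows "pairing F (feature n k (hermite m)) = 0"
proof -
  obtain i where i: "n $ i \<noteq> m $ i" using assms(3) by (auto simp: vec_eq_iff)
  define \<theta> where "\<theta> = (\<chi> j. if j = i then pi / (real (m $ i) - real (n $ i)) else 0)"
  have "(\<Prod>j\<in>UNIV. cis (\<theta> $ j * (real (m $ j) - real (n $ j)))) = (\<Prod>j\<in>UNIV. if j = i then -1 else 1)"
  proof (intro prod.cong refl)
    fix j
    have "real (m $ i) - real (n $ i) \<noteq> 0" using i by simp
    then show "cis (\<theta> $ j * (real (m $ j) - real (n $ j))) = (if j = i then -1 else 1)"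
      by (simp add: \<theta>_def)
  qed
  then have r: "feature n k (hermite m) (rotate_phase \<theta> z) = (-1) * feature n k (hermite m) z" for z
    unfolding feature_hermite_rotate by simp
  have "pairing F (feature n k (hermite m)) = pairing F (\<lambda>z. feature n k (hermite m) (rotate_phase \<theta> z))"
    using assms(2) feature_hermite_schwartz unfolding polyradial_def by metis
  also have "\<dots> = (-1) * pairing F (feature n k (hermite m))"
    unfolding r by (rule pairing_scale[OF assms(1) feature_in_S0[OF hermite_L2]])
  finally show ?thesis by simp
qed

text \<open>Reading \<open>feature_hermite_same\<close> backwards exhibits the weight as a multiple
  of a feature function, which supplies smoothness and decay even where negative exponents
  occur.\<close>

lemma eigen_weight_sqr_moduli:
  "(\<lambda>z. of_real (eigen_weight n k (sqr_moduli z))) = (\<lambda>z. of_real (multi_fact n / multi_fact k) * feature n k (hermite n) z)"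
proof -
  have "multi_fact n \<noteq> 0" "multi_fact k \<noteq> 0" by (auto simp: multi_fact_def)
  then show ?thesis unfolding feature_hermite_same by auto
qed

lemma eigen_weight_schwartz: "(\<lambda>z. of_real (eigen_weight n k (sqr_moduli z))) \<in> schwartz"
  unfolding eigen_weight_sqr_moduli by (rule schwartz_scale[OF feature_hermite_schwartz])

lemma eigenvalue_sqr_moduli:
  "eigenvalue n k F = of_real (multi_fact k / multi_fact n) * pairing F (\<lambda>z. of_real (eigen_weight n k (sqr_moduli z)))"
  by (simp add: eigenvalue_def sqr_moduli_def)

lemma pairing_feature_diagonal:
  assumes "F \<in> S0_dual"
  shows "pairing F (feature n k (hermite n)) = eigenvalue n k F"
proof -
  have "multi_fact n \<noteq> 0" "multi_fact k \<noteq> 0" by (auto simp: multi_fact_def)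
  then show ?thesis
    unfolding eigenvalue_sqr_moduli eigen_weight_sqr_moduli pairing_scale[OF assms feature_in_S0[OF hermite_L2]]
    by simp
qed

text \<open>The defect \<open>N\<close> of the identity is conjugate-linear, vanishes on Hermite
  sums, and is bounded by a multiple of the norm in \<open>L2\<close>: \<open>feature_S0\<close> and
  the continuity of \<open>F\<close> on \<open>S0\<close> control one part,
  \<open>L2_inner_small\<close> the other. Density then gives \<open>N h\<close> = 0.\<close>

lemma pairing_feature_eigen:
  fixes F :: "'d::finite phase distr \<Rightarrow> complex"
  assumes F: "F \<in> S0_dual" "polyradial (pairing F)" and h: "h \<in> L2"
  shows "pairing F (feature n k h) = eigenvalue n k F * L2_inner (hermite n) h"
proof -
  define N where "N h = pairing F (feature n k h) - eigenvalue n k F * L2_inner (hermite n) h" for h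
  have N_add: "N (\<lambda>t. f t + g t) = N f + N g" if "f \<in> L2" "g \<in> L2" for f g
    unfolding N_def feature_add[OF that] L2_inner_add_right[OF hermite_L2 that]
    by (subst pairing_add[OF F(1)]) (simp_all add: that feature_in_S0 feature_integrable algebra_simps)
  have N_scale: "N (\<lambda>t. c * f t) = cnj c * N f" if "f \<in> L2" for c f
    unfolding N_def feature_scale L2_inner_scale_right pairing_scale[OF F(1) feature_in_S0[OF that]]
    by (simp add: algebra_simps)
  have N_hermite: "N (hermite m) = 0" for m
    unfolding N_def using pairing_feature_off_diagonal[OF F] pairing_feature_diagonal[OF F(1)]
    by (simp add: hermite_orthonormal)
  have N_sum: "N (hermite_sum I a) = 0" if "finite I" for I a
    using that
  proof (induction I rule: finite_induct)
    case empty
    have "hermite_sum {} a = (\<lambda>t. 0 * hermite 0 t)" by (simp add: hermite_sum_def)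
    then show ?case using N_scale[OF hermite_L2, of 0 0] by (simp add: hermite_sum_def)
  next
    case (insert i I)
    have "hermite_sum (insert i I) a = (\<lambda>t. a i * hermite i t + hermite_sum I a t)"
      using insert.hyps by (simp add: hermite_sum_def fun_eq_iff)
    then show ?case
      using N_add[OF L2_scale[OF hermite_L2] hermite_sum_L2] N_scale[OF hermite_L2] N_hermite insert.IH by simp
  qed
  obtain K where K: "K \<ge> 0" "\<And>h \<epsilon>. h \<in> L2 \<Longrightarrow> \<epsilon> > 0 \<Longrightarrow> (LINT t|lborel. (cmod (h t))\<^sup>2) \<le> \<epsilon>\<^sup>2 \<Longrightarrow> S0_norm (regular_distr (feature n k h)) \<le> K * \<epsilon>"
    using feature_S0[of n k] by blast
  obtain C where C: "\<And>u. u \<in> S0 \<Longrightarrow> cmod (F u) \<le> C * S0_norm u"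
    using F(1) unfolding S0_dual_def by blast
  define M where "M = \<bar>C\<bar> * K + cmod (eigenvalue n k F) * ((LINT t|lborel. (cmod (hermite n t))\<^sup>2) + 1)"
  have "M \<ge> 0" unfolding M_def using K(1) by simp
  have small: "cmod (N r) \<le> M * \<epsilon>" if r: "r \<in> L2" and e: "\<epsilon> > 0" "(LINT t|lborel. (cmod (r t))\<^sup>2) \<le> \<epsilon>\<^sup>2" for r \<epsilon>
  proof -
    have "S0_norm u \<ge> 0" for u :: "'d phase distr" unfolding S0_norm_def by simp
    then have "C * S0_norm (regular_distr (feature n k r)) \<le> \<bar>C\<bar> * (K * \<epsilon>)"
      using K(2)[OF r e] by (intro mult_mono) auto
    then have 1: "cmod (pairing F (feature n k r)) \<le> \<bar>C\<bar> * (K * \<epsilon>)"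
      using C[OF feature_in_S0[OF r, of n k]] unfolding pairing_def by linarith
    have 2: "cmod (eigenvalue n k F * L2_inner (hermite n) r) \<le> cmod (eigenvalue n k F) * (((LINT t|lborel. (cmod (hermite n t))\<^sup>2) + 1) * \<epsilon>)"
      unfolding norm_mult by (intro mult_left_mono L2_inner_small hermite_L2 r e) auto
    have "cmod (N r) \<le> \<bar>C\<bar> * (K * \<epsilon>) + cmod (eigenvalue n k F) * (((LINT t|lborel. (cmod (hermite n t))\<^sup>2) + 1) * \<epsilon>)"
      unfolding N_def by (rule order_trans[OF norm_triangle_ineq4 add_mono[OF 1 2]])
    then show ?thesis by (simp add: M_def algebra_simps)
  qed
  have "cmod (N h) \<le> e" if e: "e > 0" for e
  proof -
    \<comment> \<open>The divisor M + 1 is positive even if M = 0, and it brings the final bound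
      down to e.\<close>
    define \<epsilon> where "\<epsilon> = e / (M + 1)"
    have \<epsilon>: "\<epsilon> > 0" unfolding \<epsilon>_def using e \<open>M \<ge> 0\<close> by simp
    then have "\<epsilon>\<^sup>2 > 0" by simp
    then obtain I a where I: "finite I" "L2_dist2 h (hermite_sum I a) < \<epsilon>\<^sup>2"
      using hermite_closureD[OF hermite_complete[OF h]] by blast
    define r where "r t = h t - hermite_sum I a t" for t
    have r: "r \<in> L2" unfolding r_def[abs_def] by (intro L2_diff h hermite_sum_L2)
    have "N h = N (\<lambda>t. r t + hermite_sum I a t)" by (simp add: r_def)
    also have "\<dots> = N r" using N_add[OF r hermite_sum_L2] N_sum[OF I(1)] by simp
    finally have "cmod (N h) \<le> M * \<epsilon>"
      using small[OF r \<epsilon>] I(2) by (simp add: L2_dist2_def r_def)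
    also have "\<dots> \<le> (M + 1) * \<epsilon>" using \<epsilon> by (intro mult_right_mono) auto
    also have "\<dots> = e" unfolding \<epsilon>_def using \<open>M \<ge> 0\<close> by simp
    finally show ?thesis .
  qed
  then have "cmod (N h) \<le> 0" by (rule field_le_epsilon[of _ 0, simplified])
  then show ?thesis unfolding N_def by simp
qed

theorem proposition4p4:
  fixes F :: "'d::finite phase distr \<Rightarrow> complex"
    and k :: "nat ^ 'd"
  assumes "F \<in> EFG"
    and "polyradial (pairing F)"
  shows "orthonormal_basis_L2 (hermite :: nat ^ 'd \<Rightarrow> real ^ 'd \<Rightarrow> complex) \<and>
    (\<forall>n c. has_localization F (hermite k) (hermite n) (\<lambda>t. c * hermite n t)
        \<longleftrightarrow> c = eigenvalue n k F) \<and>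
    (\<forall>F0. polyradial_representation F F0 \<longrightarrow>
        (\<forall>n. eigenvalue n k F = of_real (multi_fact k / multi_fact n) *
           (LINT u:Vd|lborel. of_real (eigen_weight n k u) * F0 (\<chi> j. sqrt (u $ j / pi)))))"
proof (intro conjI allI impI)
  show "orthonormal_basis_L2 (hermite :: nat ^ 'd \<Rightarrow> real ^ 'd \<Rightarrow> complex)"
    by (rule hermite_orthonormal_basis)
next
  have F: "F \<in> S0_dual" using assms(1) by (simp add: EFG_def)
  fix n c
  have f: "(\<lambda>z. stft (hermite k) (hermite n) z * cnj (stft (hermite k) h z)) = feature n k h" for h
    by (simp add: feature_def[abs_def])
  show "has_localization F (hermite k) (hermite n) (\<lambda>t. c * hermite n t) \<longleftrightarrow> c = eigenvalue n k F"
  proof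
    assume "has_localization F (hermite k) (hermite n) (\<lambda>t. c * hermite n t)"
    \<comment> \<open>Testing against \<open>hermite n\<close> alone already determines c, by
      orthonormality.\<close>
    then have "L2_inner (\<lambda>t. c * hermite n t) (hermite n) = pairing F (feature n k (hermite n))"
      using hermite_L2[of n] unfolding has_localization_def f by blast
    then show "c = eigenvalue n k F"
      by (simp add: L2_inner_scale_left hermite_orthonormal pairing_feature_diagonal[OF F])
  next
    assume "c = eigenvalue n k F"
    \<comment> \<open>The converse is the weak identity against every \<open>h\<close> in
      \<open>L2\<close>, which is where completeness enters through
      \<open>pairing_feature_eigen\<close>.\<close>
    then show "has_localization F (hermite k) (hermite n) (\<lambda>t. c * hermite n t)"
      unfolding has_localization_def f
      by (simp add: hermite_L2 L2_scale feature_in_S0 L2_inner_scale_left pairing_feature_eigen[OF F assms(2)])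
  qed
next
  fix F0 n
  assume "polyradial_representation F F0"
  from pairing_polyradial[OF this eigen_weight_schwartz]
  show "eigenvalue n k F = of_real (multi_fact k / multi_fact n) *
           (LINT u:Vd|lborel. of_real (eigen_weight n k u) * F0 (\<chi> j. sqrt (u $ j / pi)))"
    unfolding eigenvalue_sqr_moduli by simp
qed

end
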